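(* Let $(\mathfrak{A},\varphi,\beta)$ be a von Neumann dynamical system, let $H$ be the GNS-space pertaining to $\varphi$, and let $u\in\mathcal{L}(H)$ be a unitary operator with $\beta(a)=uau^{-1}$ for all $a\in\mathfrak{A}$. Let further $r,k\in\mathbb{N}^+$ with $r\le k$, let $\alpha:\{1,\ldots,k\}\to\{1,\ldots,r\}$ be a surjective mapping, let $p_1,\ldots,p_r\in\mathcal{P}$, and for $n_1,\ldots,n_r\in\mathbb{N}^+$ and $1\le l\le k$ let $s_l:=\sum_{d=1}^l p_{\alpha(d)}(n_{\alpha(d)})$. Assume that $a_1,\ldots,a_k\in\mathfrak{A}$ are such that $\{a_ku^{-n}:n\in\mathbb{N}^+\}$ is relatively compact in $\mathcal{L}(H)$ for the strong operator topology, and $\{a_ju^n:n\in\mathbb{N}^+\}$ is relatively compact in $\mathcal{L}(H)$ for the strong operator topology for every $1\le j\le k-1$. Then the polynomial multiple averages \[ \frac{1}{N^r}\sum_{n_1,\ldots,n_r=1}^N \beta^{s_1}(a_1)\beta^{s_2}(a_2)\cdots\beta^{s_k}(a_k) \] converge strongly as $N\to\infty$.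
   Context: $\mathbb{N}^+$ denotes the positive integers and $\mathbb{N}_0$ the nonnegative integers. $\mathcal{P}\subset\mathbb{Z}[X]$ is the set of all polynomials with integer coefficients mapping $\mathbb{N}^+$ into $\mathbb{N}_0$. $\mathcal{L}(H)$ is the space of bounded linear operators on $H$. A von Neumann dynamical system is a triple $(\mathfrak{A},\varphi,\beta)$, where $\mathfrak{A}$ is a von Neumann algebra, $\varphi:\mathfrak{A}\to\mathbb{C}$ is a faithful normal trace, and $\beta:\mathfrak{A}\to\mathfrak{A}$ is a $\varphi$-preserving $*$-automorphism. A sequence $(b_n)_{n\in\mathbb{N}^+}$ in $\mathfrak{A}$ converges strongly if it converges in the $\varphi$-norm $\|b\|_\varphi:=\sqrt{\varphi(b^*b)}$. The GNS-space $H$ is the Hilbert space obtained as the completion of $\mathfrak{A}$ with respect to $\|\cdot\|_\varphi$; $\mathfrak{A}$ is identified with a dense subspace of $H$, and also acts on $H$ (by extending left multiplication), so elements of $\mathfrak{A}$ are regarded as operators in $\mathcal{L}(H)$. A unitary $u\in\mathcal{L}(H)$ with $\beta(a)=uau^{-1}$ for all $a\in\mathfrak{A}$ always exists, and need not belong to $\mathfrak{A}$. *)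

theory Defs
  imports "HOL-Analysis.Analysis" "HOL-Computational_Algebra.Polynomial"
begin

text \<open>Complex Hilbert spaces, with inner product linear in the first argument.
  Positive definiteness is contained in \<open>cinner_self\<close>, completeness in \<^class>\<open>banach\<close>.\<close>

class chilbert = banach +
  fixes scaleC :: "complex \<Rightarrow> 'a \<Rightarrow> 'a"  (infixr "*\<^sub>C" 75)
    and cinner :: "'a \<Rightarrow> 'a \<Rightarrow> complex"
  assumes scaleC_add_right: "c *\<^sub>C (x + y) = c *\<^sub>C x + c *\<^sub>C y"
    and scaleC_add_left: "(c + d) *\<^sub>C x = c *\<^sub>C x + d *\<^sub>C x"
    and scaleC_scaleC: "c *\<^sub>C (d *\<^sub>C x) = (c * d) *\<^sub>C x"
    and scaleC_of_real: "(complex_of_real r) *\<^sub>C x = r *\<^sub>R x"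
    and cinner_commute: "cinner x y = cnj (cinner y x)"
    and cinner_add_left: "cinner (x + y) z = cinner x z + cinner y z"
    and cinner_scaleC_left: "cinner (c *\<^sub>C x) y = c * cinner x y"
    and cinner_self: "cinner x x = complex_of_real ((norm x)\<^sup>2)"

lemma norm_scaleC: "norm (c *\<^sub>C x) = cmod c * norm (x :: 'a::chilbert)"
proof -
  have r: "cinner x (d *\<^sub>C y) = cnj d * cinner x y" for d and x y :: 'a
    by (metis cinner_commute cinner_scaleC_left complex_cnj_mult)
  have "cinner (c *\<^sub>C x) (c *\<^sub>C x) = (c * cnj c) * cinner x x"
    by (simp add: cinner_scaleC_left r)
  then have "complex_of_real ((norm (c *\<^sub>C x))\<^sup>2) = complex_of_real ((cmod c * norm x)\<^sup>2)"
    by (simp only: cinner_self complex_norm_square [symmetric] of_real_mult [symmetric]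
        power_mult_distrib)
  then have "(norm (c *\<^sub>C x))\<^sup>2 = (cmod c * norm x)\<^sup>2"
    by (simp only: of_real_eq_iff)
  then show ?thesis by (simp add: power2_eq_iff_nonneg)
qed

lemma bounded_linear_scaleC: "bounded_linear (\<lambda>x :: 'a::chilbert. c *\<^sub>C x)"
proof (rule bounded_linear_intro)
  show "c *\<^sub>C (x + y) = c *\<^sub>C x + c *\<^sub>C y" for x y :: 'a
    by (rule scaleC_add_right)
  show "c *\<^sub>C (r *\<^sub>R x) = r *\<^sub>R (c *\<^sub>C x)" for r and x :: 'a
    by (simp add: scaleC_of_real [symmetric] scaleC_scaleC mult.commute)
  show "norm (c *\<^sub>C x) \<le> norm x * cmod c" for x :: 'a
    by (simp add: norm_scaleC mult.commute)
qed

text \<open>The type \<open>'a \<Rightarrow>\<^sub>L 'a\<close> consists of the bounded real-linear operators;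
  \<open>bounded_ops\<close> is the space of bounded complex-linear ones.\<close>

definition bounded_ops :: "('a::chilbert \<Rightarrow>\<^sub>L 'a) set" where
  "bounded_ops = {T. \<forall>c x. blinfun_apply T (c *\<^sub>C x) = c *\<^sub>C blinfun_apply T x}"

definition scaleC_op :: "complex \<Rightarrow> ('a::chilbert \<Rightarrow>\<^sub>L 'a) \<Rightarrow> 'a \<Rightarrow>\<^sub>L 'a" where
  "scaleC_op c T = Blinfun (\<lambda>x. c *\<^sub>C blinfun_apply T x)"

lemma scaleC_op_apply: "blinfun_apply (scaleC_op c T) x = c *\<^sub>C blinfun_apply T x"
  unfolding scaleC_op_def
  by (subst bounded_linear_Blinfun_apply)
    (auto intro: bounded_linear_compose [OF bounded_linear_scaleC] blinfun.bounded_linear_right)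

definition is_adjoint :: "('a::chilbert \<Rightarrow>\<^sub>L 'a) \<Rightarrow> ('a \<Rightarrow>\<^sub>L 'a) \<Rightarrow> bool" where
  "is_adjoint S T \<longleftrightarrow> (\<forall>x y. cinner (blinfun_apply T x) y = cinner x (blinfun_apply S y))"

definition adj :: "('a::chilbert \<Rightarrow>\<^sub>L 'a) \<Rightarrow> 'a \<Rightarrow>\<^sub>L 'a" where
  "adj T = (THE S. is_adjoint S T)"

lemma is_adjoint_unique:
  assumes "is_adjoint S T" and "is_adjoint S' T"
  shows "S = S'"
proof (rule blinfun_eqI)
  fix y
  have d: "cinner (x - x') z = cinner x z - cinner x' z" for x x' z :: 'a
    using cinner_add_left [of "x - x'" x' z] by simp
  have "cinner x (blinfun_apply S y) = cinner x (blinfun_apply S' y)" for x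
    using assms by (metis is_adjoint_def)
  then have "cinner (blinfun_apply S y) x = cinner (blinfun_apply S' y) x" for x
    by (metis cinner_commute)
  then have "cinner (blinfun_apply S y - blinfun_apply S' y)
      (blinfun_apply S y - blinfun_apply S' y) = 0"
    by (simp add: d)
  then show "blinfun_apply S y = blinfun_apply S' y"
    by (simp add: cinner_self)
qed

lemma adj_eqI: "is_adjoint S T \<Longrightarrow> adj T = S"
  unfolding adj_def using is_adjoint_unique by blast

definition op_pow :: "('a::real_normed_vector \<Rightarrow>\<^sub>L 'a) \<Rightarrow> nat \<Rightarrow> 'a \<Rightarrow>\<^sub>L 'a" where
  "op_pow T n = ((\<lambda>S. T o\<^sub>L S) ^^ n) id_blinfun"

definition op_inv :: "('a::real_normed_vector \<Rightarrow>\<^sub>L 'a) \<Rightarrow> 'a \<Rightarrow>\<^sub>L 'a" where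
  "op_inv T = (THE S. S o\<^sub>L T = id_blinfun \<and> T o\<^sub>L S = id_blinfun)"

lemma op_inv_eqI:
  assumes "S o\<^sub>L T = id_blinfun" and "T o\<^sub>L S = id_blinfun"
  shows "op_inv T = S"
  unfolding op_inv_def
proof (rule the_equality)
  show "S o\<^sub>L T = id_blinfun \<and> T o\<^sub>L S = id_blinfun"
    using assms by simp
  show "S' = S" if "S' o\<^sub>L T = id_blinfun \<and> T o\<^sub>L S' = id_blinfun" for S'
    using that assms
    by (metis (no_types, opaque_lifting) blinfun_apply_blinfun_compose blinfun_eqI
        blinfun_apply_id_blinfun id_apply)
qed

definition unitary_op :: "('a::chilbert \<Rightarrow>\<^sub>L 'a) \<Rightarrow> bool" where
  "unitary_op U \<longleftrightarrow> U \<in> bounded_ops \<and>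
     (\<exists>V. is_adjoint V U \<and> V o\<^sub>L U = id_blinfun \<and> U o\<^sub>L V = id_blinfun)"

definition op_prod_list :: "('a::real_normed_vector \<Rightarrow>\<^sub>L 'a) list \<Rightarrow> 'a \<Rightarrow>\<^sub>L 'a" where
  "op_prod_list Ts = foldr (o\<^sub>L) Ts id_blinfun"

definition weak_operator_top :: "('a::chilbert \<Rightarrow>\<^sub>L 'a) topology" where
  "weak_operator_top =
     pullback_topology bounded_ops (\<lambda>T (x, y). cinner (blinfun_apply T x) y) euclidean"

text \<open>The ultraweak topology is the initial topology for the functionals
  \<open>T \<mapsto> \<Sum>n. \<langle>T (\<xi> n), \<eta> n\<rangle>\<close> with square-summable \<open>\<xi>\<close>, \<open>\<eta>\<close>.\<close>

definition square_summable_pairs :: "((nat \<Rightarrow> 'a::chilbert) \<times> (nat \<Rightarrow> 'a)) set" where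
  "square_summable_pairs =
     {(\<xi>, \<eta>). summable (\<lambda>n. (norm (\<xi> n))\<^sup>2) \<and> summable (\<lambda>n. (norm (\<eta> n))\<^sup>2)}"

definition ultraweak_top :: "('a::chilbert \<Rightarrow>\<^sub>L 'a) topology" where
  "ultraweak_top =
     pullback_topology bounded_ops
       (\<lambda>T. \<lambda>p\<in>square_summable_pairs. \<Sum>n. cinner (blinfun_apply T (fst p n)) (snd p n))
       (product_topology (\<lambda>_. euclidean) square_summable_pairs)"

definition von_neumann_algebra :: "('a::chilbert \<Rightarrow>\<^sub>L 'a) set \<Rightarrow> bool" where
  "von_neumann_algebra A \<longleftrightarrow>
     A \<subseteq> bounded_ops \<and> id_blinfun \<in> A \<and>
     (\<forall>a\<in>A. \<forall>b\<in>A. a + b \<in> A \<and> a o\<^sub>L b \<in> A) \<and>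
     (\<forall>c. \<forall>a\<in>A. scaleC_op c a \<in> A) \<and>
     (\<forall>a\<in>A. \<exists>b\<in>A. is_adjoint b a) \<and>
     closedin weak_operator_top A"

text \<open>Finite traces are meant: \<open>\<phi>\<close> is complex-valued on all of \<open>A\<close>. It need not be
  normalised. Values of \<open>\<phi>\<close> outside \<open>A\<close> are irrelevant.\<close>

definition faithful_normal_trace ::
    "('a::chilbert \<Rightarrow>\<^sub>L 'a) set \<Rightarrow> (('a \<Rightarrow>\<^sub>L 'a) \<Rightarrow> complex) \<Rightarrow> bool" where
  "faithful_normal_trace A \<phi> \<longleftrightarrow>
     (\<forall>a\<in>A. \<forall>b\<in>A. \<phi> (a + b) = \<phi> a + \<phi> b) \<and>
     (\<forall>c. \<forall>a\<in>A. \<phi> (scaleC_op c a) = c * \<phi> a) \<and>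
     (\<forall>a\<in>A. \<phi> (adj a o\<^sub>L a) \<in> \<real> \<and> 0 \<le> Re (\<phi> (adj a o\<^sub>L a))) \<and>
     (\<forall>a\<in>A. \<phi> (adj a o\<^sub>L a) = 0 \<longrightarrow> a = 0) \<and>
     (\<forall>a\<in>A. \<forall>b\<in>A. \<phi> (a o\<^sub>L b) = \<phi> (b o\<^sub>L a)) \<and>
     continuous_map (subtopology ultraweak_top A) euclidean \<phi>"

definition star_automorphism ::
    "('a::chilbert \<Rightarrow>\<^sub>L 'a) set \<Rightarrow> (('a \<Rightarrow>\<^sub>L 'a) \<Rightarrow> 'a \<Rightarrow>\<^sub>L 'a) \<Rightarrow> bool" where
  "star_automorphism A \<beta> \<longleftrightarrow>
     bij_betw \<beta> A A \<and>
     (\<forall>a\<in>A. \<forall>b\<in>A. \<beta> (a + b) = \<beta> a + \<beta> b) \<and>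
     (\<forall>c. \<forall>a\<in>A. \<beta> (scaleC_op c a) = scaleC_op c (\<beta> a)) \<and>
     (\<forall>a\<in>A. \<forall>b\<in>A. \<beta> (a o\<^sub>L b) = \<beta> a o\<^sub>L \<beta> b) \<and>
     (\<forall>a\<in>A. \<beta> (adj a) = adj (\<beta> a))"

definition von_neumann_dynamical_system ::
    "('a::chilbert \<Rightarrow>\<^sub>L 'a) set \<Rightarrow> (('a \<Rightarrow>\<^sub>L 'a) \<Rightarrow> complex) \<Rightarrow> (('a \<Rightarrow>\<^sub>L 'a) \<Rightarrow> 'a \<Rightarrow>\<^sub>L 'a) \<Rightarrow> bool"
  where
  "von_neumann_dynamical_system A \<phi> \<beta> \<longleftrightarrow>
     von_neumann_algebra A \<and> faithful_normal_trace A \<phi> \<and>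
     star_automorphism A \<beta> \<and> (\<forall>a\<in>A. \<phi> (\<beta> a) = \<phi> a)"

definition trace_norm :: "(('a::chilbert \<Rightarrow>\<^sub>L 'a) \<Rightarrow> complex) \<Rightarrow> ('a \<Rightarrow>\<^sub>L 'a) \<Rightarrow> real" where
  "trace_norm \<phi> b = sqrt (Re (\<phi> (adj b o\<^sub>L b)))"

definition strongly_convergent ::
    "('a::chilbert \<Rightarrow>\<^sub>L 'a) set \<Rightarrow> (('a \<Rightarrow>\<^sub>L 'a) \<Rightarrow> complex) \<Rightarrow> (nat \<Rightarrow> 'a \<Rightarrow>\<^sub>L 'a) \<Rightarrow> bool" where
  "strongly_convergent A \<phi> b \<longleftrightarrow>
     (\<exists>c\<in>A. (\<lambda>n. trace_norm \<phi> (b n - c)) \<longlonglongrightarrow> 0)"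

text \<open>The Hilbert space \<open>'h\<close> is the completion of \<open>A\<close> with respect to the inner product
  \<open>\<phi> (b\<^sup>* a)\<close>: \<open>\<Lambda>\<close> is the dense isometric embedding (which determines \<open>'h\<close> up to a unique
  unitary), and \<open>\<pi> a\<close> is the continuous extension to \<open>'h\<close> of left multiplication by \<open>a\<close>.\<close>

definition gns_space ::
    "('a::chilbert \<Rightarrow>\<^sub>L 'a) set \<Rightarrow> (('a \<Rightarrow>\<^sub>L 'a) \<Rightarrow> complex) \<Rightarrow>
     (('a \<Rightarrow>\<^sub>L 'a) \<Rightarrow> 'h::chilbert) \<Rightarrow> (('a \<Rightarrow>\<^sub>L 'a) \<Rightarrow> 'h \<Rightarrow>\<^sub>L 'h) \<Rightarrow> bool" where
  "gns_space A \<phi> \<Lambda> \<pi> \<longleftrightarrow>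
     (\<forall>a\<in>A. \<forall>b\<in>A. \<Lambda> (a + b) = \<Lambda> a + \<Lambda> b) \<and>
     (\<forall>c. \<forall>a\<in>A. \<Lambda> (scaleC_op c a) = c *\<^sub>C \<Lambda> a) \<and>
     (\<forall>a\<in>A. \<forall>b\<in>A. cinner (\<Lambda> a) (\<Lambda> b) = \<phi> (adj b o\<^sub>L a)) \<and>
     closure (\<Lambda> ` A) = UNIV \<and>
     (\<forall>a\<in>A. \<pi> a \<in> bounded_ops \<and> (\<forall>b\<in>A. blinfun_apply (\<pi> a) (\<Lambda> b) = \<Lambda> (a o\<^sub>L b)))"

definition strongly_relatively_compact :: "('a::chilbert \<Rightarrow>\<^sub>L 'a) set \<Rightarrow> bool" where
  "strongly_relatively_compact S \<longleftrightarrow>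
     (let X = subtopology strong_operator_topology bounded_ops
      in S \<subseteq> bounded_ops \<and> compactin X (X closure_of S))"

definition nonneg_int_polys :: "int poly set" where
  "nonneg_int_polys = {p. \<forall>n::nat. n \<ge> 1 \<longrightarrow> poly p (int n) \<ge> 0}"

definition partial_exponent ::
    "(nat \<Rightarrow> nat) \<Rightarrow> (nat \<Rightarrow> int poly) \<Rightarrow> (nat \<Rightarrow> nat) \<Rightarrow> nat \<Rightarrow> nat" where
  "partial_exponent \<alpha> p n l = nat (\<Sum>d=1..l. poly (p (\<alpha> d)) (int (n (\<alpha> d))))"

definition polynomial_average ::
    "(('a::real_normed_vector \<Rightarrow>\<^sub>L 'a) \<Rightarrow> 'a \<Rightarrow>\<^sub>L 'a) \<Rightarrow> nat \<Rightarrow> nat \<Rightarrow> (nat \<Rightarrow> nat) \<Rightarrow>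
     (nat \<Rightarrow> int poly) \<Rightarrow> (nat \<Rightarrow> 'a \<Rightarrow>\<^sub>L 'a) \<Rightarrow> nat \<Rightarrow> 'a \<Rightarrow>\<^sub>L 'a" where
  "polynomial_average \<beta> r k \<alpha> p a N =
     (1 / real N ^ r) *\<^sub>R
       (\<Sum>n\<in>{1..r} \<rightarrow>\<^sub>E {1..N}.
          op_prod_list (map (\<lambda>l. (\<beta> ^^ partial_exponent \<alpha> p n l) (a l)) [1..<Suc k]))"

end

theory Submission
  imports Defs "HOL-Probability.Helly_Selection" "HOL-Probability.Giry_Monad"
begin

text \<open>With \<open>q\<^sub>l = s\<^sub>l - s\<^sub>l\<^sub>-\<^sub>1\<close>, the averaged products act on \<open>H\<close> as
  \<open>u\<^sup>q\<^sup>1 a\<^sub>1 u\<^sup>q\<^sup>2 a\<^sub>2 \<dots> u\<^sup>q\<^sup>k a\<^sub>k u\<^sup>-\<^sup>s\<^sup>k\<close>. By compactness, the vector to the right of each power of \<open>u\<close>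
  stays in a totally bounded set, so it is uniformly close to its projection onto a finite-dimensional
  space; this replaces the products by finite sums of products of matrix coefficients
  \<open>\<langle>u\<^sup>m x, y\<rangle>\<close> times \<open>u\<^sup>q\<^sup>1 e\<close>. By Herglotz' theorem each coefficient is a combination of Fourier transforms of
  measures, and dominated convergence reduces everything to averages of the scalar phases
  \<open>exp (i \<theta> p(n))\<close>, which converge by Weyl's theorem.

  The limit in \<open>H\<close> comes from the algebra because \<open>*\<close>-automorphisms are contractive:
  the averages are bounded in norm, so they have a weak operator cluster point, and by normality of
  the trace its image in \<open>H\<close> is the limit.\<close>

section \<open>Hilbert spaces\<close>

text \<open>One variable may drive several exponents, and \<open>u\<close> need not fix the vector
  of the unit, so the operator averages neither factor over the variables nor allow limits to be
  taken one power at a time. Convergence is therefore demanded for all twists by phases from a real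
  vector space \<open>\<Psi>\<close>: a Fourier integral over \<open>t\<close> of
  \<open>cis (t * s n)\<close> merely moves a phase \<psi> to \<psi> + t s, so functions with this
  stronger property can be multiplied by matrix coefficients, and the product can be built up from
  right to left. The hypotheses follow the telescoped product: its rightmost power is the negative
  one, hence \<open>a k\<close> is paired with inverse powers, while each earlier \<open>a j\<close>
  meets the power with exponent \<open>q (j + 1)\<close>; the leftmost power has no operator before
  it. The Hilbert spaces may be nonseparable, which is why integrands are kept real or complex
  valued and why cluster points are taken along filters rather than subsequences.\<close>

lemma cinner_add_right: "cinner x (y + z) = cinner x y + cinner x (z :: 'a::chilbert)"
  by (metis cinner_add_left cinner_commute complex_cnj_add)

lemma cinner_scaleC_right: "cinner x (c *\<^sub>C y) = cnj c * cinner x (y :: 'a::chilbert)"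
  by (metis cinner_commute cinner_scaleC_left complex_cnj_mult)

lemma scaleC_one [simp]: "1 *\<^sub>C x = (x :: 'a::chilbert)"
  using scaleC_of_real[of 1 x] by simp

lemma scaleC_zero_left [simp]: "0 *\<^sub>C x = (0 :: 'a::chilbert)"
  using scaleC_of_real[of 0 x] by simp

lemma scaleC_zero_right [simp]: "c *\<^sub>C 0 = (0 :: 'a::chilbert)"
  by (metis add_cancel_right_right scaleC_add_right)

lemma scaleC_diff_right: "c *\<^sub>C (x - y) = c *\<^sub>C x - c *\<^sub>C (y :: 'a::chilbert)"
  by (metis add_diff_cancel diff_add_cancel scaleC_add_right)

lemma scaleC_diff_left: "(c - d) *\<^sub>C x = c *\<^sub>C x - d *\<^sub>C (x :: 'a::chilbert)"
  by (metis add_diff_cancel diff_add_cancel scaleC_add_left)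

lemma scaleR_scaleC: "r *\<^sub>R x = complex_of_real r *\<^sub>C (x :: 'a::chilbert)"
  by (simp add: scaleC_of_real)

lemma scaleC_scaleR: "c *\<^sub>C (r *\<^sub>R x) = r *\<^sub>R (c *\<^sub>C (x :: 'a::chilbert))"
  by (simp add: scaleR_scaleC scaleC_scaleC mult.commute)

lemma scaleR_scaleC_left: "(r *\<^sub>R c) *\<^sub>C x = r *\<^sub>R (c *\<^sub>C (x :: 'a::chilbert))"
  by (simp add: scaleR_scaleC scaleC_scaleC scaleR_conv_of_real)

lemma cinner_scaleR_left: "cinner (r *\<^sub>R x) y = r *\<^sub>R cinner x (y :: 'a::chilbert)"
  by (simp add: scaleR_scaleC cinner_scaleC_left scaleR_conv_of_real)

lemma cinner_scaleR_right: "cinner x (r *\<^sub>R y) = r *\<^sub>R cinner x (y :: 'a::chilbert)"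
  by (simp add: scaleR_scaleC cinner_scaleC_right scaleR_conv_of_real)

lemma norm_add_sq:
  "(norm (x + y))\<^sup>2 = (norm x)\<^sup>2 + 2 * Re (cinner x y) + (norm (y :: 'a::chilbert))\<^sup>2"
proof -
  have "complex_of_real ((norm (x + y))\<^sup>2)
      = cinner x x + (cinner x y + cnj (cinner x y)) + cinner y y"
    unfolding cinner_commute[of y x, symmetric]
    by (simp only: cinner_self[symmetric] cinner_add_left cinner_add_right add_ac)
  then have "Re (complex_of_real ((norm (x + y))\<^sup>2))
      = Re (cinner x x + (cinner x y + cnj (cinner x y)) + cinner y y)" by simp
  then show ?thesis by (simp add: cinner_self)
qed

lemma cinner_cauchy_schwarz: "cmod (cinner x y) \<le> norm x * norm (y :: 'a::chilbert)"
proof (cases "norm y = 0")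
  case True
  then have y: "y = 0" by simp
  have "cinner x (0 *\<^sub>C y) = 0" by (simp only: cinner_scaleC_right) simp
  then show ?thesis using y by simp
next
  case False
  \<comment> \<open>This \<open>c\<close> makes \<open>x + c *\<^sub>C y\<close> orthogonal to
    \<open>y\<close>, hence minimises its norm.\<close>
  define c where "c = - cinner x y / complex_of_real ((norm y)\<^sup>2)"
  have n: "(norm y)\<^sup>2 > 0" using False by simp
  have "0 \<le> (norm (x + c *\<^sub>C y))\<^sup>2" by simp
  also have "\<dots> = (norm x)\<^sup>2 + 2 * Re (cnj c * cinner x y) + (cmod c)\<^sup>2 * (norm y)\<^sup>2"
    by (simp add: norm_add_sq cinner_scaleC_right norm_scaleC power_mult_distrib)
  also have "Re (cnj c * cinner x y) = - (cmod (cinner x y))\<^sup>2 / (norm y)\<^sup>2"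
  proof -
    have "cnj c * cinner x y = - (cinner x y * cnj (cinner x y)) / complex_of_real ((norm y)\<^sup>2)"
      by (simp add: c_def)
    also have "\<dots> = complex_of_real (- (cmod (cinner x y))\<^sup>2 / (norm y)\<^sup>2)"
      by (simp add: complex_norm_square[symmetric])
    finally show ?thesis by (simp only: Re_complex_of_real)
  qed
  also have "(cmod c)\<^sup>2 * (norm y)\<^sup>2 = (cmod (cinner x y))\<^sup>2 / (norm y)\<^sup>2"
    using n by (simp add: c_def norm_divide power_divide power2_eq_square norm_mult)
  finally have "(cmod (cinner x y))\<^sup>2 / (norm y)\<^sup>2 \<le> (norm x)\<^sup>2" by simp
  then have "(cmod (cinner x y))\<^sup>2 \<le> (norm x * norm y)\<^sup>2"
    using n by (simp add: divide_le_eq power_mult_distrib)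
  then show ?thesis by (rule power2_le_imp_le) simp
qed

lemma bounded_bilinear_cinner: "bounded_bilinear (cinner :: 'a::chilbert \<Rightarrow> 'a \<Rightarrow> complex)"
  by (rule bounded_bilinear.intro)
    (auto simp: cinner_add_left cinner_add_right cinner_scaleR_left cinner_scaleR_right
      intro!: exI[of _ 1] cinner_cauchy_schwarz)

lemma bounded_bilinear_scaleC: "bounded_bilinear (scaleC :: complex \<Rightarrow> 'a::chilbert \<Rightarrow> 'a)"
  by (rule bounded_bilinear.intro)
    (auto simp: scaleC_add_left scaleC_add_right scaleR_scaleC_left scaleC_scaleR norm_scaleC
      intro!: exI[of _ 1])

interpretation cinner: bounded_bilinear "cinner :: 'a::chilbert \<Rightarrow> 'a \<Rightarrow> complex"
  by (rule bounded_bilinear_cinner)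

interpretation scaleC: bounded_bilinear "scaleC :: complex \<Rightarrow> 'a::chilbert \<Rightarrow> 'a"
  by (rule bounded_bilinear_scaleC)

lemma cinner_eqI:
  assumes "\<And>z. cinner z x = cinner z (y :: 'a::chilbert)"
  shows "x = y"
proof -
  have "cinner (x - y) (x - y) = 0" using assms by (simp add: cinner.diff_right)
  then show ?thesis by (simp add: cinner_self)
qed

lemma parallelogram:
  "(norm (x - y))\<^sup>2 = 2 * (norm x)\<^sup>2 + 2 * (norm y)\<^sup>2 - (norm (x + y :: 'a::chilbert))\<^sup>2"
  using norm_add_sq[of x y] norm_add_sq[of x "- y"] by (simp add: cinner.minus_right)

text \<open>Variational argument: if \<open>y\<close> represents \<open>f\<close>, then
  \<open>J x\<close> equals \<open>(norm (x - y))^2 - (norm y)^2\<close>, so \<open>y\<close> must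
  minimise \<open>J\<close>. A minimiser exists because minimising sequences are Cauchy, and the
  first-order condition at it is the representation.\<close>

lemma riesz_representation:
  fixes f :: "'a::chilbert \<Rightarrow> complex"
  assumes add: "\<And>x y. f (x + y) = f x + f y"
    and scale: "\<And>c x. f (c *\<^sub>C x) = c * f x"
    and bound: "\<And>x. cmod (f x) \<le> B * norm x"
  shows "\<exists>y. \<forall>x. f x = cinner x y"
proof -
  define J where "J x = (norm x)\<^sup>2 - 2 * Re (f x)" for x
  have fR: "f (r *\<^sub>R x) = r *\<^sub>R f x" for r x
    by (simp add: scaleR_scaleC scale scaleR_conv_of_real)
  have lower: "- B\<^sup>2 \<le> J x" for x
  proof -
    have "Re (f x) \<le> B * norm x" using bound[of x] complex_Re_le_cmod order_trans by blast
    moreover have "0 \<le> (norm x - B)\<^sup>2" by simp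
    ultimately show ?thesis by (simp add: J_def power2_eq_square algebra_simps)
  qed
  define \<delta> where "\<delta> = (INF x. J x)"
  have bdd: "bdd_below (range J)" using lower by (intro bdd_belowI[of _ "- B\<^sup>2"]) auto
  have \<delta>: "\<delta> \<le> J x" for x unfolding \<delta>_def by (rule cINF_lower[OF bdd]) simp
  have "\<exists>x. J x < \<delta> + 1 / Suc n" for n
    using cINF_less_iff[OF _ bdd, of "\<delta> + 1 / Suc n"] by (auto simp: \<delta>_def)
  then obtain x where x: "\<And>n. J (x n) < \<delta> + 1 / Suc n" by metis
  \<comment> \<open>The linear part of \<open>J\<close> cancels in the parallelogram law. Since the
    value at the midpoint is at least \<delta>, nearly minimal values at \<open>u\<close> and
    \<open>v\<close> force the two points together.\<close>
  have par: "(norm (u - v))\<^sup>2 = 2 * J u + 2 * J v - 4 * J ((1/2) *\<^sub>R (u + v))" for u v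
  proof -
    have "(norm ((1/2) *\<^sub>R (u + v)))\<^sup>2 = (norm (u + v))\<^sup>2 / 4"
      by (simp add: power_divide)
    moreover have "Re (f ((1/2) *\<^sub>R (u + v))) = (Re (f u) + Re (f v)) / 2"
      by (simp add: fR add)
    ultimately show ?thesis unfolding J_def parallelogram[of u v] by (simp add: algebra_simps)
  qed
  have close: "(norm (x m - x n))\<^sup>2 \<le> 2 / Suc m + 2 / Suc n" for m n
  proof -
    have "(norm (x m - x n))\<^sup>2 \<le> 2 * (\<delta> + 1 / Suc m) + 2 * (\<delta> + 1 / Suc n) - 4 * \<delta>"
      unfolding par using x[of m] x[of n] \<delta>[of "(1/2) *\<^sub>R (x m + x n)"] by argo
    then show ?thesis by simp
  qed
  have "Cauchy x"
  proof (rule metric_CauchyI)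
    fix e :: real assume e: "0 < e"
    obtain M :: nat where M: "4 / e\<^sup>2 < M" using reals_Archimedean2 by blast
    have "dist (x m) (x n) < e" if "M \<le> m" "M \<le> n" for m n
    proof -
      have M0: "0 < real M" using M e by (smt (verit) divide_pos_pos zero_less_power)
      have "2 / Suc m \<le> 2 / M" "2 / Suc n \<le> 2 / M"
        using that M0 by (auto intro!: divide_left_mono)
      then have "(norm (x m - x n))\<^sup>2 \<le> 4 / M" using close[of m n] by simp
      also have "\<dots> < e\<^sup>2" using M M0 e by (simp add: divide_less_eq mult.commute)
      finally show ?thesis using e by (simp add: dist_norm power2_less_imp_less)
    qed
    then show "\<exists>M. \<forall>m\<ge>M. \<forall>n\<ge>M. dist (x m) (x n) < e" by blast
  qed
  then obtain y where y: "x \<longlonglongrightarrow> y" using Cauchy_convergent convergent_def by blast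
  have blf: "bounded_linear f"
    by (rule bounded_linear_intro[where K=B]) (simp_all add: add fR bound mult.commute)
  have "(\<lambda>n. J (x n)) \<longlonglongrightarrow> J y"
    unfolding J_def by (intro tendsto_intros y bounded_linear.tendsto[OF blf])
  moreover have "(\<lambda>n. \<delta> + 1 / Suc n) \<longlonglongrightarrow> \<delta> + 0"
    by (intro tendsto_intros LIMSEQ_Suc lim_1_over_n)
  ultimately have Jy: "J y \<le> \<delta>" using x by (auto intro: LIMSEQ_le less_imp_le)
  have re: "Re (f z) = Re (cinner z y)" for z
  proof (rule ccontr)
    define d where "d = Re (cinner z y) - Re (f z)"
    assume "Re (f z) \<noteq> Re (cinner z y)"
    then have d0: "d \<noteq> 0" by (simp add: d_def)
    have ineq: "0 \<le> t\<^sup>2 * (norm z)\<^sup>2 + 2 * t * d" for t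
    proof -
      have "J y \<le> J (y + t *\<^sub>R z)" using Jy \<delta> order_trans by blast
      moreover have "Re (cinner y z) = Re (cinner z y)" by (subst cinner_commute) simp
      ultimately show ?thesis
        by (simp add: J_def norm_add_sq add fR cinner_scaleR_right d_def power_mult_distrib
            algebra_simps)
    qed
    \<comment> \<open>\<open>t = - d / q\<close> nearly minimises the quadratic in \<open>t\<close>;
      the added 1 keeps \<open>q\<close> positive when \<open>z = 0\<close>.\<close>
    define q where "q = (norm z)\<^sup>2 + 1"
    have q: "q > 0" by (simp add: q_def add_nonneg_pos)
    have "0 \<le> (- d / q)\<^sup>2 * (norm z)\<^sup>2 + 2 * (- d / q) * d" by (rule ineq)
    also have "\<dots> \<le> (- d / q)\<^sup>2 * q + 2 * (- d / q) * d"
      by (intro add_right_mono mult_left_mono) (auto simp: q_def)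
    also have "\<dots> = - d\<^sup>2 / q" using q by (simp add: power2_eq_square field_simps)
    finally show False using q d0 by (simp add: divide_le_0_iff)
  qed
  have "f z = cinner z y" for z
  proof (rule complex_eqI)
    show "Re (f z) = Re (cinner z y)" by (rule re)
    \<comment> \<open>Multiplying the argument by \<open>- \<i>\<close> turns the real part of a
      complex-linear functional into its imaginary part.\<close>
    show "Im (f z) = Im (cinner z y)"
      using re[of "(- \<i>) *\<^sub>C z"] by (simp add: scale cinner_scaleC_left)
  qed
  then show ?thesis by blast
qed

section \<open>Bounded complex-linear operators, adjoints and polarisation\<close>

lemma bounded_opsD: "T \<in> bounded_ops \<Longrightarrow> blinfun_apply T (c *\<^sub>C x) = c *\<^sub>C blinfun_apply T x"
  by (simp add: bounded_ops_def)

lemma bounded_ops_adjoint: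
  assumes "T \<in> bounded_ops"
  shows "\<exists>S. \<forall>x y. cinner (blinfun_apply T x) y = cinner x (S y)"
proof -
  have "\<exists>z. \<forall>x. cinner (blinfun_apply T x) y = cinner x z" for y
  proof (rule riesz_representation)
    show "cinner (blinfun_apply T (a + b)) y
        = cinner (blinfun_apply T a) y + cinner (blinfun_apply T b) y" for a b
      by (simp add: blinfun.add_right cinner_add_left)
    show "cinner (blinfun_apply T (c *\<^sub>C b)) y = c * cinner (blinfun_apply T b) y" for c b
      by (simp add: bounded_opsD[OF assms] cinner_scaleC_left)
    show "cmod (cinner (blinfun_apply T b) y) \<le> (norm T * norm y) * norm b" for b
    proof -
      have "cmod (cinner (blinfun_apply T b) y) \<le> norm (blinfun_apply T b) * norm y"
        by (rule cinner_cauchy_schwarz)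
      also have "\<dots> \<le> (norm T * norm b) * norm y"
        by (intro mult_right_mono norm_blinfun) simp
      finally show ?thesis by (simp add: mult_ac)
    qed
  qed
  then show ?thesis by metis
qed

lemma is_adjointD:
  "is_adjoint S T \<Longrightarrow> cinner (blinfun_apply T x) y = cinner x (blinfun_apply S y)"
  by (simp add: is_adjoint_def)

lemma is_adjoint_sym: "is_adjoint S T \<Longrightarrow> is_adjoint T S"
  unfolding is_adjoint_def by (metis cinner_commute)

text \<open>Herglotz' theorem concerns a vector paired with its own orbit; polarisation over the
  fourth roots of unity reduces general coefficients to that diagonal case.\<close>

lemma cinner_polarization:
  fixes x y :: "'a::chilbert"
  assumes "T \<in> bounded_ops"
  shows "cinner (blinfun_apply T x) y
    = (\<Sum>j<4. \<i> ^ j / 4 * cinner (blinfun_apply T (x + \<i> ^ j *\<^sub>C y)) (x + \<i> ^ j *\<^sub>C y))"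
proof -
  let ?T = "blinfun_apply T"
  have "cinner (?T (x + c *\<^sub>C y)) (x + c *\<^sub>C y)
      = cinner (?T x) x + cnj c * cinner (?T x) y + c * cinner (?T y) x + c * cnj c * cinner (?T y) y"
    for c
    by (simp add: blinfun.add_right bounded_opsD[OF assms]
      cinner_add_left cinner_add_right cinner_scaleC_left cinner_scaleC_right algebra_simps)
  moreover have "\<i> ^ 2 = -1" "\<i> ^ 3 = -\<i>" by (simp_all add: eval_nat_numeral)
  moreover have "{..<4} = {0, 1, 2, 3 :: nat}" by auto
  ultimately show ?thesis by (simp add: field_simps)
qed

subsection \<open>Finite orthonormal systems\<close>

definition orthonormal :: "'a::chilbert set \<Rightarrow> bool" where
  "orthonormal E \<longleftrightarrow> finite E \<and> (\<forall>e\<in>E. \<forall>f\<in>E. cinner e f = (if e = f then 1 else 0))"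

definition proj :: "'a::chilbert set \<Rightarrow> 'a \<Rightarrow> 'a" where
  "proj E x = (\<Sum>e\<in>E. cinner x e *\<^sub>C e)"

lemma proj_diff: "proj E (x - y) = proj E x - proj E y"
  by (simp add: proj_def cinner.diff_left scaleC_diff_left sum_subtractf)

lemma cinner_proj_right:
  assumes "orthonormal E" "e \<in> E" shows "cinner (proj E x) e = cinner x e"
proof -
  have "cinner (proj E x) e = (\<Sum>f\<in>E. cinner x f * cinner f e)"
    by (simp add: proj_def cinner.sum_left cinner_scaleC_left)
  also have "\<dots> = (\<Sum>f\<in>E. if f = e then cinner x f else 0)"
    using assms by (intro sum.cong) (auto simp: orthonormal_def)
  also have "\<dots> = cinner x e" using assms by (simp add: orthonormal_def)
  finally show ?thesis .
qed

lemma norm_proj_le: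
  assumes "orthonormal E" shows "norm (proj E x) \<le> norm x"
proof -
  let ?p = "proj E x"
  have "cinner (x - ?p) ?p = (\<Sum>e\<in>E. cnj (cinner x e) * cinner (x - ?p) e)"
    unfolding proj_def[of E x] by (simp add: cinner.sum_right cinner_scaleC_right)
  also have "\<dots> = 0"
    by (intro sum.neutral) (auto simp: cinner.diff_left cinner_proj_right[OF assms])
  finally have "(norm ((x - ?p) + ?p))\<^sup>2 = (norm (x - ?p))\<^sup>2 + (norm ?p)\<^sup>2"
    by (subst norm_add_sq) simp
  then have "(norm ?p)\<^sup>2 \<le> (norm x)\<^sup>2" by simp
  then show ?thesis by (rule power2_le_imp_le) simp
qed

text \<open>Lying in the span of \<open>E\<close> is encoded as \<open>proj E x = x\<close>. A
  vector that depends on the earlier ones leaves \<open>E\<close> unchanged, so \<open>X\<close> may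
  be linearly dependent.\<close>

lemma gram_schmidt:
  assumes "finite X"
  shows "\<exists>E. orthonormal E \<and> (\<forall>x\<in>X. proj E x = (x :: 'a::chilbert))"
  using assms
proof (induction X)
  case empty
  show ?case by (rule exI[of _ "{}"]) (simp add: orthonormal_def)
next
  case (insert a X)
  then obtain E where E: "orthonormal E" "\<And>x. x \<in> X \<Longrightarrow> proj E x = x" by blast
  define b where "b = a - proj E a"
  show ?case
  proof (cases "b = 0")
    case True
    then show ?thesis using E by (auto simp: b_def intro!: exI[of _ E])
  next
    case False
    define e where "e = (1 / norm b) *\<^sub>R b"
    have orth: "cinner b f = 0" if "f \<in> E" for f
      by (simp add: b_def cinner.diff_left cinner_proj_right[OF E(1) that])
    have ef: "cinner e f = 0" if "f \<in> E" for f
      using orth[OF that] by (simp add: e_def cinner_scaleR_left)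
    have fe: "cinner f e = 0" if "f \<in> E" for f
      using ef[OF that] by (subst cinner_commute) simp
    have ee: "cinner e e = 1" using False by (simp add: cinner_self e_def)
    have eE: "e \<notin> E" using ef ee by force
    have ort: "orthonormal (insert e E)"
      using E(1) ef fe ee eE by (auto simp: orthonormal_def)
    have fin: "finite E" using E(1) by (simp add: orthonormal_def)
    have pr: "proj (insert e E) x = cinner x e *\<^sub>C e + proj E x" for x
      using eE fin by (simp add: proj_def)
    have projE: "cinner (proj E x) e = 0" for x
      by (simp add: proj_def cinner.sum_left cinner_scaleC_left fe)
    have "proj (insert e E) x = x" if "x \<in> X" for x
      using pr[of x] projE[of x] E(2)[OF that] by simp
    moreover have "proj (insert e E) a = a"
    proof -
      have nb: "b = norm b *\<^sub>R e" using False by (simp add: e_def)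
      have ab: "a = b + proj E a" by (simp add: b_def)
      then have "cinner a e = cinner b e" using projE by (metis add.right_neutral cinner_add_left)
      also have "\<dots> = norm b" by (subst nb) (simp add: cinner_scaleR_left ee scaleR_conv_of_real)
      finally show ?thesis using pr[of a] nb ab scaleC_of_real by metis
    qed
    ultimately show ?thesis using ort by blast
  qed
qed

section \<open>Averages of polynomial phases\<close>

text \<open>Subtracting the linear growth \<open>(N / b) S\<close> from the partial sums leaves a
  periodic, hence bounded, sequence; the averages tend to the mean over one period.\<close>

lemma convergent_average_periodic:
  fixes f :: "nat \<Rightarrow> complex"
  assumes "b > 0" and per: "\<And>n. f (n + b) = f n"
  shows "convergent (\<lambda>N. (1 / real N) *\<^sub>R (\<Sum>n=1..N. f n))"
proof -
  define S where "S = (\<Sum>n=1..b. f n)"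
  define g where "g N = (\<Sum>n=1..N. f n) - (real N / b) *\<^sub>R S" for N
  have shift: "(\<Sum>n=1..N + b. f n) = (\<Sum>n=1..N. f n) + S" for N
  proof (induction N)
    case (Suc N)
    have "(\<Sum>n=1..Suc N + b. f n) = (\<Sum>n=1..N + b. f n) + f (Suc N + b)" by simp
    then show ?case by (simp only: Suc per) simp
  qed (simp add: S_def)
  have gper: "g (N + b) = g N" for N
    using assms(1) unfolding g_def shift
    by (simp add: add_divide_distrib scaleR_add_left)
  have "g (m + b * q) = g m" for m q
    by (induction q) (simp_all add: gper add.assoc[symmetric] add.commute[of b])
  then have gmod: "g N = g (N mod b)" for N
    by (metis mod_mult_div_eq)
  define C where "C = (\<Sum>m<b. norm (g m))"
  have gC: "norm (g N) \<le> C" for N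
    unfolding C_def using assms(1) by (subst gmod, intro member_le_sum) auto
  have "(\<lambda>N. (1 / real N) *\<^sub>R g N) \<longlonglongrightarrow> 0"
  proof (rule Lim_null_comparison)
    show "(\<lambda>N. C * (1 / real N)) \<longlonglongrightarrow> 0" using tendsto_mult_left[OF lim_1_over_n, of C] by simp
    show "\<forall>\<^sub>F N in sequentially. norm ((1 / real N) *\<^sub>R g N) \<le> C * (1 / real N)"
      using gC by (intro always_eventually allI) (simp add: divide_right_mono)
  qed
  from tendsto_add[OF this tendsto_const[of "(1/b) *\<^sub>R S"]]
  have "(\<lambda>N. (1 / real N) *\<^sub>R g N + (1/b) *\<^sub>R S) \<longlonglongrightarrow> (1/b) *\<^sub>R S" by simp
  moreover have "\<forall>\<^sub>F N in sequentially.
      (1 / real N) *\<^sub>R g N + (1/b) *\<^sub>R S = (1 / real N) *\<^sub>R (\<Sum>n=1..N. f n)"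
    using eventually_gt_at_top[of 0]
    by eventually_elim (simp add: g_def scaleR_diff_right)
  ultimately have "(\<lambda>N. (1 / real N) *\<^sub>R (\<Sum>n=1..N. f n)) \<longlonglongrightarrow> (1/b) *\<^sub>R S"
    by (rule Lim_transform_eventually)
  then show ?thesis by (rule convergentI)
qed

section \<open>Van der Corput's difference theorem\<close>

lemma norm_sum_shift_diff:
  fixes z :: "nat \<Rightarrow> complex"
  assumes "\<And>n. norm (z n) \<le> 1"
  shows "norm ((\<Sum>n=1..N. z n) - (\<Sum>n=1..N. z (n + h))) \<le> 2 * real h"
proof (induction h)
  case (Suc h)
  have "(\<Sum>n=1..N. z (n + h)) - (\<Sum>n=1..N. z (n + Suc h)) = z (1 + h) - z (Suc N + h)"
    by (induction N) (simp_all add: algebra_simps)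
  moreover have "norm (z (1 + h) - z (Suc N + h)) \<le> 1 + 1"
    using assms by (intro order_trans[OF norm_triangle_ineq4] add_mono)
  ultimately have "norm ((\<Sum>n=1..N. z (n + h)) - (\<Sum>n=1..N. z (n + Suc h))) \<le> 2" by simp
  then have "norm (((\<Sum>n=1..N. z n) - (\<Sum>n=1..N. z (n + h)))
      + ((\<Sum>n=1..N. z (n + h)) - (\<Sum>n=1..N. z (n + Suc h)))) \<le> 2 * real h + 2"
    by (intro order_trans[OF norm_triangle_ineq] add_mono Suc.IH)
  then show ?case by simp
qed simp

text \<open>Replacing \<open>z\<close> by its average over \<open>H\<close> consecutive shifts
  changes the sum over \<open>n\<close> only by boundary terms. After Cauchy-Schwarz, the mean
  square of the shift sums \<open>T\<close> expands into correlations: the off-diagonal ones vanish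
  in the limit, and the diagonal ones contribute \<open>H\<close> against the normalisation
  \<open>H^2\<close>. This leaves an error of order \<open>1 / sqrt H\<close>, and \<open>H\<close>
  is arbitrary.\<close>

lemma van_der_corput:
  fixes z :: "nat \<Rightarrow> complex"
  assumes bound: "\<And>n. norm (z n) \<le> 1"
    and corr: "\<And>h h'. h \<noteq> h' \<Longrightarrow>
      (\<lambda>N. (1 / real N) *\<^sub>R (\<Sum>n=1..N. z (n + h) * cnj (z (n + h')))) \<longlonglongrightarrow> 0"
  shows "(\<lambda>N. (1 / real N) *\<^sub>R (\<Sum>n=1..N. z n)) \<longlonglongrightarrow> 0"
proof (rule tendstoI)
  fix e :: real assume e: "0 < e"
  \<comment> \<open>Any \<open>H\<close> above \<open>8 / e^2\<close> gives
    \<open>sqrt (2 / H) < e / 2\<close>; the 2 under the root accounts for the diagonal contribution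
    \<open>H\<close> together with the off-diagonal error \<open>E N \<le> H\<close>.\<close>
  obtain H :: nat where H: "9 / e\<^sup>2 < H" using reals_Archimedean2 by blast
  have H0: "real H > 0" using H e by (smt (verit) divide_pos_pos zero_less_power)
  define c where "c h h' N = (\<Sum>n=1..N. z (n + h) * cnj (z (n + h')))" for h h' N
  define P where "P = {(h, h'). h < H \<and> h' < H \<and> h \<noteq> h'}"
  have finP: "finite P"
    by (rule finite_subset[of _ "{..<H} \<times> {..<H}"]) (auto simp: P_def)
  define E where "E N = (\<Sum>(h, h')\<in>P. norm ((1 / real N) *\<^sub>R c h h' N))" for N
  have "(\<lambda>N. \<Sum>x\<in>P. norm ((1 / real N) *\<^sub>R c (fst x) (snd x) N)) \<longlonglongrightarrow> (\<Sum>x\<in>P. 0)"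
    unfolding c_def by (intro tendsto_sum tendsto_norm_zero corr) (auto simp: P_def)
  then have E: "E \<longlonglongrightarrow> 0" by (simp add: E_def[abs_def] case_prod_beta)
  define T where "T n = (\<Sum>h<H. z (n + h))" for n
  have T2: "(\<Sum>n=1..N. (norm (T n))\<^sup>2) \<le> real N * (H + E N)" if "N > 0" for N
  proof -
    have "complex_of_real (\<Sum>n=1..N. (norm (T n))\<^sup>2) = (\<Sum>n=1..N. T n * cnj (T n))"
      by (simp only: of_real_sum complex_norm_square)
    also have "\<dots> = (\<Sum>n=1..N. \<Sum>h<H. \<Sum>h'<H. z (n + h) * cnj (z (n + h')))"
      by (simp add: T_def sum_product)
    also have "\<dots> = (\<Sum>h<H. \<Sum>h'<H. c h h' N)"
      unfolding c_def sum.swap[of _ "{1..N}"] by simp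
    also have "\<dots> = (\<Sum>x\<in>{..<H}\<times>{..<H}. c (fst x) (snd x) N)"
      by (simp add: sum.cartesian_product case_prod_beta)
    finally have eq: "complex_of_real (\<Sum>n=1..N. (norm (T n))\<^sup>2)
        = (\<Sum>x\<in>{..<H}\<times>{..<H}. c (fst x) (snd x) N)" .
    have split: "{..<H} \<times> {..<H} = (\<lambda>h. (h, h)) ` {..<H} \<union> P" by (auto simp: P_def)
    have "(\<Sum>n=1..N. (norm (T n))\<^sup>2) = norm (complex_of_real (\<Sum>n=1..N. (norm (T n))\<^sup>2))"
      by (simp only: norm_of_real) (simp add: sum_nonneg)
    also have "\<dots> \<le> (\<Sum>x\<in>{..<H}\<times>{..<H}. norm (c (fst x) (snd x) N))"
      unfolding eq by (rule norm_sum)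
    also have "\<dots> = (\<Sum>x\<in>(\<lambda>h. (h, h)) ` {..<H}. norm (c (fst x) (snd x) N))
        + (\<Sum>x\<in>P. norm (c (fst x) (snd x) N))"
      unfolding split using finP by (intro sum.union_disjoint) (auto simp: P_def)
    also have "(\<Sum>x\<in>P. norm (c (fst x) (snd x) N)) = real N * E N"
      using that by (simp add: E_def case_prod_beta sum_distrib_left)
    also have "(\<Sum>x\<in>(\<lambda>h. (h, h)) ` {..<H}. norm (c (fst x) (snd x) N)) = (\<Sum>h<H. norm (c h h N))"
      by (subst sum.reindex) (auto simp: inj_on_def)
    also have "\<dots> \<le> (\<Sum>h<H. real N)"
    proof (rule sum_mono)
      fix h
      have "norm (c h h N) \<le> (\<Sum>n=1..N. norm (z (n + h) * cnj (z (n + h))))"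
        unfolding c_def by (rule norm_sum)
      also have "\<dots> \<le> (\<Sum>n=1..N. 1)"
        using bound by (intro sum_mono) (simp add: norm_mult mult_le_one)
      finally show "norm (c h h N) \<le> real N" by simp
    qed
    finally show ?thesis by (simp add: algebra_simps)
  qed
  have main: "norm ((1 / real N) *\<^sub>R (\<Sum>n=1..N. z n)) \<le> sqrt (2 / H) + 2 * real H / N"
    if N: "N > 0" "E N \<le> H" for N
  proof -
    have "(norm (\<Sum>n=1..N. T n))\<^sup>2 \<le> (\<Sum>n=1..N. norm (T n))\<^sup>2"
      by (intro power_mono norm_sum) simp
    also have "\<dots> \<le> real N * (\<Sum>n=1..N. (norm (T n))\<^sup>2)"
      using Cauchy_Schwarz_ineq_sum[of "\<lambda>_. 1" "\<lambda>n. norm (T n)" "{1..N}"] by simp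
    also have "\<dots> \<le> real N * (real N * (H + H))"
      using T2[OF N(1)] N(2)
      by (intro mult_left_mono order_trans[OF T2[OF N(1)]]) auto
    finally have "norm (\<Sum>n=1..N. T n) \<le> sqrt (real N * (real N * (H + H)))"
      by (rule real_le_rsqrt)
    also have "\<dots> = real N * sqrt (2 * real H)"
      by (simp add: real_sqrt_mult)
    finally have a: "norm (\<Sum>n=1..N. T n) \<le> real N * sqrt (2 * real H)" .
    have "(\<Sum>n=1..N. T n) = (\<Sum>h<H. \<Sum>n=1..N. z (n + h))"
      unfolding T_def by (rule sum.swap)
    then have "real H *\<^sub>R (\<Sum>n=1..N. z n) - (\<Sum>n=1..N. T n)
        = (\<Sum>h<H. (\<Sum>n=1..N. z n) - (\<Sum>n=1..N. z (n + h)))"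
      by (simp add: sum_subtractf scaleR_conv_of_real)
    also have "norm \<dots> \<le> (\<Sum>h<H. 2 * real H)"
      by (intro sum_norm_le order_trans[OF norm_sum_shift_diff[OF bound]]) auto
    finally have b: "norm (real H *\<^sub>R (\<Sum>n=1..N. z n) - (\<Sum>n=1..N. T n)) \<le> 2 * real H * real H"
      by simp
    have "norm (real H *\<^sub>R (\<Sum>n=1..N. z n)) \<le> real N * sqrt (2 * real H) + 2 * real H * real H"
      using norm_triangle_sub[of "real H *\<^sub>R (\<Sum>n=1..N. z n)" "\<Sum>n=1..N. T n"] a b by simp
    then have "norm (\<Sum>n=1..N. z n) \<le> (real N * sqrt (2 * real H) + 2 * real H * real H) / H"
      using H0 by (simp add: pos_le_divide_eq mult.commute)
    also have "\<dots> = real N * (sqrt (2 * real H) / H) + 2 * real H"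
      using H0 by (simp add: field_simps)
    also have "sqrt (2 * real H) / H = sqrt (2 / H)"
      using H0 by (simp add: real_sqrt_mult real_sqrt_divide real_div_sqrt field_simps)
    finally have "norm (\<Sum>n=1..N. z n) / N \<le> (real N * sqrt (2 / H) + 2 * real H) / N"
      using N by (intro divide_right_mono) auto
    then show ?thesis using N by (simp add: add_divide_distrib)
  qed
  have small: "sqrt (2 / H) < e / 2"
  proof (rule real_less_lsqrt)
    show "2 / real H < (e / 2)\<^sup>2"
      using H e H0 by (simp add: power_divide field_simps)
  qed (use e in auto)
  have "(\<lambda>N. 2 * real H * (1 / real N)) \<longlonglongrightarrow> 0"
    using tendsto_mult_left[OF lim_1_over_n, of "2 * real H"] by simp
  then have "\<forall>\<^sub>F N in sequentially. 2 * real H * (1 / real N) < e / 2"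
    using e by (intro order_tendstoD) auto
  moreover have "\<forall>\<^sub>F N in sequentially. E N < H" using E H0 by (intro order_tendstoD)
  moreover have "\<forall>\<^sub>F N in sequentially. N > 0" by (rule eventually_gt_at_top)
  ultimately show "\<forall>\<^sub>F N in sequentially. dist ((1 / real N) *\<^sub>R (\<Sum>n=1..N. z n)) 0 < e"
  proof eventually_elim
    case (elim N)
    then show ?case using main[of N] small by (simp add: dist_norm)
  qed
qed

text \<open>At the top degree, a difference of two shifts behaves like \<open>h - h'\<close> times
  the derivative, whence the drop in degree and the factor \<open>n + 1\<close>. Bounding the degree
  instead of fixing it keeps the induction over \<open>pCons\<close> uniform.\<close>

lemma degree_coeff_shift_diff:
  fixes p :: "int poly"
  assumes "degree p \<le> Suc n"
  shows "degree (pcompose p [:h, 1:] - pcompose p [:h', 1:]) \<le> n \<and>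
    coeff (pcompose p [:h, 1:] - pcompose p [:h', 1:]) n = (int n + 1) * (h - h') * coeff p (Suc n)"
  using assms
proof (induction p arbitrary: n)
  case (pCons a q)
  have dq: "degree q \<le> n" using pCons.prems pCons.hyps by (cases "q = 0") auto
  let ?E = "pcompose q [:h, 1:] - pcompose q [:h', 1:]"
  \<comment> \<open>Write the polynomial as \<open>a + X q\<close> and expand
    \<open>(X + h) q(X + h) - (X + h') q(X + h')\<close>; only \<open>X\<close> times
    \<open>?E\<close> and the last summand can reach degree \<open>n\<close>.\<close>
  have decomp: "pcompose (pCons a q) [:h, 1:] - pcompose (pCons a q) [:h', 1:]
      = pCons 0 ?E + smult h ?E + smult (h - h') (pcompose q [:h', 1:])"
    by (simp add: pcompose_pCons algebra_simps smult_diff_left smult_diff_right)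
  have degq: "degree (pcompose q [:h', 1:]) \<le> n"
    using dq degree_pcompose_le[of q "[:h', 1:]"] by simp
  have cq: "coeff (pcompose q [:h', 1:]) n = coeff q n"
  proof (cases "degree q = n")
    case True
    then show ?thesis using lead_coeff_comp[of "[:h', 1:]" q] by (simp add: degree_pcompose)
  next
    case False
    then show ?thesis using dq by (simp add: coeff_eq_0 degree_pcompose)
  qed
  show ?case
  proof (cases n)
    case 0
    then obtain c where "q = [:c:]" using dq by (metis degree_eq_zeroE le_zero_eq)
    then show ?thesis unfolding decomp 0 by simp
  next
    case (Suc m)
    have IH: "degree ?E \<le> m" "coeff ?E m = (int m + 1) * (h - h') * coeff q (Suc m)"
      using pCons.IH[of m] dq Suc by auto
    have "degree (pCons 0 ?E) \<le> n" using IH(1) Suc degree_pCons_le[of 0 ?E] by linarith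
    moreover have "degree (smult h ?E) \<le> n"
      using IH(1) Suc degree_smult_le[of h ?E] by linarith
    moreover have "degree (smult (h - h') (pcompose q [:h', 1:])) \<le> n"
      using degq degree_smult_le[of "h - h'" "pcompose q [:h', 1:]"] by linarith
    ultimately have "degree (pCons 0 ?E + smult h ?E + smult (h - h') (pcompose q [:h', 1:])) \<le> n"
      by (intro degree_add_le)
    moreover have "coeff ?E n = 0" using IH(1) Suc by (intro coeff_eq_0) auto
    ultimately show ?thesis
      unfolding decomp using IH(2) cq Suc by (simp add: algebra_simps)
  qed
qed simp

text \<open>The hypothesis \<open>irr\<close> expresses that \<open>\<theta> / (2 \<pi>)\<close> is
  irrational. The phases then form a geometric progression with ratio \<open>w \<noteq> 1\<close>,
  whose partial sums are bounded.\<close>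

lemma average_irrational_linear_phase:
  fixes c d :: int
  assumes irr: "\<And>(k::int) (l::int). l \<noteq> 0 \<Longrightarrow> \<theta> * real_of_int l \<noteq> 2 * pi * real_of_int k" and d: "d \<noteq> 0"
  shows "(\<lambda>N. (1 / real N) *\<^sub>R (\<Sum>n=1..N. cis (\<theta> * real_of_int (c + int n * d)))) \<longlonglongrightarrow> 0"
proof -
  define w where "w = cis (\<theta> * real_of_int d)"
  have w1: "w \<noteq> 1"
  proof
    assume "w = 1"
    then have "cos (\<theta> * real_of_int d) = 1" by (simp add: w_def complex_eq_iff)
    then obtain k :: int where "\<theta> * real_of_int d = real_of_int k * 2 * pi"
      using cos_one_2pi_int by auto
    then show False using irr[OF d, of k] by (simp add: mult_ac)
  qed
  have phase: "cis (\<theta> * real_of_int (c + int n * d)) = cis (\<theta> * c) * w ^ n" for n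
    unfolding w_def Complex.DeMoivre cis_mult by (simp add: algebra_simps)
  have bound: "norm (\<Sum>n=1..N. cis (\<theta> * real_of_int (c + int n * d))) \<le> 2 / norm (w - 1)" for N
  proof -
    have "(\<Sum>n=1..N. cis (\<theta> * real_of_int (c + int n * d))) * (w - 1)
        = cis (\<theta> * c) * (w ^ Suc N - w)"
      unfolding phase by (induction N) (simp_all add: algebra_simps)
    then have "norm (\<Sum>n=1..N. cis (\<theta> * real_of_int (c + int n * d))) * norm (w - 1)
        = norm (w ^ Suc N - w)"
      by (metis norm_mult norm_cis mult_1)
    also have "\<dots> \<le> norm (w ^ Suc N) + norm w" by (rule norm_triangle_ineq4)
    also have "\<dots> = 2" by (simp add: w_def norm_power norm_mult)
    finally show ?thesis using w1 by (simp add: pos_le_divide_eq)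
  qed
  show ?thesis
  proof (rule Lim_null_comparison)
    show "(\<lambda>N. 2 / norm (w - 1) * (1 / real N)) \<longlonglongrightarrow> 0"
      using tendsto_mult_left[OF lim_1_over_n, of "2 / norm (w - 1)"] by simp
    show "\<forall>\<^sub>F N in sequentially. norm ((1 / real N) *\<^sub>R (\<Sum>n=1..N. cis (\<theta> * real_of_int (c + int n * d))))
        \<le> 2 / norm (w - 1) * (1 / real N)"
    proof (rule always_eventually, rule allI)
      fix N :: nat
      show "norm ((1 / real N) *\<^sub>R (\<Sum>n=1..N. cis (\<theta> * real_of_int (c + int n * d))))
        \<le> 2 / norm (w - 1) * (1 / real N)"
        using mult_left_mono[OF bound[of N], of "1 / real N"] by (simp add: mult.commute)
    qed
  qed
qed

text \<open>Weyl's induction: the correlations in van der Corput's theorem are again phases of an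
  integer polynomial, of degree one less. The induction has to end at linear phases, since constant
  ones do not average to 0; hence the degree \<open>Suc d\<close>.\<close>

lemma average_irrational_phase:
  fixes p :: "int poly"
  assumes irr: "\<And>(k::int) (l::int). l \<noteq> 0 \<Longrightarrow> \<theta> * real_of_int l \<noteq> 2 * pi * real_of_int k" and "degree p = Suc d"
  shows "(\<lambda>N. (1 / real N) *\<^sub>R (\<Sum>n=1..N. cis (\<theta> * real_of_int (poly p (int n))))) \<longlonglongrightarrow> 0"
  using assms(2)
proof (induction d arbitrary: p)
  case 0
  then obtain a b where p: "p = [:a, b:]"
    using degree1_coeffs[of p] by (metis One_nat_def)
  with 0 have "b \<noteq> 0" by (auto split: if_splits)
  from average_irrational_linear_phase[OF irr this, of a] show ?case
    by (simp add: p)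
next
  case (Suc d)
  show ?case
  proof (rule van_der_corput)
    fix h h' :: nat assume hh: "h \<noteq> h'"
    define q where "q = pcompose p [:int h, 1:] - pcompose p [:int h', 1:]"
    have q: "degree q \<le> Suc d" "coeff q (Suc d) = (int (Suc d) + 1) * (int h - int h') * lead_coeff p"
      using degree_coeff_shift_diff[of p "Suc d" "int h" "int h'"] Suc.prems by (auto simp: q_def)
    have "p \<noteq> 0" using Suc.prems by auto
    then have "lead_coeff p \<noteq> 0" by (simp only: leading_coeff_0_iff) simp
    then have "coeff q (Suc d) \<noteq> 0" using q(2) hh by simp
    then have "degree q = Suc d" using q(1) le_degree by (metis le_antisym)
    from Suc.IH[OF this]
    show "(\<lambda>N. (1 / real N) *\<^sub>R (\<Sum>n=1..N. cis (\<theta> * real_of_int (poly p (int (n + h))))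
        * cnj (cis (\<theta> * real_of_int (poly p (int (n + h'))))))) \<longlonglongrightarrow> 0"
      by (simp add: q_def poly_pcompose cis_cnj cis_mult algebra_simps)
  qed simp
qed

text \<open>Makes polynomial phases periodic when \<open>\<theta> / (2 \<pi>)\<close> is
  rational.\<close>

lemma dvd_poly_shift_diff: "b dvd poly p (x + b) - poly p (x :: int)"
proof (induction p)
  case (pCons a p)
  have "poly (pCons a p) (x + b) - poly (pCons a p) x
      = x * (poly p (x + b) - poly p x) + b * poly p (x + b)"
    by (simp add: algebra_simps)
  then show ?case using pCons.IH by simp
qed simp

theorem convergent_average_polynomial_phase:
  fixes p :: "int poly"
  shows "convergent (\<lambda>N. (1 / real N) *\<^sub>R (\<Sum>n=1..N. cis (\<theta> * real_of_int (poly p (int n)))))"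
proof (cases "\<exists>(k::int) (l::int). l \<noteq> 0 \<and> \<theta> * real_of_int l = 2 * pi * real_of_int k")
  case True
  then obtain k l :: int where kl: "l \<noteq> 0" "\<theta> * real_of_int l = 2 * pi * real_of_int k"
    by blast
  define b where "b = nat \<bar>l\<bar>"
  have b: "b > 0" using kl by (simp add: b_def)
  show ?thesis
  proof (rule convergent_average_periodic[OF b])
    fix n
    have "l dvd poly p (int n + int b) - poly p (int n)"
      using dvd_poly_shift_diff[of "int b" p "int n"] by (auto simp: b_def)
    then obtain m where m: "poly p (int (n + b)) = poly p (int n) + l * m"
      by (metis add.commute diff_add_cancel dvdE of_nat_add)
    have "\<theta> * real_of_int (poly p (int (n + b))) = \<theta> * real_of_int (poly p (int n)) + \<theta> * l * m"
      unfolding m by (simp add: algebra_simps)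
    also have "\<theta> * l * m = 2 * pi * real_of_int (k * m)" by (simp add: kl(2))
    finally show "cis (\<theta> * real_of_int (poly p (int (n + b)))) = cis (\<theta> * real_of_int (poly p (int n)))"
      by (simp add: cis_mult[symmetric] cis_multiple_2pi del: of_int_mult)
  qed
next
  case False
  show ?thesis
  proof (cases "degree p")
    case 0
    then obtain c where "p = [:c:]" by (metis degree_eq_zeroE)
    then show ?thesis using convergent_average_periodic[of 1 "\<lambda>_. cis (\<theta> * c)"] by simp
  next
    case (Suc d)
    then show ?thesis using average_irrational_phase[of \<theta> p d] False
      by (auto simp: convergent_def)
  qed
qed

section \<open>Spectral measures of stationary sequences\<close>

lemma has_integral_character:
  "has_bochner_integral lborel (\<lambda>t. indicator {0..2*pi} t *\<^sub>R cis (real_of_int j * t))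
     (if j = 0 then complex_of_real (2 * pi) else 0)"
proof (cases "j = 0")
  case True
  have "has_bochner_integral lborel (\<lambda>t. indicator {0..2*pi} t *\<^sub>R (1::complex))
      (complex_of_real (2 * pi) - complex_of_real 0)"
    by (rule has_bochner_integral_FTC_Icc)
      (auto intro!: derivative_eq_intros has_vector_derivative_of_real)
  then show ?thesis using True by simp
next
  case False
  define F where "F t = cis (real_of_int j * t) / (\<i> * of_int j)" for t
  have F: "(F has_vector_derivative cis (real_of_int j * t)) (at t within {0..2*pi})" for t
  proof -
    have "((\<lambda>t. exp (\<i> * of_int j * t) / (\<i> * of_int j)) has_field_derivative
        exp (\<i> * of_int j * z)) (at z)" for z :: complex
      using False by (auto intro!: derivative_eq_intros)
    from has_vector_derivative_real_field[OF this[of "complex_of_real t"]]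
    have "((\<lambda>t. exp (\<i> * of_int j * complex_of_real t) / (\<i> * of_int j)) has_vector_derivative
        exp (\<i> * of_int j * complex_of_real t)) (at t within {0..2*pi})"
      by (simp add: o_def)
    then show ?thesis by (simp add: F_def[abs_def] cis_conv_exp mult.assoc)
  qed
  have "has_bochner_integral lborel (\<lambda>t. indicator {0..2*pi} t *\<^sub>R cis (real_of_int j * t))
      (F (2 * pi) - F 0)"
    by (rule has_bochner_integral_FTC_Icc)
      (auto intro!: F continuous_intros)
  moreover have "cis (real_of_int j * (2 * pi)) = 1"
    using cis_multiple_2pi[of "real_of_int j"] by (simp add: mult_ac)
  ultimately show ?thesis using False by (simp add: F_def)
qed

lemma isCont_cis_mult: "isCont (\<lambda>t. cis (c * t)) x"
  unfolding cis_conv_exp by (intro continuous_intros)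

text \<open>The measure is a weak limit, by Helly selection, of the Fejer densities
  \<open>\<parallel>\<Sum>n\<le>N. exp (- i n t) y\<^sub>n\<parallel>\<^sup>2 / (2 \<pi> (N + 1))\<close> on \<open>[0, 2 \<pi>]\<close>.\<close>

lemma herglotz_normalized:
  fixes y :: "nat \<Rightarrow> 'a::chilbert"
  assumes stat: "\<And>n n' m. cinner (y (n + m)) (y (n' + m)) = cinner (y n) (y n')"
    and norm1: "norm (y 0) = 1"
  shows "\<exists>\<mu>. real_distribution \<mu> \<and>
    (\<forall>m. cinner (y m) (y 0) = (\<integral>t. cis (real m * t) \<partial>\<mu>))"
proof -
  \<comment> \<open>With this sign the \<open>m\<close>-th Fourier coefficient of the density picks
    out the pairs with \<open>n = n' + m\<close>, hence a multiple of
    \<open>cinner (y m) (y 0)\<close> by stationarity.\<close>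
  define V where "V N t = (\<Sum>n<Suc N. cis (- (real n * t)) *\<^sub>C y n)" for N t
  define D where "D N t = (norm (V N t))\<^sup>2 / (2 * pi * Suc N)" for N t
  have D0: "0 \<le> D N t" for N t by (simp add: D_def)
  have Vcont: "continuous_on UNIV (V N)" for N
    unfolding V_def by (intro continuous_intros scaleC.continuous_on)
  have Dcont: "continuous_on UNIV (D N)" for N
    unfolding D_def by (intro continuous_intros Vcont) auto
  then have [measurable]: "D N \<in> borel_measurable borel" for N
    by (rule borel_measurable_continuous_onI)
  have expand: "D N t *\<^sub>R cis (real m * t) = (\<Sum>n<Suc N. \<Sum>n'<Suc N.
      (cinner (y n) (y n') / complex_of_real (2 * pi * Suc N))
        * cis (real_of_int (int n' - int n + int m) * t))" for N m t
  proof -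
    have "complex_of_real ((norm (V N t))\<^sup>2) * cis (real m * t)
        = (\<Sum>n<Suc N. \<Sum>n'<Suc N. cinner (y n) (y n')
            * (cis (- (real n * t)) * cnj (cis (- (real n' * t))) * cis (real m * t)))"
      unfolding cinner_self[symmetric] V_def cinner.sum_left sum_distrib_right
    proof (intro sum.cong refl)
      fix n
      show "cinner (cis (- (real n * t)) *\<^sub>C y n) (\<Sum>n<Suc N. cis (- (real n * t)) *\<^sub>C y n)
          * cis (real m * t) = (\<Sum>n'<Suc N. cinner (y n) (y n')
            * (cis (- (real n * t)) * cnj (cis (- (real n' * t))) * cis (real m * t)))"
        unfolding cinner.sum_right sum_distrib_right cinner_scaleC_left cinner_scaleC_right
        by (intro sum.cong refl) (simp only: mult_ac)
    qed
    also have "\<dots> = (\<Sum>n<Suc N. \<Sum>n'<Suc N. cinner (y n) (y n')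
        * cis (real_of_int (int n' - int n + int m) * t))"
      by (intro sum.cong refl arg_cong2[where f="(*)"])
        (simp add: cis_cnj cis_mult algebra_simps)
    finally have e: "complex_of_real ((norm (V N t))\<^sup>2) * cis (real m * t)
        = (\<Sum>n<Suc N. \<Sum>n'<Suc N. cinner (y n) (y n')
        * cis (real_of_int (int n' - int n + int m) * t))" .
    have "D N t *\<^sub>R cis (real m * t)
        = (complex_of_real ((norm (V N t))\<^sup>2) * cis (real m * t)) / complex_of_real (2 * pi * Suc N)"
      by (simp add: D_def scaleR_conv_of_real)
    then show ?thesis unfolding e sum_divide_distrib by simp
  qed
  \<comment> \<open>The length of the diagonal \<open>n - n' = m\<close> in a square of side
    \<open>N + 1\<close>; natural subtraction gives the correct value 0 for
    \<open>m > N\<close>.\<close>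
  have count: "(\<Sum>n<Suc N. \<Sum>n'<Suc N. if n = n' + m then (1::real) else 0) = real (Suc N - m)" for N m
  proof -
    have "(\<Sum>n<Suc N. \<Sum>n'<Suc N. if n = n' + m then (1::real) else 0)
        = (\<Sum>n'<Suc N. \<Sum>n<Suc N. if n = n' + m then (1::real) else 0)"
      by (rule sum.swap)
    also have "\<dots> = (\<Sum>n'<Suc N. if n' < Suc N - m then 1 else 0)"
      by (intro sum.cong refl) auto
    also have "\<dots> = (\<Sum>n'\<in>{..<Suc N - m}. 1)"
      by (intro sum.mono_neutral_cong_right) auto
    finally show ?thesis by simp
  qed
  have bi: "has_bochner_integral lborel (\<lambda>t. indicator {0..2*pi} t *\<^sub>R (D N t *\<^sub>R cis (real m * t)))
      ((real (Suc N - m) / Suc N) *\<^sub>R cinner (y m) (y 0))" for N m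
  proof -
    have "has_bochner_integral lborel (\<lambda>t. \<Sum>n<Suc N. \<Sum>n'<Suc N.
        (cinner (y n) (y n') / complex_of_real (2 * pi * Suc N)) *
        (indicator {0..2*pi} t *\<^sub>R cis (real_of_int (int n' - int n + int m) * t)))
       (\<Sum>n<Suc N. \<Sum>n'<Suc N. (cinner (y n) (y n') / complex_of_real (2 * pi * Suc N)) *
        (if int n' - int n + int m = 0 then complex_of_real (2 * pi) else 0))"
      by (intro has_bochner_integral_sum has_bochner_integral_mult_right has_integral_character)
    also have "(\<lambda>t. \<Sum>n<Suc N. \<Sum>n'<Suc N.
        (cinner (y n) (y n') / complex_of_real (2 * pi * Suc N)) *
        (indicator {0..2*pi} t *\<^sub>R cis (real_of_int (int n' - int n + int m) * t)))
        = (\<lambda>t. indicator {0..2*pi} t *\<^sub>R (D N t *\<^sub>R cis (real m * t)))"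
      unfolding expand by (simp only: scaleR_sum_right mult_scaleR_right)
    also have "(\<Sum>n<Suc N. \<Sum>n'<Suc N. (cinner (y n) (y n') / complex_of_real (2 * pi * Suc N)) *
        (if int n' - int n + int m = 0 then complex_of_real (2 * pi) else 0))
        = (\<Sum>n<Suc N. \<Sum>n'<Suc N. (cinner (y m) (y 0) / complex_of_real (Suc N)) *
            complex_of_real (if n = n' + m then 1 else 0))"
    proof (intro sum.cong refl)
      fix n n'
      show "(cinner (y n) (y n') / complex_of_real (2 * pi * Suc N)) *
        (if int n' - int n + int m = 0 then complex_of_real (2 * pi) else 0)
        = (cinner (y m) (y 0) / complex_of_real (Suc N)) * complex_of_real (if n = n' + m then 1 else 0)"
      proof (cases "n = n' + m")
        case True
        then have "cinner (y n) (y n') = cinner (y m) (y 0)"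
          using stat[of m n' 0] by (simp add: add.commute)
        then show ?thesis using True by simp
      next
        case False
        then have "int n' - int n + int m \<noteq> 0" by linarith
        then show ?thesis using False by simp
      qed
    qed
    also have "\<dots> = (cinner (y m) (y 0) / complex_of_real (Suc N)) * complex_of_real (real (Suc N - m))"
      unfolding count[symmetric] of_real_sum sum_distrib_left by (rule refl)
    also have "\<dots> = (real (Suc N - m) / Suc N) *\<^sub>R cinner (y m) (y 0)"
      by (simp add: scaleR_conv_of_real)
    finally show ?thesis .
  qed
  define M where "M N = density lborel (\<lambda>t. ennreal (indicator {0..2*pi} t * D N t))" for N
  have c0: "cinner (y 0) (y 0) = 1" using norm1 by (simp add: cinner_self)
  have "has_bochner_integral lborel (\<lambda>t. Re (indicator {0..2*pi} t *\<^sub>R (D N t *\<^sub>R cis (real 0 * t))))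
      (Re ((real (Suc N - 0) / Suc N) *\<^sub>R cinner (y 0) (y 0)))" for N
    by (rule has_bochner_integral_bounded_linear[OF bounded_linear_Re bi])
  then have mass: "has_bochner_integral lborel (\<lambda>t. indicator {0..2*pi} t * D N t) 1" for N
    by (simp add: c0)
  have total: "(\<integral>\<^sup>+t. ennreal (indicator {0..2*pi} t * D N t) \<partial>lborel) = 1" for N
    using nn_integral_eq_integral[OF integrable.intros[OF mass], of N]
      has_bochner_integral_integral_eq[OF mass] D0
    by simp
  have prob: "prob_space (M N)" for N
    by (rule prob_spaceI) (simp add: M_def emeasure_density total)
  have rd: "real_distribution (M N)" for N
    unfolding real_distribution_def real_distribution_axioms_def using prob by (simp add: M_def)
  \<comment> \<open>Tightness is phrased with half-open intervals; \<open>{-1<..8}\<close> contains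
    \<open>[0, 2 \<pi>]\<close> and so carries the full mass of every Fejer measure.\<close>
  have meas: "measure (M N) {-1<..8} = 1" for N
  proof -
    have pi8: "2 * pi \<le> 8" using pi_less_4 by simp
    have "emeasure (M N) {-1<..8}
        = (\<integral>\<^sup>+t. ennreal (indicator {0..2*pi} t * D N t) * indicator {-1<..8} t \<partial>lborel)"
      unfolding M_def by (rule emeasure_density) auto
    also have "\<dots> = (\<integral>\<^sup>+t. ennreal (indicator {0..2*pi} t * D N t) \<partial>lborel)"
      using pi8 by (intro nn_integral_cong) (auto split: split_indicator)
    finally show ?thesis by (simp add: total measure_def)
  qed
  have "tight M"
    unfolding tight_def
  proof (intro conjI allI impI rd)
    fix \<epsilon> :: real assume "0 < \<epsilon>"
    then show "\<exists>a b. a < b \<and> (\<forall>n. 1 - \<epsilon> < measure (M n) {a<..b})"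
      by (intro exI[of _ "-1"] exI[of _ 8]) (simp add: meas)
  qed
  from tight_imp_convergent_subsubsequence[OF this strict_mono_id]
  obtain s \<mu> where s: "strict_mono (s :: nat \<Rightarrow> nat)" "real_distribution \<mu>" "weak_conv_m (M \<circ> id \<circ> s) \<mu>"
    by blast
  have integrals: "integral\<^sup>L (M N) (\<lambda>t. cis (real m * t))
      = (real (Suc N - m) / Suc N) *\<^sub>R cinner (y m) (y 0)" for N m
  proof -
    have "integral\<^sup>L (M N) (\<lambda>t. cis (real m * t))
        = (\<integral>t. (indicator {0..2*pi} t * D N t) *\<^sub>R cis (real m * t) \<partial>lborel)"
      unfolding M_def
      by (rule integral_density)
        (auto simp: D0 intro!: borel_measurable_continuous_onI continuous_at_imp_continuous_on isCont_cis_mult)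
    then show ?thesis using has_bochner_integral_integral_eq[OF bi[of N m]] by simp
  qed
  have "cinner (y m) (y 0) = (\<integral>t. cis (real m * t) \<partial>\<mu>)" for m
  proof (rule LIMSEQ_unique)
    have "(\<lambda>n. integral\<^sup>L ((M \<circ> id \<circ> s) n) (\<lambda>t. cis (real m * t))) \<longlonglongrightarrow> (\<integral>t. cis (real m * t) \<partial>\<mu>)"
      by (rule weak_conv_imp_integral_bdd_continuous_conv[where B=1])
        (use rd s in \<open>auto intro: isCont_cis_mult simp: o_def\<close>)
    then show "(\<lambda>n. integral\<^sup>L (M (s n)) (\<lambda>t. cis (real m * t))) \<longlonglongrightarrow> (\<integral>t. cis (real m * t) \<partial>\<mu>)"
      by simp
    have "(\<lambda>N. real (Suc N - m) / Suc N) \<longlonglongrightarrow> 1"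
    proof -
      have "(\<lambda>N. 1 - real m * (1 / Suc N)) \<longlonglongrightarrow> 1 - real m * 0"
        by (intro tendsto_intros LIMSEQ_Suc lim_1_over_n)
      moreover have "\<forall>\<^sub>F N in sequentially. 1 - real m * (1 / Suc N) = real (Suc N - m) / Suc N"
        using eventually_ge_at_top[of m]
        by eventually_elim (simp add: of_nat_diff field_simps)
      ultimately show ?thesis using Lim_transform_eventually by force
    qed
    then have "(\<lambda>N. (real (Suc N - m) / Suc N) *\<^sub>R cinner (y m) (y 0)) \<longlonglongrightarrow> 1 *\<^sub>R cinner (y m) (y 0)"
      by (intro tendsto_intros)
    then have "(\<lambda>N. integral\<^sup>L (M N) (\<lambda>t. cis (real m * t))) \<longlonglongrightarrow> cinner (y m) (y 0)"
      by (simp add: integrals)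
    from LIMSEQ_subseq_LIMSEQ[OF this s(1)]
    show "(\<lambda>n. integral\<^sup>L (M (s n)) (\<lambda>t. cis (real m * t))) \<longlonglongrightarrow> cinner (y m) (y 0)"
      by (simp add: o_def)
  qed
  then show ?thesis using s(2) by blast
qed

text \<open>Scaling by \<open>1 / norm (y 0)\<close> turns the Fejer densities into probability
  densities, to which Helly selection applies. In the form with two indices, \<open>y n\<close>
  behaves like the character \<open>cis (n t)\<close>, scaled by \<open>norm (y 0)\<close>, in L2 of
  the measure.\<close>

theorem herglotz:
  fixes y :: "nat \<Rightarrow> 'a::chilbert"
  assumes stat: "\<And>n n' m. cinner (y (n + m)) (y (n' + m)) = cinner (y n) (y n')"
  obtains \<mu> where "real_distribution \<mu>"
    "\<And>n n'. cinner (y n) (y n')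
      = complex_of_real ((norm (y 0))\<^sup>2) * (\<integral>t. cis (real n * t) * cnj (cis (real n' * t)) \<partial>\<mu>)"
proof -
  have "\<exists>\<mu>. real_distribution \<mu> \<and>
    (\<forall>m. cinner (y m) (y 0) = complex_of_real ((norm (y 0))\<^sup>2) * (\<integral>t. cis (real m * t) \<partial>\<mu>))"
  proof (cases "y 0 = 0")
    case True
    \<comment> \<open>For \<open>y 0 = 0\<close> both sides vanish, so any distribution
      serves.\<close>
    interpret prob_space "return borel (0::real)" by (rule prob_space_return) simp
    have "real_distribution (return borel 0)" by unfold_locales simp
    then show ?thesis using True by (auto simp: cinner.zero_right)
  next
    case False
    define z where "z n = (1 / norm (y 0)) *\<^sub>R y n" for n
    have yz: "cinner (y n) (y n') = complex_of_real ((norm (y 0))\<^sup>2) * cinner (z n) (z n')" for n n'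
      using False by (simp add: z_def cinner_scaleR_left cinner_scaleR_right scaleR_conv_of_real
          power2_eq_square field_simps)
    have "\<exists>\<mu>. real_distribution \<mu> \<and> (\<forall>m. cinner (z m) (z 0) = (\<integral>t. cis (real m * t) \<partial>\<mu>))"
      using False by (intro herglotz_normalized)
        (simp_all add: z_def cinner_scaleR_left cinner_scaleR_right stat)
    then show ?thesis unfolding yz by auto
  qed
  then obtain \<mu> where \<mu>: "real_distribution \<mu>"
    "\<And>m. cinner (y m) (y 0) = complex_of_real ((norm (y 0))\<^sup>2) * (\<integral>t. cis (real m * t) \<partial>\<mu>)"
    by blast
  have ge: "cinner (y n) (y n')
      = complex_of_real ((norm (y 0))\<^sup>2) * (\<integral>t. cis (real n * t) * cnj (cis (real n' * t)) \<partial>\<mu>)"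
    if "n' \<le> n" for n n'
  proof -
    have "cinner (y n) (y n') = cinner (y (n - n')) (y 0)"
      using stat[of "n - n'" n' 0] that by simp
    moreover have "cis (real n * t) * cnj (cis (real n' * t)) = cis (real (n - n') * t)" for t
      using that by (simp add: cis_cnj cis_mult of_nat_diff algebra_simps)
    ultimately show ?thesis using \<mu>(2) by simp
  qed
  have "cinner (y n) (y n')
      = complex_of_real ((norm (y 0))\<^sup>2) * (\<integral>t. cis (real n * t) * cnj (cis (real n' * t)) \<partial>\<mu>)"
    for n n'
  proof (cases "n' \<le> n")
    case False
    have "cinner (y n) (y n') = cnj (cinner (y n') (y n))" by (rule cinner_commute)
    also have "\<dots> = complex_of_real ((norm (y 0))\<^sup>2)
        * cnj (\<integral>t. cis (real n' * t) * cnj (cis (real n * t)) \<partial>\<mu>)"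
      using ge[of n n'] False by simp
    also have "cnj (\<integral>t. cis (real n' * t) * cnj (cis (real n * t)) \<partial>\<mu>)
        = (\<integral>t. cis (real n * t) * cnj (cis (real n' * t)) \<partial>\<mu>)"
      using Bochner_Integration.integral_cnj[of \<mu> "\<lambda>t. cis (real n' * t) * cnj (cis (real n * t))"]
      by (simp add: mult.commute)
    finally show ?thesis .
  qed (rule ge)
  then show ?thesis using \<mu>(1) that by blast
qed

section \<open>Averages twisted by phases\<close>

text \<open>\<open>B\<close> abstracts the boxes and \<open>\<Psi>\<close> the phases that can be
  averaged. Closure under sums and real multiples lets the spectral variable \<open>t\<close> of
  Herglotz' theorem be absorbed: with \<psi> and L also \<psi> + t L is a phase.\<close>

locale phase_averages =
  fixes B :: "nat \<Rightarrow> 'i set" and \<Psi> :: "('i \<Rightarrow> real) set"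
  assumes finite_box: "finite (B N)"
    and phase_zero: "(\<lambda>_. 0) \<in> \<Psi>"
    and phase_add: "\<psi> \<in> \<Psi> \<Longrightarrow> \<psi>' \<in> \<Psi> \<Longrightarrow> (\<lambda>n. \<psi> n + \<psi>' n) \<in> \<Psi>"
    and phase_scale: "\<psi> \<in> \<Psi> \<Longrightarrow> (\<lambda>n. c * \<psi> n) \<in> \<Psi>"
    and phase_convergent: "\<psi> \<in> \<Psi> \<Longrightarrow>
      convergent (\<lambda>N. (1 / real (card (B N))) *\<^sub>R (\<Sum>n\<in>B N. cis (\<psi> n)))"
begin

text \<open>Estimates are demanded only at indices that occur in some box, because only there do the
  exponents agree with the polynomial values.\<close>

definition idx :: "'i set" where "idx = (\<Union>N. B N)"

definition avg :: "nat \<Rightarrow> ('i \<Rightarrow> 'b::real_vector) \<Rightarrow> 'b" where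
  "avg N f = (1 / real (card (B N))) *\<^sub>R (\<Sum>n\<in>B N. f n)"

text \<open>Plain convergence of the averages would not survive multiplication by a matrix
  coefficient; convergence under all twists does. The bound supplies the majorant for dominated
  convergence.\<close>

definition good :: "('i \<Rightarrow> 'h::chilbert) \<Rightarrow> bool" where
  "good f \<longleftrightarrow> (\<exists>K. \<forall>n\<in>idx. norm (f n) \<le> K) \<and>
     (\<forall>\<psi>\<in>\<Psi>. convergent (\<lambda>N. avg N (\<lambda>n. cis (\<psi> n) *\<^sub>C f n)))"

lemma box_subset_idx: "B N \<subseteq> idx"
  by (auto simp: idx_def)

lemma norm_avg_le:
  fixes f :: "'i \<Rightarrow> 'b::real_normed_vector"
  assumes "\<And>n. n \<in> idx \<Longrightarrow> norm (f n) \<le> K" and "0 \<le> K"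
  shows "norm (avg N f) \<le> K"
proof -
  have "norm (\<Sum>n\<in>B N. f n) \<le> (\<Sum>n\<in>B N. K)"
    using assms(1) box_subset_idx[of N] by (intro sum_norm_le) auto
  then have "norm (avg N f) \<le> (1 / real (card (B N))) * (real (card (B N)) * K)"
    unfolding avg_def by (simp add: divide_le_eq mult.commute)
  \<comment> \<open>An empty box has average 0 because \<open>1 / 0 = 0\<close>; this is the case
    that uses \<open>0 \<le> K\<close>.\<close>
  also have "\<dots> \<le> K" using assms(2) by (cases "card (B N) = 0") auto
  finally show ?thesis .
qed

lemma avg_diff: "avg N (\<lambda>n. f n - g n) = avg N f - avg N g"
  by (simp add: avg_def sum_subtractf scaleR_diff_right)

lemma avg_add: "avg N (\<lambda>n. f n + g n) = avg N f + avg N g"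
  by (simp add: avg_def sum.distrib scaleR_add_right)

lemma avg_cong: "(\<And>n. n \<in> idx \<Longrightarrow> f n = g n) \<Longrightarrow> avg N f = avg N g"
  unfolding avg_def using box_subset_idx by (metis (no_types, lifting) subsetD sum.cong)

text \<open>Brings averages over different boxes onto one finite index set, so that their difference
  is a single weighted sum.\<close>

lemma avg_eq_sum:
  assumes "B N \<subseteq> I" "finite I"
  shows "avg N f = (\<Sum>n\<in>I. (if n \<in> B N then 1 / real (card (B N)) else 0) *\<^sub>R f n)"
proof -
  have "(\<Sum>n\<in>I. (if n \<in> B N then 1 / real (card (B N)) else 0) *\<^sub>R f n)
      = (\<Sum>n\<in>B N. (1 / real (card (B N))) *\<^sub>R f n)"
    using assms by (intro sum.mono_neutral_cong_right) auto
  then show ?thesis by (simp add: avg_def scaleR_sum_right)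
qed

lemma goodI:
  assumes "\<And>n. n \<in> idx \<Longrightarrow> norm (f n) \<le> K"
    and "\<And>\<psi>. \<psi> \<in> \<Psi> \<Longrightarrow> convergent (\<lambda>N. avg N (\<lambda>n. cis (\<psi> n) *\<^sub>C f n))"
  shows "good f"
  using assms by (auto simp: good_def)

lemma good_bound:
  assumes "good f"
  obtains K where "0 \<le> K" "\<And>n. n \<in> idx \<Longrightarrow> norm (f n) \<le> K"
proof -
  obtain K where "\<forall>n\<in>idx. norm (f n) \<le> K" using assms by (auto simp: good_def)
  then have "\<And>n. n \<in> idx \<Longrightarrow> norm (f n) \<le> max K 0" by (meson max.coboundedI1)
  then show ?thesis using that[of "max K 0"] by simp
qed

lemma good_convergent:
  "good f \<Longrightarrow> \<psi> \<in> \<Psi> \<Longrightarrow> convergent (\<lambda>N. avg N (\<lambda>n. cis (\<psi> n) *\<^sub>C f n))"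
  by (simp add: good_def)

lemma good_convergent_avg: "good f \<Longrightarrow> convergent (\<lambda>N. avg N f)"
  using good_convergent[OF _ phase_zero] by simp

lemma good_const: "good (\<lambda>_. e :: 'h::chilbert)"
proof (rule goodI[of _ "norm e"])
  fix \<psi> assume "\<psi> \<in> \<Psi>"
  then obtain l where "(\<lambda>N. avg N (\<lambda>n. cis (\<psi> n))) \<longlonglongrightarrow> l"
    using phase_convergent by (auto simp: convergent_def avg_def)
  then have "(\<lambda>N. avg N (\<lambda>n. cis (\<psi> n)) *\<^sub>C e) \<longlonglongrightarrow> l *\<^sub>C e"
    by (intro scaleC.tendsto tendsto_const)
  moreover have "avg N (\<lambda>n. cis (\<psi> n)) *\<^sub>C e = avg N (\<lambda>n. cis (\<psi> n) *\<^sub>C e)" for N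
    by (simp add: avg_def scaleR_scaleC_left scaleC.sum_left)
  ultimately show "convergent (\<lambda>N. avg N (\<lambda>n. cis (\<psi> n) *\<^sub>C e))"
    by (auto simp: convergent_def)
qed simp

lemma good_add:
  assumes "good f" "good (g :: 'i \<Rightarrow> 'h::chilbert)"
  shows "good (\<lambda>n. f n + g n)"
proof -
  obtain K K' where "\<And>n. n \<in> idx \<Longrightarrow> norm (f n) \<le> K" "\<And>n. n \<in> idx \<Longrightarrow> norm (g n) \<le> K'"
    using good_bound[OF assms(1)] good_bound[OF assms(2)] by metis
  then have "norm (f n + g n) \<le> K + K'" if "n \<in> idx" for n
    using that by (intro norm_triangle_mono) auto
  then show ?thesis
    by (rule goodI)
      (simp_all add: scaleC_add_right avg_add convergent_add good_convergent assms)
qed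

lemma good_scaleC:
  assumes "good (f :: 'i \<Rightarrow> 'h::chilbert)"
  shows "good (\<lambda>n. c *\<^sub>C f n)"
proof -
  obtain K where K: "\<And>n. n \<in> idx \<Longrightarrow> norm (f n) \<le> K" using good_bound[OF assms] by metis
  show ?thesis
  proof (rule goodI[of _ "cmod c * K"])
    show "norm (c *\<^sub>C f n) \<le> cmod c * K" if "n \<in> idx" for n
      using K[OF that] by (simp add: norm_scaleC mult_left_mono)
    fix \<psi> assume "\<psi> \<in> \<Psi>"
    then obtain l where "(\<lambda>N. avg N (\<lambda>n. cis (\<psi> n) *\<^sub>C f n)) \<longlonglongrightarrow> l"
      using good_convergent[OF assms] by (auto simp: convergent_def)
    then have "(\<lambda>N. c *\<^sub>C avg N (\<lambda>n. cis (\<psi> n) *\<^sub>C f n)) \<longlonglongrightarrow> c *\<^sub>C l"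
      by (intro scaleC.tendsto tendsto_const)
    moreover have "c *\<^sub>C avg N (\<lambda>n. cis (\<psi> n) *\<^sub>C f n) = avg N (\<lambda>n. cis (\<psi> n) *\<^sub>C (c *\<^sub>C f n))" for N
      by (simp add: avg_def scaleC_scaleR scaleC.sum_right scaleC_scaleC mult.commute)
    ultimately show "convergent (\<lambda>N. avg N (\<lambda>n. cis (\<psi> n) *\<^sub>C (c *\<^sub>C f n)))"
      by (auto simp: convergent_def)
  qed
qed

lemma good_sum:
  assumes "finite E" "\<And>e. e \<in> E \<Longrightarrow> good (f e :: 'i \<Rightarrow> 'h::chilbert)"
  shows "good (\<lambda>n. \<Sum>e\<in>E. f e n)"
  using assms by (induction E) (auto intro: good_const good_add)

text \<open>Averaging contracts the supremum norm and multiplication by \<open>cis\<close> preserves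
  it, so the approximation error is uniform in \<open>N\<close> and the Cauchy property carries
  over.\<close>

lemma good_uniform_limit:
  fixes f :: "'i \<Rightarrow> 'h::chilbert"
  assumes approx: "\<And>\<epsilon>. \<epsilon> > 0 \<Longrightarrow> \<exists>g. good g \<and> (\<forall>n\<in>idx. norm (f n - g n) \<le> \<epsilon>)"
  shows "good f"
proof -
  obtain g K where g: "\<forall>n\<in>idx. norm (f n - g n) \<le> 1" "\<And>n. n \<in> idx \<Longrightarrow> norm (g n) \<le> K"
    using approx[of 1] good_bound by (metis zero_less_one)
  have bound: "norm (f n) \<le> K + 1" if "n \<in> idx" for n
    using g that norm_triangle_sub[of "f n" "g n"] by fastforce
  have "convergent (\<lambda>N. avg N (\<lambda>n. cis (\<psi> n) *\<^sub>C f n))" if \<psi>: "\<psi> \<in> \<Psi>" for \<psi>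
  proof -
    have "Cauchy (\<lambda>N. avg N (\<lambda>n. cis (\<psi> n) *\<^sub>C f n))"
    proof (rule metric_CauchyI)
      fix e :: real assume e: "0 < e"
      obtain g where g: "good g" "\<forall>n\<in>idx. norm (f n - g n) \<le> e / 4"
        using approx[of "e/4"] e by auto
      define G where "G N = avg N (\<lambda>n. cis (\<psi> n) *\<^sub>C g n)" for N
      define F where "F N = avg N (\<lambda>n. cis (\<psi> n) *\<^sub>C f n)" for N
      have FG: "norm (F N - G N) \<le> e / 4" for N
        unfolding F_def G_def avg_diff[symmetric] scaleC_diff_right[symmetric]
        using g(2) e by (intro norm_avg_le) (auto simp: norm_scaleC)
      have "Cauchy G"
        using good_convergent[OF g(1) \<psi>] by (auto simp: G_def[abs_def] convergent_Cauchy)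
      then obtain M where M: "\<And>m n. m \<ge> M \<Longrightarrow> n \<ge> M \<Longrightarrow> dist (G m) (G n) < e / 2"
        using e metric_CauchyD[of G "e/2"] by auto
      have "dist (F m) (F n) < e" if "m \<ge> M" "n \<ge> M" for m n
      proof -
        have "norm (F m - F n) \<le> norm (F m - G m) + norm (G m - G n) + norm (F n - G n)"
          by norm
        then show ?thesis using FG[of m] FG[of n] M[OF that] by (simp add: dist_norm)
      qed
      then show "\<exists>M. \<forall>m\<ge>M. \<forall>n\<ge>M. dist (F m) (F n) < e" by blast
    qed
    then show ?thesis by (rule Cauchy_convergent)
  qed
  with bound show ?thesis by (rule goodI)
qed

text \<open>If the linear combinations of \<open>f'\<close> are dominated by those of \<open>f\<close> twisted by the characters
  \<open>t * L\<close>, averaged over \<open>t\<close>, then dominated convergence carries the Cauchy property over to \<open>f'\<close>.\<close>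

lemma good_dominated:
  fixes f f' :: "'i \<Rightarrow> 'h::chilbert"
  assumes f: "good f" and L: "L \<in> \<Psi>" and \<mu>: "real_distribution \<mu>"
    and bounded: "\<And>n. n \<in> idx \<Longrightarrow> norm (f' n) \<le> C"
    and dom: "\<And>I w. finite I \<Longrightarrow> (norm (\<Sum>n\<in>I. w n *\<^sub>C f' n))\<^sup>2
      \<le> K * (\<integral>t. (norm (\<Sum>n\<in>I. (w n * cis (t * L n)) *\<^sub>C f n))\<^sup>2 \<partial>\<mu>)"
    and "0 \<le> K"
  shows "good f'"
proof (rule goodI[OF bounded])
  fix \<psi> assume \<psi>: "\<psi> \<in> \<Psi>"
  interpret \<mu>: real_distribution \<mu> by (rule \<mu>)
  obtain R where R: "0 \<le> R" "\<And>n. n \<in> idx \<Longrightarrow> norm (f n) \<le> R" by (rule good_bound[OF f]) blast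
  define G where "G N t = avg N (\<lambda>n. cis (\<psi> n + t * L n) *\<^sub>C f n)" for N t
  define A where "A N = avg N (\<lambda>n. cis (\<psi> n) *\<^sub>C f' n)" for N
  have "convergent (\<lambda>N. G N t)" for t
    unfolding G_def using good_convergent[OF f phase_add[OF \<psi> phase_scale[OF L, of t]]] .
  then obtain g where g: "\<And>t. (\<lambda>N. G N t) \<longlonglongrightarrow> g t" unfolding convergent_def by metis
  have Gbound: "norm (G N t) \<le> R" for N t
    unfolding G_def using R by (intro norm_avg_le) (auto simp: norm_scaleC)
  have gbound: "norm (g t) \<le> R" for t
    using tendsto_norm[OF g] Gbound by (intro LIMSEQ_le_const2[of "\<lambda>N. norm (G N t)"]) auto
  have Gcont: "continuous_on UNIV (G N)" for N
    unfolding G_def avg_def cis_conv_exp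
    by (intro continuous_intros scaleC.continuous_on)
  have Gmeas [measurable]: "(\<lambda>t. (norm (G N t - G M t))\<^sup>2) \<in> borel_measurable borel" for N M
    by (intro borel_measurable_continuous_onI continuous_intros Gcont)
  \<comment> \<open>Since \<open>'h\<close> may be nonseparable, measurability is claimed only for
    these real functions, as pointwise limits of continuous ones.\<close>
  have gmeas [measurable]: "(\<lambda>t. (norm (G N t - g t))\<^sup>2) \<in> borel_measurable borel" for N
    by (rule borel_measurable_LIMSEQ_real[where u="\<lambda>M t. (norm (G N t - G M t))\<^sup>2"])
      (intro tendsto_intros g, rule Gmeas)
  have sqb: "(norm (x - y))\<^sup>2 \<le> (2 * R)\<^sup>2" if "norm x \<le> R" "norm y \<le> R" for x y :: 'h
    using that norm_triangle_ineq4[of x y] by (intro power_mono) auto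
  have gint: "integrable \<mu> (\<lambda>t. (norm (G N t - g t))\<^sup>2)" for N
    by (rule \<mu>.integrable_const_bound[of _ "(2 * R)\<^sup>2"]) (use sqb[OF Gbound gbound] in auto)
  have Gint: "integrable \<mu> (\<lambda>t. (norm (G N t - G M t))\<^sup>2)" for N M
    by (rule \<mu>.integrable_const_bound[of _ "(2 * R)\<^sup>2"]) (use sqb[OF Gbound Gbound] in auto)
  define \<delta> where "\<delta> N = (\<integral>t. (norm (G N t - g t))\<^sup>2 \<partial>\<mu>)" for N
  have "\<delta> \<longlonglongrightarrow> (\<integral>t. 0 \<partial>\<mu>)"
    unfolding \<delta>_def
  proof (rule integral_dominated_convergence[where w="\<lambda>_. (2 * R)\<^sup>2"])
    show "AE t in \<mu>. (\<lambda>N. (norm (G N t - g t))\<^sup>2) \<longlonglongrightarrow> 0"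
    proof (rule AE_I2)
      fix t
      have "(\<lambda>N. (norm (G N t - g t))\<^sup>2) \<longlonglongrightarrow> (norm (g t - g t))\<^sup>2" by (intro tendsto_intros g)
      then show "(\<lambda>N. (norm (G N t - g t))\<^sup>2) \<longlonglongrightarrow> 0" by simp
    qed
    show "AE t in \<mu>. norm ((norm (G N t - g t))\<^sup>2) \<le> (2 * R)\<^sup>2" for N
      using sqb[OF Gbound gbound] by simp
  qed auto
  then have \<delta>: "\<delta> \<longlonglongrightarrow> 0" by simp
  have A: "(norm (A N - A M))\<^sup>2 \<le> 2 * K * (\<delta> N + \<delta> M)" for N M
  proof -
    \<comment> \<open>Over the union of both boxes \<open>A N - A M\<close> is one finite linear
      combination with signed weights \<open>v\<close>, as \<open>dom\<close> requires.\<close>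
    define I where "I = B N \<union> B M"
    have I: "finite I" "B N \<subseteq> I" "B M \<subseteq> I" by (auto simp: I_def finite_box)
    define v where "v n = (if n \<in> B N then 1 / real (card (B N)) else 0)
        - (if n \<in> B M then 1 / real (card (B M)) else 0)" for n
    have diff: "avg N h - avg M h = (\<Sum>n\<in>I. v n *\<^sub>R h n)" for h :: "'i \<Rightarrow> 'h"
      unfolding avg_eq_sum[OF I(2,1)] avg_eq_sum[OF I(3,1)] sum_subtractf[symmetric] v_def
      by (simp only: scaleR_diff_left)
    define w where "w n = complex_of_real (v n) * cis (\<psi> n)" for n
    have "A N - A M = (\<Sum>n\<in>I. w n *\<^sub>C f' n)"
      unfolding A_def diff w_def by (simp add: scaleC_scaleC[symmetric] scaleC_of_real)
    then have le: "(norm (A N - A M))\<^sup>2 \<le> K * (\<integral>t. (norm (\<Sum>n\<in>I. (w n * cis (t * L n)) *\<^sub>C f n))\<^sup>2 \<partial>\<mu>)"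
      using dom[OF I(1), of w] by simp
    have "(\<Sum>n\<in>I. (w n * cis (t * L n)) *\<^sub>C f n) = G N t - G M t" for t
      unfolding G_def diff w_def
      by (simp add: cis_mult[symmetric] scaleC_scaleC[symmetric] scaleC_of_real)
    then have "(\<integral>t. (norm (\<Sum>n\<in>I. (w n * cis (t * L n)) *\<^sub>C f n))\<^sup>2 \<partial>\<mu>)
        = (\<integral>t. (norm (G N t - G M t))\<^sup>2 \<partial>\<mu>)"
      by simp
    also have "\<dots> \<le> (\<integral>t. 2 * (norm (G N t - g t))\<^sup>2 + 2 * (norm (G M t - g t))\<^sup>2 \<partial>\<mu>)"
    proof (rule integral_mono)
      show "(norm (G N t - G M t))\<^sup>2 \<le> 2 * (norm (G N t - g t))\<^sup>2 + 2 * (norm (G M t - g t))\<^sup>2" for t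
        using parallelogram[of "G N t - g t" "G M t - g t"] by simp
    qed (use Gint gint in auto)
    also have "\<dots> = 2 * (\<delta> N + \<delta> M)"
      using gint by (simp add: \<delta>_def)
    finally have "(\<integral>t. (norm (\<Sum>n\<in>I. (w n * cis (t * L n)) *\<^sub>C f n))\<^sup>2 \<partial>\<mu>) \<le> 2 * (\<delta> N + \<delta> M)" .
    from order_trans[OF le mult_left_mono[OF this \<open>0 \<le> K\<close>]]
    show ?thesis by (simp only: mult_ac)
  qed
  have "Cauchy A"
  proof (rule metric_CauchyI)
    fix e :: real assume e: "0 < e"
    \<comment> \<open>Chosen so that \<open>4 * K * \<eta> < e^2\<close>; the summand 4 covers
      \<open>K = 0\<close>.\<close>
    define \<eta> where "\<eta> = e\<^sup>2 / (4 * K + 4)"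
    have \<eta>: "0 < \<eta>" using e \<open>0 \<le> K\<close> by (simp add: \<eta>_def)
    obtain M where M: "\<And>n. n \<ge> M \<Longrightarrow> \<delta> n < \<eta>"
      using order_tendstoD(2)[OF \<delta> \<eta>] by (auto simp: eventually_at_top_linorder)
    have "dist (A m) (A n) < e" if "m \<ge> M" "n \<ge> M" for m n
    proof -
      have "(norm (A m - A n))\<^sup>2 \<le> 2 * K * (\<delta> m + \<delta> n)" by (rule A)
      also have "\<dots> \<le> 2 * K * (\<eta> + \<eta>)"
        using M[OF that(1)] M[OF that(2)] \<open>0 \<le> K\<close> by (intro mult_left_mono) auto
      also have "\<dots> < (4 * K + 4) * \<eta>" using \<eta> by (simp add: algebra_simps)
      also have "\<dots> = e\<^sup>2" using \<open>0 \<le> K\<close> by (simp add: \<eta>_def)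
      finally show ?thesis using e by (simp add: dist_norm power2_less_imp_less)
    qed
    then show "\<exists>M. \<forall>m\<ge>M. \<forall>n\<ge>M. dist (A m) (A n) < e" by blast
  qed
  then show "convergent (\<lambda>N. avg N (\<lambda>n. cis (\<psi> n) *\<^sub>C f' n))"
    unfolding A_def by (rule Cauchy_convergent)
qed

text \<open>On linear combinations, \<open>y n\<close> corresponds isometrically to
  \<open>norm (y 0)\<close> times the character \<open>cis (n t)\<close> in L2 of the spectral
  measure. The constant function \<open>y 0\<close>, twisted by \<open>t * s n\<close>, therefore
  dominates with equality.\<close>

lemma good_stationary:
  fixes y :: "nat \<Rightarrow> 'h::chilbert" and s :: "'i \<Rightarrow> nat"
  assumes stat: "\<And>n n' m. cinner (y (n + m)) (y (n' + m)) = cinner (y n) (y n')"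
    and L: "(\<lambda>n. real (s n)) \<in> \<Psi>"
  shows "good (\<lambda>n. y (s n))"
proof -
  obtain \<mu> where \<mu>: "real_distribution \<mu>" and
    spec: "\<And>n n'. cinner (y n) (y n')
      = complex_of_real ((norm (y 0))\<^sup>2) * (\<integral>t. cis (real n * t) * cnj (cis (real n' * t)) \<partial>\<mu>)"
    using herglotz[of y, OF stat] by metis
  interpret \<mu>: real_distribution \<mu> by (rule \<mu>)
  have cism: "(\<lambda>t. cis (c * t)) \<in> borel_measurable \<mu>" for c
    using isCont_cis_mult by (simp add: borel_measurable_continuous_onI continuous_at_imp_continuous_on)
  have int: "integrable \<mu> (\<lambda>t. cis (c * t) * cnj (cis (d * t)))" for c d
  proof (rule \<mu>.integrable_const_bound[of _ 1])
    have "(\<lambda>t. cis (c * t) * cnj (cis (d * t))) = (\<lambda>t. cis ((c - d) * t))"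
      by (simp add: cis_cnj cis_mult algebra_simps)
    then show "(\<lambda>t. cis (c * t) * cnj (cis (d * t))) \<in> borel_measurable \<mu>" using cism by simp
  qed (simp add: norm_mult)
  show ?thesis
  proof (rule good_dominated[OF good_const[of "y 0"] L \<mu>, of _ "norm (y 0)" 1])
    show "norm (y (s n)) \<le> norm (y 0)" for n
      using stat[of 0 "s n" 0] by (simp add: cinner_self flip: of_real_power)
    fix I :: "'i set" and w assume "finite I"
    let ?W = "\<lambda>t. \<Sum>n\<in>I. w n * cis (real (s n) * t)"
    have "complex_of_real ((norm (\<Sum>n\<in>I. w n *\<^sub>C y (s n)))\<^sup>2)
        = (\<Sum>n\<in>I. \<Sum>n'\<in>I. w n * cnj (w n') * cinner (y (s n)) (y (s n')))"
      unfolding cinner_self[symmetric] cinner.sum_left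
      by (simp add: cinner.sum_right cinner_scaleC_left cinner_scaleC_right sum_distrib_left mult_ac)
    also have "\<dots> = complex_of_real ((norm (y 0))\<^sup>2) * (\<Sum>n\<in>I. \<Sum>n'\<in>I.
        (\<integral>t. w n * cnj (w n') * (cis (real (s n) * t) * cnj (cis (real (s n') * t))) \<partial>\<mu>))"
      unfolding spec sum_distrib_left by (simp add: mult_ac)
    also have "(\<Sum>n\<in>I. \<Sum>n'\<in>I.
        (\<integral>t. w n * cnj (w n') * (cis (real (s n) * t) * cnj (cis (real (s n') * t))) \<partial>\<mu>))
        = (\<integral>t. (\<Sum>n\<in>I. \<Sum>n'\<in>I. w n * cnj (w n') *
            (cis (real (s n) * t) * cnj (cis (real (s n') * t)))) \<partial>\<mu>)"
      using int by (simp add: Bochner_Integration.integral_sum)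
    also have "(\<lambda>t. \<Sum>n\<in>I. \<Sum>n'\<in>I. w n * cnj (w n') *
            (cis (real (s n) * t) * cnj (cis (real (s n') * t))))
        = (\<lambda>t. complex_of_real ((cmod (?W t))\<^sup>2))"
      by (rule ext) (simp add: complex_norm_square sum_product mult_ac del: of_real_power)
    also have "complex_of_real ((norm (y 0))\<^sup>2) * (\<integral>t. complex_of_real ((cmod (?W t))\<^sup>2) \<partial>\<mu>)
        = complex_of_real (\<integral>t. (cmod (?W t))\<^sup>2 * (norm (y 0))\<^sup>2 \<partial>\<mu>)"
      by (simp add: mult.commute del: of_real_power)
    also have "(\<lambda>t. (cmod (?W t))\<^sup>2 * (norm (y 0))\<^sup>2)
        = (\<lambda>t. (norm (\<Sum>n\<in>I. (w n * cis (t * real (s n))) *\<^sub>C y 0))\<^sup>2)"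
      by (simp add: scaleC.sum_left[symmetric] norm_scaleC power_mult_distrib mult.commute)
    finally show "(norm (\<Sum>n\<in>I. w n *\<^sub>C y (s n)))\<^sup>2
        \<le> 1 * (\<integral>t. (norm (\<Sum>n\<in>I. (w n * cis (t * real (s n))) *\<^sub>C y 0))\<^sup>2 \<partial>\<mu>)"
      by (simp only: of_real_eq_iff)
  qed simp
qed

end

context phase_averages
begin

text \<open>The type argument fixes the space in which the averaged functions take their values.\<close>

definition multiplier :: "'h::chilbert itself \<Rightarrow> ('i \<Rightarrow> complex) \<Rightarrow> bool" where
  "multiplier T g \<longleftrightarrow> (\<exists>K. \<forall>n\<in>idx. cmod (g n) \<le> K) \<and>
     (\<forall>f :: 'i \<Rightarrow> 'h. good f \<longrightarrow> good (\<lambda>n. g n *\<^sub>C f n))"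

lemma multiplier_bound:
  assumes "multiplier TYPE('h::chilbert) g"
  obtains K where "0 \<le> K" "\<And>n. n \<in> idx \<Longrightarrow> cmod (g n) \<le> K"
proof -
  obtain K where "\<forall>n\<in>idx. cmod (g n) \<le> K" using assms by (auto simp: multiplier_def)
  then have "\<And>n. n \<in> idx \<Longrightarrow> cmod (g n) \<le> max K 0" by (meson max.coboundedI1)
  then show ?thesis using that[of "max K 0"] by simp
qed

lemma good_multiplier:
  fixes f :: "'i \<Rightarrow> 'h::chilbert"
  shows "multiplier TYPE('h) g \<Longrightarrow> good f \<Longrightarrow> good (\<lambda>n. g n *\<^sub>C f n)"
  by (simp add: multiplier_def)

lemma multiplier_const: "multiplier TYPE('h::chilbert) (\<lambda>_. c)"
  by (auto simp: multiplier_def intro: good_scaleC)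

lemma multiplier_add:
  assumes f: "multiplier TYPE('h::chilbert) f" and g: "multiplier TYPE('h) g"
  shows "multiplier TYPE('h) (\<lambda>n. f n + g n)"
proof -
  obtain K K' where "\<And>n. n \<in> idx \<Longrightarrow> cmod (f n) \<le> K" "\<And>n. n \<in> idx \<Longrightarrow> cmod (g n) \<le> K'"
    using multiplier_bound[OF f] multiplier_bound[OF g] by metis
  then have "\<forall>n\<in>idx. cmod (f n + g n) \<le> K + K'" by (auto intro: norm_triangle_mono)
  then show ?thesis
    using f g unfolding multiplier_def by (auto simp: scaleC_add_left intro: good_add)
qed

lemma multiplier_mult:
  assumes f: "multiplier TYPE('h::chilbert) f" and g: "multiplier TYPE('h) g"
  shows "multiplier TYPE('h) (\<lambda>n. f n * g n)"
proof -
  obtain K K' where K: "0 \<le> K" "\<And>n. n \<in> idx \<Longrightarrow> cmod (f n) \<le> K" "\<And>n. n \<in> idx \<Longrightarrow> cmod (g n) \<le> K'"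
    using multiplier_bound[OF f] multiplier_bound[OF g] by metis
  then have "\<forall>n\<in>idx. cmod (f n * g n) \<le> K * K'" by (auto simp: norm_mult intro: mult_mono)
  then show ?thesis
    using f g unfolding multiplier_def by (auto simp: scaleC_scaleC[symmetric])
qed

lemma multiplier_sum:
  assumes "finite E" "\<And>e. e \<in> E \<Longrightarrow> multiplier TYPE('h::chilbert) (f e)"
  shows "multiplier TYPE('h) (\<lambda>n. \<Sum>e\<in>E. f e n)"
  using assms by (induction E) (auto intro: multiplier_const multiplier_add)

lemma multiplier_uniform_limit:
  assumes approx: "\<And>\<epsilon>. \<epsilon> > 0 \<Longrightarrow> \<exists>g. multiplier TYPE('h::chilbert) g \<and> (\<forall>n\<in>idx. cmod (f n - g n) \<le> \<epsilon>)"
  shows "multiplier TYPE('h) f"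
  unfolding multiplier_def
proof (intro conjI allI impI)
  obtain g K where g: "\<forall>n\<in>idx. norm (f n - g n) \<le> 1" "\<And>n. n \<in> idx \<Longrightarrow> norm (g n) \<le> K"
    using approx[of 1] multiplier_bound by (metis zero_less_one)
  have "norm (f n) \<le> K + 1" if "n \<in> idx" for n
    using g that norm_triangle_sub[of "f n" "g n"] by fastforce
  then show "\<exists>K. \<forall>n\<in>idx. cmod (f n) \<le> K" by blast
  fix h :: "'i \<Rightarrow> 'h" assume h: "good h"
  obtain R where R: "0 \<le> R" "\<And>n. n \<in> idx \<Longrightarrow> norm (h n) \<le> R" by (rule good_bound[OF h]) blast
  show "good (\<lambda>n. f n *\<^sub>C h n)"
  proof (rule good_uniform_limit)
    fix \<epsilon> :: real assume \<epsilon>: "\<epsilon> > 0"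
    obtain g where g: "multiplier TYPE('h) g" "\<forall>n\<in>idx. cmod (f n - g n) \<le> \<epsilon> / (R + 1)"
      using approx[of "\<epsilon> / (R + 1)"] \<epsilon> R(1) by auto
    have "norm (f n *\<^sub>C h n - g n *\<^sub>C h n) \<le> \<epsilon>" if "n \<in> idx" for n
    proof -
      have "norm (f n *\<^sub>C h n - g n *\<^sub>C h n) = cmod (f n - g n) * norm (h n)"
        by (simp add: scaleC_diff_left[symmetric] norm_scaleC)
      also have "\<dots> \<le> (\<epsilon> / (R + 1)) * (R + 1)"
        using g(2) R(2)[OF that] that \<epsilon> R(1) by (intro mult_mono) auto
      finally show ?thesis using R(1) by simp
    qed
    then show "\<exists>g. good g \<and> (\<forall>n\<in>idx. norm (f n *\<^sub>C h n - g n) \<le> \<epsilon>)"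
      using good_multiplier[OF g(1) h] by blast
  qed
qed

text \<open>The coefficient is \<open>\<kappa>\<close> times the mean over \<open>t\<close> of
  \<open>cis (t * s n)\<close>, so multiplying by it averages twisted copies of \<open>f\<close>;
  convexity of the squared norm gives domination with constant \<open>\<kappa>^2\<close>.\<close>

lemma multiplier_stationary:
  fixes y :: "nat \<Rightarrow> 'b::chilbert" and s :: "'i \<Rightarrow> nat"
  assumes stat: "\<And>n n' m. cinner (y (n + m)) (y (n' + m)) = cinner (y n) (y n')"
    and L: "(\<lambda>n. real (s n)) \<in> \<Psi>"
  shows "multiplier TYPE('h::chilbert) (\<lambda>n. cinner (y (s n)) (y 0))"
proof -
  define \<kappa> where "\<kappa> = (norm (y 0))\<^sup>2"
  have \<kappa>: "0 \<le> \<kappa>" by (simp add: \<kappa>_def)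
  obtain \<mu> where \<mu>: "real_distribution \<mu>" and
    spec': "\<And>n n'. cinner (y n) (y n')
      = complex_of_real ((norm (y 0))\<^sup>2) * (\<integral>t. cis (real n * t) * cnj (cis (real n' * t)) \<partial>\<mu>)"
    using herglotz[of y, OF stat] by metis
  have spec: "cinner (y n) (y 0) = complex_of_real \<kappa> * (\<integral>t. cis (t * real n) \<partial>\<mu>)" for n
    using spec'[of n 0] by (simp add: \<kappa>_def mult.commute)
  interpret \<mu>: real_distribution \<mu> by (rule \<mu>)
  have cism: "(\<lambda>t. cis (t * c)) \<in> borel_measurable \<mu>" for c
    unfolding mult.commute[of _ c]
    using isCont_cis_mult by (simp add: borel_measurable_continuous_onI continuous_at_imp_continuous_on)
  have int: "integrable \<mu> (\<lambda>t. cis (t * c))" for c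
    by (rule \<mu>.integrable_const_bound[of _ 1]) (simp_all add: cism)
  have cbound: "cmod (cinner (y n) (y 0)) \<le> \<kappa>" for n
  proof -
    have "norm (y n) = norm (y 0)"
      using stat[of 0 n 0] by (simp add: cinner_self flip: of_real_power)
    then show ?thesis using cinner_cauchy_schwarz[of "y n" "y 0"] by (simp add: \<kappa>_def power2_eq_square)
  qed
  have "good (\<lambda>n. cinner (y (s n)) (y 0) *\<^sub>C f n)" if f: "good f" for f :: "'i \<Rightarrow> 'h"
  proof -
    obtain R where R: "0 \<le> R" "\<And>n. n \<in> idx \<Longrightarrow> norm (f n) \<le> R" by (rule good_bound[OF f]) blast
    show ?thesis
    proof (rule good_dominated[OF f L \<mu>, of _ "\<kappa> * R" "\<kappa>\<^sup>2"])
      show "norm (cinner (y (s n)) (y 0) *\<^sub>C f n) \<le> \<kappa> * R" if "n \<in> idx" for n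
        unfolding norm_scaleC using cbound R(2)[OF that] \<kappa> by (intro mult_mono) auto
      fix I :: "'i set" and w assume I: "finite I"
      define S where "S = (\<Sum>n\<in>I. w n *\<^sub>C (cinner (y (s n)) (y 0) *\<^sub>C f n))"
      define Y where "Y t = (\<Sum>n\<in>I. (w n * cis (t * real (s n))) *\<^sub>C f n)" for t
      \<comment> \<open>Testing \<open>S\<close> against itself keeps the integrand scalar, in place
        of a vector-valued integral of \<open>Y\<close>.\<close>
      have "cinner S S = (\<Sum>n\<in>I. w n * (cinner (y (s n)) (y 0) * cinner (f n) S))"
        by (subst S_def) (simp add: cinner.sum_left cinner_scaleC_left)
      also have "\<dots> = complex_of_real \<kappa> * (\<Sum>n\<in>I. (\<integral>t. (w n * cinner (f n) S) * cis (t * real (s n)) \<partial>\<mu>))"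
        unfolding spec sum_distrib_left by (simp add: mult_ac)
      also have "(\<Sum>n\<in>I. (\<integral>t. (w n * cinner (f n) S) * cis (t * real (s n)) \<partial>\<mu>))
          = (\<integral>t. (\<Sum>n\<in>I. (w n * cinner (f n) S) * cis (t * real (s n))) \<partial>\<mu>)"
        using int by (simp add: Bochner_Integration.integral_sum)
      also have "(\<lambda>t. \<Sum>n\<in>I. (w n * cinner (f n) S) * cis (t * real (s n))) = (\<lambda>t. cinner (Y t) S)"
        by (simp add: Y_def cinner.sum_left cinner_scaleC_left mult_ac)
      finally have SS: "cinner S S = complex_of_real \<kappa> * (\<integral>t. cinner (Y t) S \<partial>\<mu>)" .
      have Ycont: "continuous_on UNIV Y"
        unfolding Y_def cis_conv_exp by (intro continuous_intros scaleC.continuous_on)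
      have Yb: "norm (Y t) \<le> (\<Sum>n\<in>I. cmod (w n) * norm (f n))" for t
        unfolding Y_def by (intro sum_norm_le) (simp add: norm_scaleC norm_mult)
      have Ym: "(\<lambda>t. (norm (Y t))\<^sup>2) \<in> borel_measurable \<mu>"
        by (simp add: borel_measurable_continuous_onI continuous_intros Ycont)
      have Yint: "integrable \<mu> (\<lambda>t. (norm (Y t))\<^sup>2)"
        by (rule \<mu>.integrable_const_bound[of _ "(\<Sum>n\<in>I. cmod (w n) * norm (f n))\<^sup>2"])
          (use Ym Yb in \<open>auto intro!: power_mono\<close>)
      have "(norm S)\<^sup>2 = cmod (cinner S S)"
        by (simp only: cinner_self norm_of_real) simp
      also have "\<dots> = \<kappa> * cmod (\<integral>t. cinner (Y t) S \<partial>\<mu>)"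
        using \<kappa> by (simp add: SS norm_mult)
      also have "\<dots> = cmod (\<integral>t. complex_of_real \<kappa> * cinner (Y t) S \<partial>\<mu>)"
        using \<kappa> by (simp add: norm_mult)
      \<comment> \<open>From \<open>2 x y \<le> x^2 + y^2\<close>; the half of the square of
        \<open>norm S\<close> is absorbed into the left-hand side at the end.\<close>
      also have "\<dots> \<le> (\<integral>t. \<kappa>\<^sup>2 / 2 * (norm (Y t))\<^sup>2 + (norm S)\<^sup>2 / 2 \<partial>\<mu>)"
      proof (rule order_trans[OF integral_norm_bound])
        show "(\<integral>t. cmod (complex_of_real \<kappa> * cinner (Y t) S) \<partial>\<mu>)
          \<le> (\<integral>t. \<kappa>\<^sup>2 / 2 * (norm (Y t))\<^sup>2 + (norm S)\<^sup>2 / 2 \<partial>\<mu>)"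
        proof (rule integral_mono')
          show "cmod (complex_of_real \<kappa> * cinner (Y t) S)
              \<le> \<kappa>\<^sup>2 / 2 * (norm (Y t))\<^sup>2 + (norm S)\<^sup>2 / 2" for t
          proof -
            have "cmod (complex_of_real \<kappa> * cinner (Y t) S) \<le> \<kappa> * (norm (Y t) * norm S)"
              using \<kappa> by (simp add: norm_mult mult_left_mono cinner_cauchy_schwarz)
            also have "\<dots> \<le> \<kappa>\<^sup>2 / 2 * (norm (Y t))\<^sup>2 + (norm S)\<^sup>2 / 2"
              using zero_le_power2[of "\<kappa> * norm (Y t) - norm S"]
              by (simp add: power2_diff power_mult_distrib algebra_simps)
            finally show ?thesis .
          qed
        qed (use Yint in auto)
      qed
      also have "\<dots> = \<kappa>\<^sup>2 / 2 * (\<integral>t. (norm (Y t))\<^sup>2 \<partial>\<mu>) + (norm S)\<^sup>2 / 2"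
        using Yint \<mu>.prob_space by simp
      finally show "(norm (\<Sum>n\<in>I. w n *\<^sub>C (cinner (y (s n)) (y 0) *\<^sub>C f n)))\<^sup>2
          \<le> \<kappa>\<^sup>2 * (\<integral>t. (norm (\<Sum>n\<in>I. (w n * cis (t * real (s n))) *\<^sub>C f n))\<^sup>2 \<partial>\<mu>)"
        unfolding S_def[symmetric] Y_def[symmetric] by simp
    qed simp
  qed
  then show ?thesis using cbound by (auto simp: multiplier_def)
qed

subsection \<open>Functions with totally bounded range\<close>

text \<open>The invariant carried through the product from right to left. Total boundedness gives
  uniform approximation by projections onto finite-dimensional spaces, and the second clause makes
  their coordinates admissible scalar factors.\<close>

definition compact_multiplier :: "('i \<Rightarrow> 'h::chilbert) \<Rightarrow> bool" where
  "compact_multiplier F \<longleftrightarrow> totally_bounded (F ` idx) \<and>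
     (\<forall>e. multiplier TYPE('h) (\<lambda>n. cinner (F n) e))"

lemma compact_multiplier_const: "compact_multiplier (\<lambda>_. v)"
  by (auto simp: compact_multiplier_def multiplier_const totally_bounded_metric intro!: exI[of _ "{v}"])

text \<open>Project onto the span of a finite \<open>\<epsilon> / 2\<close>-net: net points are
  fixed and projections are contractions, so the error is at most twice the distance to the
  net.\<close>

lemma finite_rank_approximation:
  fixes F :: "'i \<Rightarrow> 'h::chilbert"
  assumes "compact_multiplier F" "\<epsilon> > 0"
  obtains E where "orthonormal E" "\<And>n. n \<in> idx \<Longrightarrow> norm (F n - proj E (F n)) \<le> \<epsilon>"
proof -
  have "\<exists>X. finite X \<and> F ` idx \<subseteq> (\<Union>x\<in>X. {y. dist x y < \<epsilon> / 2})"
    using assms unfolding compact_multiplier_def totally_bounded_metric by (meson half_gt_zero)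
  then obtain X where X: "finite X" "F ` idx \<subseteq> (\<Union>x\<in>X. {y. dist x y < \<epsilon> / 2})" by blast
  obtain E where E: "orthonormal E" "\<And>x. x \<in> X \<Longrightarrow> proj E x = x"
    using gram_schmidt[OF X(1)] by blast
  have "norm (F n - proj E (F n)) \<le> \<epsilon>" if n: "n \<in> idx" for n
  proof -
    obtain x where x: "x \<in> X" "dist x (F n) < \<epsilon> / 2" using X(2) n by blast
    have "F n - proj E (F n) = (F n - x) - proj E (F n - x)"
      by (simp add: proj_diff E(2)[OF x(1)])
    also have "norm \<dots> \<le> norm (F n - x) + norm (F n - x)"
      by (intro order_trans[OF norm_triangle_ineq4] add_left_mono norm_proj_le E)
    finally show ?thesis using x(2) by (simp add: dist_norm norm_minus_commute)
  qed
  then show ?thesis using that E(1) by blast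
qed

section \<open>Bounded families of operators applied along an index function\<close>

context
  fixes R :: "nat \<Rightarrow> 'h::chilbert \<Rightarrow>\<^sub>L 'h" and C :: real and s :: "'i \<Rightarrow> nat"
  assumes R_linear: "\<And>m. R m \<in> bounded_ops" and R_bound: "\<And>m. norm (R m) \<le> C"
begin

lemma operator_bound_apply: "norm (blinfun_apply (R m) x) \<le> C * norm x"
  by (meson R_bound mult_right_mono norm_blinfun norm_ge_zero order_trans)

lemma operator_bound_nonneg: "0 \<le> C"
  using R_bound norm_ge_zero order_trans by blast

lemma operator_proj: "blinfun_apply (R m) (proj E x) = (\<Sum>e\<in>E. cinner x e *\<^sub>C blinfun_apply (R m) e)"
  by (simp add: proj_def blinfun.sum_right bounded_opsD[OF R_linear])

lemma finite_rank_operator_approximation: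
  assumes F: "compact_multiplier F" and "\<epsilon> > 0"
  obtains E where "orthonormal E"
    "\<And>n. n \<in> idx \<Longrightarrow>
      norm (blinfun_apply (R (s n)) (F n) - (\<Sum>e\<in>E. cinner (F n) e *\<^sub>C blinfun_apply (R (s n)) e)) \<le> \<epsilon>"
proof -
  \<comment> \<open>\<open>C + 1\<close> rather than \<open>C\<close> avoids a division by
    zero.\<close>
  have "\<epsilon> / (C + 1) > 0" using assms(2) operator_bound_nonneg by simp
  from finite_rank_approximation[OF F this]
  obtain E where E: "orthonormal E" "\<And>n. n \<in> idx \<Longrightarrow> norm (F n - proj E (F n)) \<le> \<epsilon> / (C + 1)"
    by metis
  have "norm (blinfun_apply (R (s n)) (F n) - (\<Sum>e\<in>E. cinner (F n) e *\<^sub>C blinfun_apply (R (s n)) e)) \<le> \<epsilon>"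
    if "n \<in> idx" for n
  proof -
    have "norm (blinfun_apply (R (s n)) (F n - proj E (F n))) \<le> C * norm (F n - proj E (F n))"
      by (rule operator_bound_apply)
    also have "\<dots> \<le> (C + 1) * (\<epsilon> / (C + 1))"
      using E(2)[OF that] operator_bound_nonneg by (intro mult_mono) auto
    finally show ?thesis using operator_bound_nonneg by (simp add: blinfun.diff_right operator_proj)
  qed
  then show ?thesis using that E(1) by blast
qed

text \<open>For total boundedness, take a net of the range of \<open>F\<close>, then nets of the
  orbits of its finitely many points; the bound on \<open>R\<close> combines them. For the
  coefficients, finite-rank approximation of \<open>F\<close> gives uniformly close finite sums of
  products of two multipliers.\<close>

lemma compact_multiplier_step:
  assumes F: "compact_multiplier F"
    and tb: "\<And>x. totally_bounded (range (\<lambda>m. blinfun_apply (R m) x))"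
    and coef: "\<And>x e. multiplier TYPE('h) (\<lambda>n. cinner (blinfun_apply (R (s n)) x) e)"
  shows "compact_multiplier (\<lambda>n. blinfun_apply (R (s n)) (F n))"
  unfolding compact_multiplier_def
proof (intro conjI allI)
  show "totally_bounded ((\<lambda>n. blinfun_apply (R (s n)) (F n)) ` idx)"
    unfolding totally_bounded_metric
  proof (intro allI impI)
    fix \<epsilon> :: real assume \<epsilon>: "\<epsilon> > 0"
    define \<delta> where "\<delta> = \<epsilon> / (2 * (C + 1))"
    have \<delta>: "\<delta> > 0" using \<epsilon> operator_bound_nonneg by (simp add: \<delta>_def)
    have "\<exists>X. finite X \<and> F ` idx \<subseteq> (\<Union>x\<in>X. {y. dist x y < \<delta>})"
      using F \<delta> unfolding compact_multiplier_def totally_bounded_metric by blast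
    then obtain X where X: "finite X" "F ` idx \<subseteq> (\<Union>x\<in>X. {y. dist x y < \<delta>})" by blast
    have "\<exists>Y. finite Y \<and> range (\<lambda>m. blinfun_apply (R m) x) \<subseteq> (\<Union>z\<in>Y. {y. dist z y < \<epsilon> / 2})" for x
      using tb[of x] \<epsilon> unfolding totally_bounded_metric by (meson half_gt_zero)
    then obtain Y where Y: "\<And>x. finite (Y x)"
      "\<And>x. range (\<lambda>m. blinfun_apply (R m) x) \<subseteq> (\<Union>z\<in>Y x. {y. dist z y < \<epsilon> / 2})" by metis
    have "blinfun_apply (R (s n)) (F n) \<in> (\<Union>z\<in>(\<Union>x\<in>X. Y x). {y. dist z y < \<epsilon>})" if "n \<in> idx" for n
    proof -
      obtain x where x: "x \<in> X" "dist x (F n) < \<delta>" using X(2) \<open>n \<in> idx\<close> by blast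
      obtain z where z: "z \<in> Y x" "dist z (blinfun_apply (R (s n)) x) < \<epsilon> / 2" using Y(2)[of x] by blast
      have "dist (blinfun_apply (R (s n)) x) (blinfun_apply (R (s n)) (F n)) \<le> C * dist x (F n)"
        using operator_bound_apply[of "s n" "x - F n"] by (simp add: dist_norm blinfun.diff_right)
      also have "\<dots> \<le> (C + 1) * \<delta>" using x(2) operator_bound_nonneg by (intro mult_mono) auto
      also have "\<dots> = \<epsilon> / 2" using operator_bound_nonneg by (simp add: \<delta>_def field_simps)
      finally have "dist z (blinfun_apply (R (s n)) (F n)) < \<epsilon>"
        using z(2) dist_triangle[of z "blinfun_apply (R (s n)) (F n)" "blinfun_apply (R (s n)) x"] by linarith
      then show ?thesis using x(1) z(1) by blast
    qed
    then show "\<exists>k. finite k \<and> (\<lambda>n. blinfun_apply (R (s n)) (F n)) ` idx \<subseteq> (\<Union>x\<in>k. {y. dist x y < \<epsilon>})"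
      using X(1) Y(1) by (intro exI[of _ "\<Union>x\<in>X. Y x"]) blast
  qed
  fix e
  show "multiplier TYPE('h) (\<lambda>n. cinner (blinfun_apply (R (s n)) (F n)) e)"
  proof (rule multiplier_uniform_limit)
    fix \<epsilon> :: real assume \<epsilon>: "\<epsilon> > 0"
    have "\<epsilon> / (norm e + 1) > 0" using \<epsilon> by (simp add: add_nonneg_pos)
    from finite_rank_operator_approximation[OF F this]
    obtain E where E: "orthonormal E" "\<And>n. n \<in> idx \<Longrightarrow>
      norm (blinfun_apply (R (s n)) (F n) - (\<Sum>f\<in>E. cinner (F n) f *\<^sub>C blinfun_apply (R (s n)) f))
        \<le> \<epsilon> / (norm e + 1)" by metis
    define g where "g n = (\<Sum>f\<in>E. cinner (F n) f * cinner (blinfun_apply (R (s n)) f) e)" for n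
    have "multiplier TYPE('h) g"
      unfolding g_def
    proof (rule multiplier_sum)
      show "finite E" using E(1) by (simp add: orthonormal_def)
      show "multiplier TYPE('h) (\<lambda>n. cinner (F n) f * cinner (blinfun_apply (R (s n)) f) e)" for f
        using F by (intro multiplier_mult coef) (simp add: compact_multiplier_def)
    qed
    moreover have "cmod (cinner (blinfun_apply (R (s n)) (F n)) e - g n) \<le> \<epsilon>" if "n \<in> idx" for n
    proof -
      have "cinner (blinfun_apply (R (s n)) (F n)) e - g n
        = cinner (blinfun_apply (R (s n)) (F n) - (\<Sum>f\<in>E. cinner (F n) f *\<^sub>C blinfun_apply (R (s n)) f)) e"
        by (simp add: g_def cinner.diff_left cinner.sum_left cinner_scaleC_left)
      also have "cmod \<dots> \<le> (\<epsilon> / (norm e + 1)) * (norm e + 1)"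
        using E(2)[OF that] \<epsilon>
        by (intro order_trans[OF cinner_cauchy_schwarz] mult_mono) (auto simp: add_nonneg_nonneg)
      finally show ?thesis by (simp add: add_nonneg_eq_0_iff)
    qed
    ultimately show "\<exists>g. multiplier TYPE('h) g \<and>
        (\<forall>n\<in>idx. cmod (cinner (blinfun_apply (R (s n)) (F n)) e - g n) \<le> \<epsilon>)" by blast
  qed
qed

text \<open>Serves the leftmost power of \<open>u\<close>. Compactness enters through
  \<open>F\<close> alone: the finite-rank approximation leaves scalar multipliers times orbits of
  fixed vectors, of which only goodness is assumed.\<close>

lemma good_compact_multiplier:
  assumes F: "compact_multiplier F" and good: "\<And>x. good (\<lambda>n. blinfun_apply (R (s n)) x)"
  shows "good (\<lambda>n. blinfun_apply (R (s n)) (F n))"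
proof (rule good_uniform_limit)
  fix \<epsilon> :: real assume "\<epsilon> > 0"
  from finite_rank_operator_approximation[OF F this]
  obtain E where E: "orthonormal E" "\<And>n. n \<in> idx \<Longrightarrow>
    norm (blinfun_apply (R (s n)) (F n) - (\<Sum>f\<in>E. cinner (F n) f *\<^sub>C blinfun_apply (R (s n)) f)) \<le> \<epsilon>"
    by metis
  have "good (\<lambda>n. \<Sum>f\<in>E. cinner (F n) f *\<^sub>C blinfun_apply (R (s n)) f)"
  proof (rule good_sum)
    show "finite E" using E(1) by (simp add: orthonormal_def)
    show "good (\<lambda>n. cinner (F n) f *\<^sub>C blinfun_apply (R (s n)) f)" for f
      using F by (intro good_multiplier good) (simp add: compact_multiplier_def)
  qed
  then show "\<exists>g. good g \<and> (\<forall>n\<in>idx. norm (blinfun_apply (R (s n)) (F n) - g n) \<le> \<epsilon>)"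
    using E(2) by blast
qed

end

end

section \<open>The entangled ergodic theorem\<close>

lemma op_pow_0 [simp]: "op_pow T 0 = id_blinfun"
  by (simp add: op_pow_def)

lemma op_pow_Suc: "op_pow T (Suc n) = T o\<^sub>L op_pow T n"
  by (simp add: op_pow_def)

lemma op_pow_apply: "blinfun_apply (op_pow T n) x = (blinfun_apply T ^^ n) x"
  by (induction n) (simp_all add: op_pow_Suc)

lemma op_pow_add: "blinfun_apply (op_pow T (m + n)) x = blinfun_apply (op_pow T m) (blinfun_apply (op_pow T n) x)"
  by (simp add: op_pow_apply funpow_add)

lemma op_pow_bounded_ops:
  assumes "T \<in> bounded_ops" shows "op_pow T n \<in> bounded_ops"
  using assms by (induction n) (simp_all add: op_pow_Suc bounded_ops_def)

lemma compose_bounded_ops: "S \<in> bounded_ops \<Longrightarrow> T \<in> bounded_ops \<Longrightarrow> S o\<^sub>L T \<in> bounded_ops"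
  by (simp add: bounded_ops_def)

lemma unitary_op_inv:
  assumes "unitary_op u"
  shows "is_adjoint (op_inv u) u" "op_inv u o\<^sub>L u = id_blinfun" "u o\<^sub>L op_inv u = id_blinfun"
    "unitary_op (op_inv u)"
proof -
  obtain V where V: "is_adjoint V u" "V o\<^sub>L u = id_blinfun" "u o\<^sub>L V = id_blinfun" "u \<in> bounded_ops"
    using assms by (auto simp: unitary_op_def)
  have inv: "op_inv u = V" using V by (intro op_inv_eqI)
  show "is_adjoint (op_inv u) u" "op_inv u o\<^sub>L u = id_blinfun" "u o\<^sub>L op_inv u = id_blinfun"
    using V inv by simp_all
  have "V \<in> bounded_ops"
    unfolding bounded_ops_def
  proof (intro CollectI allI cinner_eqI)
    fix c x z
    show "cinner z (blinfun_apply V (c *\<^sub>C x)) = cinner z (c *\<^sub>C blinfun_apply V x)"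
      by (simp add: is_adjointD[OF V(1), symmetric] cinner_scaleC_right)
  qed
  then show "unitary_op (op_inv u)"
    unfolding inv unitary_op_def using is_adjoint_sym[OF V(1)] V by blast
qed

lemma unitary_op_bounded_ops: "unitary_op u \<Longrightarrow> u \<in> bounded_ops"
  by (simp add: unitary_op_def)

lemma unitary_op_inv_apply:
  assumes "unitary_op u"
  shows "blinfun_apply (op_inv u) (blinfun_apply u x) = x" "blinfun_apply u (blinfun_apply (op_inv u) x) = x"
  using unitary_op_inv(2,3)[OF assms] by (metis blinfun_apply_blinfun_compose blinfun_apply_id_blinfun id_apply)+

lemma unitary_cinner:
  assumes "unitary_op u"
  shows "cinner (blinfun_apply u x) (blinfun_apply u y) = cinner x y"
  by (simp add: is_adjointD[OF unitary_op_inv(1)[OF assms]] unitary_op_inv_apply[OF assms])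

lemma unitary_pow_cinner:
  assumes "unitary_op u"
  shows "cinner (blinfun_apply (op_pow u m) x) (blinfun_apply (op_pow u m) y) = cinner x y"
  by (induction m) (simp_all add: op_pow_Suc unitary_cinner[OF assms])

lemma unitary_pow_norm:
  assumes "unitary_op u" shows "norm (blinfun_apply (op_pow u m) x) = norm x"
proof -
  have "complex_of_real ((norm (blinfun_apply (op_pow u m) x))\<^sup>2) = complex_of_real ((norm x)\<^sup>2)"
    unfolding cinner_self[symmetric] by (rule unitary_pow_cinner[OF assms])
  then have "(norm (blinfun_apply (op_pow u m) x))\<^sup>2 = (norm x)\<^sup>2" by (simp only: of_real_eq_iff)
  then show ?thesis by (simp add: power2_eq_iff_nonneg)
qed

lemma norm_compose_unitary_pow:
  assumes "unitary_op u" shows "norm (T o\<^sub>L op_pow u m) \<le> norm T"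
proof (rule norm_blinfun_bound)
  fix x
  show "norm (blinfun_apply (T o\<^sub>L op_pow u m) x) \<le> norm T * norm x"
    using norm_blinfun[of T "blinfun_apply (op_pow u m) x"] by (simp add: unitary_pow_norm[OF assms])
qed simp

lemma unitary_stationary:
  assumes "unitary_op u"
  shows "cinner (blinfun_apply (op_pow u (n + m)) x) (blinfun_apply (op_pow u (n' + m)) x)
    = cinner (blinfun_apply (op_pow u n) x) (blinfun_apply (op_pow u n') x)"
  by (simp add: add.commute[of _ m] op_pow_add unitary_pow_cinner[OF assms])

text \<open>Evaluation at a vector is continuous for the strong operator topology, so it maps the
  compact closure to a norm-compact set.\<close>

lemma strongly_relatively_compact_orbit:
  assumes "strongly_relatively_compact {f n |n. n \<ge> (1::nat)}"
  shows "totally_bounded (range (\<lambda>n. blinfun_apply (f n) x))"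
proof -
  define S where "S = {f n |n. n \<ge> 1}"
  define X where "X = subtopology strong_operator_topology (bounded_ops :: ('a \<Rightarrow>\<^sub>L 'a) set)"
  have S: "S \<subseteq> bounded_ops" "compactin X (X closure_of S)"
    using assms by (auto simp: strongly_relatively_compact_def S_def X_def Let_def)
  have "continuous_map X euclidean (\<lambda>T. blinfun_apply T x)"
    unfolding X_def
    by (intro continuous_map_from_subtopology strong_operator_topology_continuous_evaluation)
  from image_compactin[OF S(2) this]
  have comp: "compact ((\<lambda>T. blinfun_apply T x) ` (X closure_of S))" by simp
  have sub: "S \<subseteq> X closure_of S"
    using S(1) by (intro closure_of_subset) (simp add: X_def strong_operator_topology_topspace)
  show ?thesis
    unfolding totally_bounded_metric
  proof (intro allI impI)
    fix \<epsilon> :: real assume "\<epsilon> > 0"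
    then obtain k where k: "finite k" "(\<lambda>T. blinfun_apply T x) ` (X closure_of S) \<subseteq> (\<Union>z\<in>k. ball z \<epsilon>)"
      using seq_compact_imp_totally_bounded[OF compact_imp_seq_compact[OF comp]] by blast
    \<comment> \<open>The hypothesis covers \<open>n \<ge> 1\<close>, but exponents may be 0; the
      point for \<open>n = 0\<close> is added to the net by hand.\<close>
    have "blinfun_apply (f n) x \<in> (\<Union>z\<in>insert (blinfun_apply (f 0) x) k. {y. dist z y < \<epsilon>})" for n
    proof (cases "n = 0")
      case False
      then have "f n \<in> S" by (auto simp: S_def)
      then have "blinfun_apply (f n) x \<in> (\<Union>z\<in>k. ball z \<epsilon>)" using sub k(2) by blast
      then show ?thesis by auto
    qed (use \<open>\<epsilon> > 0\<close> in auto)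
    then show "\<exists>k. finite k \<and> range (\<lambda>n. blinfun_apply (f n) x) \<subseteq> (\<Union>z\<in>k. {y. dist z y < \<epsilon>})"
      using k(1) by (intro exI[of _ "insert (blinfun_apply (f 0) x) k"]) blast
  qed
qed

section \<open>Twisted averages of products containing powers of a unitary\<close>

context phase_averages
begin

text \<open>Moving \<open>T\<close> across the inner product leaves a coefficient of a power of
  \<open>u\<close> alone; polarisation then expresses it through pairings of the vectors
  \<open>w j\<close> with their own orbits, where Herglotz' theorem applies.\<close>

lemma multiplier_unitary_coefficient:
  fixes u T :: "'b::chilbert \<Rightarrow>\<^sub>L 'b"
  assumes u: "unitary_op u" and T: "T \<in> bounded_ops" and s: "(\<lambda>n. real (s n)) \<in> \<Psi>"
  shows "multiplier TYPE('h::chilbert) (\<lambda>n. cinner (blinfun_apply (T o\<^sub>L op_pow u (s n)) x) e)"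
proof -
  obtain S where S: "\<And>x y. cinner (blinfun_apply T x) y = cinner x (S y)"
    using bounded_ops_adjoint[OF T] by metis
  define w where "w j = x + \<i> ^ j *\<^sub>C S e" for j :: nat
  have "cinner (blinfun_apply (T o\<^sub>L op_pow u (s n)) x) e
      = (\<Sum>j<4. \<i> ^ j / 4 * cinner (blinfun_apply (op_pow u (s n)) (w j)) (blinfun_apply (op_pow u 0) (w j)))" for n
    using cinner_polarization[OF op_pow_bounded_ops[OF unitary_op_bounded_ops[OF u]], of "s n" x "S e"]
    by (simp only: S w_def op_pow_0 blinfun_apply_id_blinfun blinfun_apply_blinfun_compose id_apply)
  moreover have "multiplier TYPE('h) (\<lambda>n. \<Sum>j<4. \<i> ^ j / 4 *
      cinner (blinfun_apply (op_pow u (s n)) (w j)) (blinfun_apply (op_pow u 0) (w j)))"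
  proof (rule multiplier_sum)
    fix j
    show "multiplier TYPE('h) (\<lambda>n. \<i> ^ j / 4 *
        cinner (blinfun_apply (op_pow u (s n)) (w j)) (blinfun_apply (op_pow u 0) (w j)))"
      by (rule multiplier_mult[OF multiplier_const
          multiplier_stationary[where y="\<lambda>m. blinfun_apply (op_pow u m) (w j)",
            OF unitary_stationary[OF u] s]])
  qed simp
  ultimately show ?thesis by simp
qed

lemma compact_multiplier_unitary_step:
  fixes F :: "'i \<Rightarrow> 'h::chilbert"
  assumes F: "compact_multiplier F" and u: "unitary_op u" and T: "T \<in> bounded_ops"
    and s: "(\<lambda>n. real (s n)) \<in> \<Psi>"
    and rc: "strongly_relatively_compact {T o\<^sub>L op_pow u n |n. n \<ge> 1}"
  shows "compact_multiplier (\<lambda>n. blinfun_apply T (blinfun_apply (op_pow u (s n)) (F n)))"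
proof -
  have "compact_multiplier (\<lambda>n. blinfun_apply (T o\<^sub>L op_pow u (s n)) (F n))"
  proof (rule compact_multiplier_step[where R="\<lambda>m. T o\<^sub>L op_pow u m" and C="norm T"])
    show "T o\<^sub>L op_pow u m \<in> bounded_ops" for m
      by (intro compose_bounded_ops T op_pow_bounded_ops unitary_op_bounded_ops u)
    show "norm (T o\<^sub>L op_pow u m) \<le> norm T" for m by (rule norm_compose_unitary_pow[OF u])
    show "totally_bounded (range (\<lambda>m. blinfun_apply (T o\<^sub>L op_pow u m) x))" for x
      by (rule strongly_relatively_compact_orbit[OF rc])
    show "multiplier TYPE('h) (\<lambda>n. cinner (blinfun_apply (T o\<^sub>L op_pow u (s n)) x) e)" for x e
      by (rule multiplier_unitary_coefficient[OF u T s])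
  qed (rule F)
  then show ?thesis by simp
qed

lemma good_unitary:
  fixes F :: "'i \<Rightarrow> 'h::chilbert"
  assumes F: "compact_multiplier F" and u: "unitary_op u" and s: "(\<lambda>n. real (s n)) \<in> \<Psi>"
  shows "good (\<lambda>n. blinfun_apply (op_pow u (s n)) (F n))"
proof (rule good_compact_multiplier[where R="op_pow u" and C=1])
  show "op_pow u m \<in> bounded_ops" for m
    by (intro op_pow_bounded_ops unitary_op_bounded_ops u)
  show "norm (op_pow u m) \<le> 1" for m
    by (rule norm_blinfun_bound) (simp_all add: unitary_pow_norm[OF u])
  show "good (\<lambda>n. blinfun_apply (op_pow u (s n)) x)" for x
    by (rule good_stationary[where y="\<lambda>m. blinfun_apply (op_pow u m) x"]) (intro unitary_stationary u s)+
qed (rule F)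

text \<open>The exponents enter only as members of \<open>\<Psi>\<close>, so several of them may
  depend on the same variable. The vector \<open>v\<close> is arbitrary because \<open>u\<close> may
  move the image of the unit.\<close>

theorem good_entangled:
  fixes u :: "'h::chilbert \<Rightarrow>\<^sub>L 'h" and a :: "nat \<Rightarrow> 'h \<Rightarrow>\<^sub>L 'h" and q :: "nat \<Rightarrow> 'i \<Rightarrow> nat"
  assumes u: "unitary_op u" and k: "1 \<le> k"
    and a: "\<And>l. l \<in> {1..k} \<Longrightarrow> a l \<in> bounded_ops"
    and q: "\<And>l. l \<in> {1..k} \<Longrightarrow> (\<lambda>n. real (q l n)) \<in> \<Psi>" and s: "(\<lambda>n. real (s n)) \<in> \<Psi>"
    and rck: "strongly_relatively_compact {a k o\<^sub>L op_pow (op_inv u) n |n. n \<ge> 1}"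
    and rc: "\<And>l. 1 \<le> l \<Longrightarrow> l \<le> k - 1 \<Longrightarrow> strongly_relatively_compact {a l o\<^sub>L op_pow u n |n. n \<ge> 1}"
  shows "good (\<lambda>n. blinfun_apply (op_pow u (q 1 n))
    (foldr (\<lambda>l x. blinfun_apply (a l) (blinfun_apply (op_pow u (q (Suc l) n)) x)) [1..<k]
      (blinfun_apply (a k) (blinfun_apply (op_pow (op_inv u) (s n)) v))))"
proof -
  \<comment> \<open>Generalised to any list of positions below \<open>k\<close>, so that the
    induction can strip the head of the list. Total boundedness survives each factor because
    \<open>a l\<close> acts after the power of \<open>u\<close>.\<close>
  have "compact_multiplier (\<lambda>n. foldr (\<lambda>l x. blinfun_apply (a l) (blinfun_apply (op_pow u (q (Suc l) n)) x)) ls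
      (blinfun_apply (a k) (blinfun_apply (op_pow (op_inv u) (s n)) v)))"
    if "set ls \<subseteq> {1..<k}" for ls
    using that
  proof (induction ls)
    case Nil
    then show ?case
      using k by (simp add: compact_multiplier_unitary_step[OF compact_multiplier_const unitary_op_inv(4)[OF u] a s rck])
  next
    case (Cons l ls)
    then have l: "l \<in> {1..k}" "Suc l \<in> {1..k}" "1 \<le> l" "l \<le> k - 1" by auto
    have IH: "compact_multiplier (\<lambda>n. foldr (\<lambda>l x. blinfun_apply (a l) (blinfun_apply (op_pow u (q (Suc l) n)) x)) ls
      (blinfun_apply (a k) (blinfun_apply (op_pow (op_inv u) (s n)) v)))"
      using Cons by simp
    show ?case
      using compact_multiplier_unitary_step[OF IH u a[OF l(1)] q[OF l(2)] rc[OF l(3,4)]] by simp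
  qed
  from good_unitary[OF this[of "[1..<k]"] u q[of 1]] k show ?thesis by simp
qed

end

subsection \<open>Polynomial phases on boxes\<close>

text \<open>The formula is imposed only on boxes: elsewhere an exponent written with
  \<open>nat\<close> may differ from the polynomial value. Real coefficients \<theta> make this a
  real vector space.\<close>

definition poly_phases :: "nat \<Rightarrow> (nat \<Rightarrow> int poly) \<Rightarrow> ((nat \<Rightarrow> nat) \<Rightarrow> real) set" where
  "poly_phases r p = {\<psi>. \<exists>\<theta>. \<forall>N. \<forall>n\<in>{1..r} \<rightarrow>\<^sub>E {1..N}.
     \<psi> n = (\<Sum>i\<in>{1..r}. \<theta> i * real_of_int (poly (p i) (int (n i))))}"

lemma poly_phases_add:
  assumes "\<psi> \<in> poly_phases r p" "\<psi>' \<in> poly_phases r p"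
  shows "(\<lambda>n. \<psi> n + \<psi>' n) \<in> poly_phases r p"
proof -
  obtain \<theta> where \<theta>: "\<And>N n. n \<in> {1..r} \<rightarrow>\<^sub>E {1..N} \<Longrightarrow>
      \<psi> n = (\<Sum>i\<in>{1..r}. \<theta> i * real_of_int (poly (p i) (int (n i))))"
    using assms(1) unfolding poly_phases_def by blast
  obtain \<theta>' where \<theta>': "\<And>N n. n \<in> {1..r} \<rightarrow>\<^sub>E {1..N} \<Longrightarrow>
      \<psi>' n = (\<Sum>i\<in>{1..r}. \<theta>' i * real_of_int (poly (p i) (int (n i))))"
    using assms(2) unfolding poly_phases_def by blast
  have "\<psi> n + \<psi>' n = (\<Sum>i\<in>{1..r}. (\<theta> i + \<theta>' i) * real_of_int (poly (p i) (int (n i))))"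
    if "n \<in> {1..r} \<rightarrow>\<^sub>E {1..N}" for N n
    using \<theta>[OF that] \<theta>'[OF that] by (simp add: distrib_right sum.distrib)
  then show ?thesis unfolding poly_phases_def by (intro CollectI exI[of _ "\<lambda>i. \<theta> i + \<theta>' i"]) blast
qed

lemma poly_phases_scale:
  assumes "\<psi> \<in> poly_phases r p" shows "(\<lambda>n. c * \<psi> n) \<in> poly_phases r p"
proof -
  obtain \<theta> where \<theta>: "\<And>N n. n \<in> {1..r} \<rightarrow>\<^sub>E {1..N} \<Longrightarrow>
      \<psi> n = (\<Sum>i\<in>{1..r}. \<theta> i * real_of_int (poly (p i) (int (n i))))"
    using assms unfolding poly_phases_def by blast
  have "c * \<psi> n = (\<Sum>i\<in>{1..r}. (c * \<theta> i) * real_of_int (poly (p i) (int (n i))))"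
    if "n \<in> {1..r} \<rightarrow>\<^sub>E {1..N}" for N n
    using \<theta>[OF that] by (simp add: sum_distrib_left mult.assoc)
  then show ?thesis unfolding poly_phases_def by (intro CollectI exI[of _ "\<lambda>i. c * \<theta> i"]) blast
qed

lemma poly_phases_zero: "(\<lambda>_. 0) \<in> poly_phases r p"
  unfolding poly_phases_def by (intro CollectI exI[of _ "\<lambda>_. 0"]) simp

lemma poly_phases_sum:
  assumes "finite D" "\<And>d. d \<in> D \<Longrightarrow> \<psi> d \<in> poly_phases r p"
  shows "(\<lambda>n. \<Sum>d\<in>D. \<psi> d n) \<in> poly_phases r p"
  using assms by (induction D) (auto intro: poly_phases_zero poly_phases_add)

lemma poly_phases_single:
  assumes "i \<in> {1..r}" and "p i \<in> nonneg_int_polys"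
  shows "(\<lambda>n. real (nat (poly (p i) (int (n i))))) \<in> poly_phases r p"
proof -
  have "real (nat (poly (p i) (int (n i))))
      = (\<Sum>j\<in>{1..r}. (if j = i then 1 else 0) * real_of_int (poly (p j) (int (n j))))"
    if "n \<in> {1..r} \<rightarrow>\<^sub>E {1..N}" for n N
  proof -
    have "n i \<ge> 1" using PiE_mem[OF that assms(1)] by simp
    then have "poly (p i) (int (n i)) \<ge> 0" using assms(2) by (simp add: nonneg_int_polys_def)
    moreover have "(\<Sum>j\<in>{1..r}. (if j = i then 1 else 0) * real_of_int (poly (p j) (int (n j))))
        = (\<Sum>j\<in>{1..r}. if j = i then real_of_int (poly (p j) (int (n j))) else 0)"
      by (intro sum.cong) auto
    ultimately show ?thesis using assms(1) by simp
  qed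
  then show ?thesis
    unfolding poly_phases_def by (intro CollectI exI[of _ "\<lambda>j. if j = i then 1 else 0"]) blast
qed

lemma cis_sum: "finite I \<Longrightarrow> cis (\<Sum>i\<in>I. f i) = (\<Prod>i\<in>I. cis (f i))"
  by (induction I rule: finite_induct) (simp_all add: cis_mult[symmetric])

text \<open>The exponential of a sum of one-variable terms factorises, so the box average is a
  product of one-variable averages, each covered by
  \<open>convergent_average_polynomial_phase\<close>.\<close>

lemma phase_averages_box: "phase_averages (\<lambda>N. {1..r} \<rightarrow>\<^sub>E {1..N}) (poly_phases r p)"
proof
  show "finite ({1..r} \<rightarrow>\<^sub>E {1..N::nat})" for N by (intro finite_PiE) auto
  fix \<psi> assume "\<psi> \<in> poly_phases r p"
  then obtain \<theta> where \<theta>: "\<And>N n. n \<in> {1..r} \<rightarrow>\<^sub>E {1..N} \<Longrightarrow>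
      \<psi> n = (\<Sum>i\<in>{1..r}. \<theta> i * real_of_int (poly (p i) (int (n i))))"
    unfolding poly_phases_def by blast
  define b where "b i N = (1 / real N) *\<^sub>R (\<Sum>m=1..N. cis (\<theta> i * real_of_int (poly (p i) (int m))))" for i N
  have "(1 / real (card ({1..r} \<rightarrow>\<^sub>E {1..N}))) *\<^sub>R (\<Sum>n\<in>{1..r} \<rightarrow>\<^sub>E {1..N}. cis (\<psi> n))
      = (\<Prod>i\<in>{1..r}. b i N)" for N
  proof -
    have "(\<Sum>n\<in>{1..r} \<rightarrow>\<^sub>E {1..N}. cis (\<psi> n))
        = (\<Sum>n\<in>{1..r} \<rightarrow>\<^sub>E {1..N}. \<Prod>i\<in>{1..r}. cis (\<theta> i * real_of_int (poly (p i) (int (n i)))))"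
      by (intro sum.cong refl) (simp add: \<theta> cis_sum)
    also have "\<dots> = (\<Prod>i\<in>{1..r}. \<Sum>m\<in>{1..N}. cis (\<theta> i * real_of_int (poly (p i) (int m))))"
      by (rule prod_sum_PiE[symmetric]) auto
    finally show ?thesis
      by (simp add: b_def card_PiE scaleR_conv_of_real prod_dividef)
  qed
  moreover have "convergent (\<lambda>N. \<Prod>i\<in>{1..r}. b i N)"
  proof -
    have "\<exists>l. b i \<longlonglongrightarrow> l" for i
      using convergent_average_polynomial_phase[of "\<theta> i" "p i"] by (simp add: b_def[abs_def] convergent_def)
    then obtain l where "\<And>i. b i \<longlonglongrightarrow> l i" by metis
    then have "(\<lambda>N. \<Prod>i\<in>{1..r}. b i N) \<longlonglongrightarrow> (\<Prod>i\<in>{1..r}. l i)" by (intro tendsto_prod)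
    then show ?thesis by (auto simp: convergent_def)
  qed
  ultimately show "convergent (\<lambda>N. (1 / real (card ({1..r} \<rightarrow>\<^sub>E {1..N}))) *\<^sub>R
      (\<Sum>n\<in>{1..r} \<rightarrow>\<^sub>E {1..N}. cis (\<psi> n)))" by simp
qed (auto intro: poly_phases_zero poly_phases_add poly_phases_scale)

section \<open>Von Neumann algebras\<close>

lemma tendsto_fun_iff:
  fixes l :: "'a \<Rightarrow> 'b::topological_space"
  shows "(f \<longlongrightarrow> l) F \<longleftrightarrow> (\<forall>p. ((\<lambda>j. f j p) \<longlongrightarrow> l p) F)"
  using limitin_componentwise[of "\<lambda>_. euclidean" UNIV f l F]
  by (simp add: euclidean_product_topology)

lemma limitin_pullback_topology:
  assumes "l \<in> A" "\<And>j. g j \<in> A" "limitin T (\<lambda>j. f (g j)) (f l) F"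
  shows "limitin (pullback_topology A f T) g l F"
  unfolding limitin_def
proof (intro conjI allI impI)
  show "l \<in> topspace (pullback_topology A f T)"
    using assms(1) assms(3) by (auto simp: topspace_pullback_topology limitin_def)
  fix U assume "openin (pullback_topology A f T) U \<and> l \<in> U"
  then obtain V where V: "openin T V" "U = f -` V \<inter> A" "l \<in> U" by (auto simp: openin_pullback_topology)
  then have "\<forall>\<^sub>F j in F. f (g j) \<in> V" using assms(3) unfolding limitin_def by auto
  then show "\<forall>\<^sub>F j in F. g j \<in> U" by eventually_elim (simp add: V(2) assms(2))
qed

text \<open>Tychonoff's theorem. Since an uncountable product of compact sets need not be
  sequentially compact, a filter finer than \<open>sequentially\<close> plays the role of a
  subnet.\<close>

lemma convergent_subfilter_of_bounded_sequence:
  fixes f :: "nat \<Rightarrow> 'p \<Rightarrow> 'b::heine_borel"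
  assumes "\<And>N p. f N p \<in> K p" "\<And>p. compact (K p)"
  obtains F l where "F \<noteq> bot" "F \<le> sequentially" "\<And>p. ((\<lambda>N. f N p) \<longlongrightarrow> l p) F"
proof -
  have "compactin (product_topology (\<lambda>_. euclidean) UNIV) (PiE UNIV K)"
    unfolding compactin_PiE using assms(2) by auto
  then have "compact (PiE UNIV K)" by (simp add: euclidean_product_topology)
  moreover have "filtermap f sequentially \<noteq> bot" by (simp add: filtermap_bot_iff)
  moreover have "\<forall>\<^sub>F z in filtermap f sequentially. z \<in> PiE UNIV K"
    using assms(1) by (simp add: eventually_filtermap PiE_UNIV_domain)
  ultimately obtain l where l: "inf (nhds l) (filtermap f sequentially) \<noteq> bot"
    unfolding compact_filter by blast
  \<comment> \<open>The coarsest refinement of \<open>sequentially\<close> along which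
    \<open>f\<close> tends to \<open>l\<close>; it is proper because \<open>l\<close> is a cluster
    point.\<close>
  define F where "F = inf sequentially (filtercomap f (nhds l))"
  have "F \<noteq> bot"
  proof
    assume "F = bot"
    then have "eventually (\<lambda>_. False) F" by simp
    then obtain P Q where PQ: "eventually P sequentially" "eventually Q (filtercomap f (nhds l))"
      "\<And>n. \<not> (P n \<and> Q n)" unfolding F_def eventually_inf by blast
    then obtain Q' where Q': "eventually Q' (nhds l)" "\<And>n. Q' (f n) \<Longrightarrow> Q n"
      unfolding eventually_filtercomap by blast
    have "eventually (\<lambda>z. \<not> Q' z) (filtermap f sequentially)"
      unfolding eventually_filtermap using PQ(1) by eventually_elim (use PQ(3) Q'(2) in blast)
    with Q'(1) have "eventually (\<lambda>_. False) (inf (nhds l) (filtermap f sequentially))"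
      unfolding eventually_inf by (intro exI[of _ Q'] exI[of _ "\<lambda>z. \<not> Q' z"]) simp
    then show False using l by (simp add: trivial_limit_def)
  qed
  moreover have "F \<le> sequentially" by (simp add: F_def)
  moreover have "(f \<longlongrightarrow> l) F"
    unfolding F_def by (rule filterlim_mono[OF filterlim_filtercomap order_refl inf_le2])
  then have "\<And>p. ((\<lambda>N. f N p) \<longlongrightarrow> l p) F" by (simp add: tendsto_fun_iff)
  ultimately show ?thesis by (rule that)
qed

lemma operator_of_form:
  fixes l :: "'k::chilbert \<Rightarrow> 'k \<Rightarrow> complex"
  assumes add_left: "\<And>x x' y. l (x + x') y = l x y + l x' y"
    and scale_left: "\<And>c x y. l (c *\<^sub>C x) y = c * l x y"
    and add_right: "\<And>x y y'. l x (y + y') = l x y + l x y'"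
    and scale_right: "\<And>c x y. l x (c *\<^sub>C y) = cnj c * l x y"
    and bound: "\<And>x y. cmod (l x y) \<le> M * norm x * norm y" and "0 \<le> M"
  obtains c where "c \<in> bounded_ops" "\<And>x y. l x y = cinner (blinfun_apply c x) y"
proof -
  \<comment> \<open>\<open>l x\<close> is conjugate-linear in its second argument, so Riesz is
    applied to its conjugate.\<close>
  have "\<exists>z. \<forall>y. cnj (l x y) = cinner y z" for x
    by (rule riesz_representation[where B="M * norm x"])
      (simp_all add: add_right scale_right bound)
  then obtain z where z: "\<And>x y. cnj (l x y) = cinner y (z x)" by metis
  have z': "l x y = cinner (z x) y" for x y
    using z[of x y] by (metis cinner_commute complex_cnj_cnj)
  have zadd: "z (x + x') = z x + z x'" for x x'
    by (rule cinner_eqI) (simp add: z[symmetric] add_left cinner_add_right)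
  have zscale: "z (c *\<^sub>C x) = c *\<^sub>C z x" for c x
    by (rule cinner_eqI) (simp add: z[symmetric] scale_left cinner_scaleC_right)
  have zb: "norm (z x) \<le> norm x * M" for x
  proof -
    have "norm (z x) * norm (z x) = cmod (cinner (z x) (z x))"
      by (simp only: cinner_self norm_of_real) (simp add: power2_eq_square)
    also have "\<dots> \<le> (norm x * M) * norm (z x)"
      using bound[of x "z x"] by (simp add: z' mult_ac)
    finally show ?thesis
      using \<open>0 \<le> M\<close> by (cases "norm (z x) = 0") (auto simp: mult_le_cancel_right)
  qed
  have "bounded_linear z"
    by (rule bounded_linear_intro[where K=M]) (simp_all add: zadd scaleR_scaleC zscale zb)
  then have "blinfun_apply (Blinfun z) = z" by (rule bounded_linear_Blinfun_apply)
  then show ?thesis using that[of "Blinfun z"] by (simp add: bounded_ops_def zscale z')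
qed

lemma norm_adjoint_le:
  assumes "is_adjoint S T" shows "norm S \<le> norm T"
proof (rule norm_blinfun_bound)
  fix x
  let ?s = "norm (blinfun_apply S x)"
  have "?s * ?s = cmod (cinner (blinfun_apply T (blinfun_apply S x)) x)"
    unfolding is_adjointD[OF assms] by (simp only: cinner_self norm_of_real) (simp add: power2_eq_square)
  also have "\<dots> \<le> norm (blinfun_apply T (blinfun_apply S x)) * norm x" by (rule cinner_cauchy_schwarz)
  also have "\<dots> \<le> (norm T * ?s) * norm x" by (intro mult_right_mono norm_blinfun) simp
  finally have "?s * ?s \<le> (norm T * norm x) * ?s" by (simp add: mult_ac)
  then show "?s \<le> norm T * norm x"
    by (cases "?s = 0") (auto simp: mult_le_cancel_right)
qed simp

section \<open>Closure properties of von Neumann algebras and contractivity of their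
  automorphisms\<close>

locale vn_algebra =
  fixes A :: "('k::chilbert \<Rightarrow>\<^sub>L 'k) set"
  assumes vn: "von_neumann_algebra A"
begin

lemma vn_bounded_ops: "a \<in> A \<Longrightarrow> a \<in> bounded_ops"
  and vn_id: "id_blinfun \<in> A"
  and vn_add: "a \<in> A \<Longrightarrow> b \<in> A \<Longrightarrow> a + b \<in> A"
  and vn_compose: "a \<in> A \<Longrightarrow> b \<in> A \<Longrightarrow> a o\<^sub>L b \<in> A"
  and vn_scaleC: "a \<in> A \<Longrightarrow> scaleC_op c a \<in> A"
  and vn_closed: "closedin weak_operator_top A"
  using vn by (auto simp: von_neumann_algebra_def)

lemma vn_adj:
  assumes "a \<in> A" shows "adj a \<in> A" "is_adjoint (adj a) a"
proof -
  obtain b where "b \<in> A" "is_adjoint b a" using vn assms by (auto simp: von_neumann_algebra_def)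
  then show "adj a \<in> A" "is_adjoint (adj a) a" using adj_eqI by metis+
qed

lemma scaleC_op_of_real: "scaleC_op (complex_of_real t) a = t *\<^sub>R a"
  by (rule blinfun_eqI) (simp add: scaleC_op_apply scaleC_of_real blinfun.scaleR_left)

lemma vn_scaleR: "a \<in> A \<Longrightarrow> t *\<^sub>R a \<in> A"
  using vn_scaleC[of a "complex_of_real t"] by (simp add: scaleC_op_of_real)

lemma vn_zero: "0 \<in> A"
  using vn_scaleR[OF vn_id, of 0] by simp

lemma vn_diff: "a \<in> A \<Longrightarrow> b \<in> A \<Longrightarrow> a - b \<in> A"
  using vn_add[of a "(-1) *\<^sub>R b"] vn_scaleR[of b "-1"] by simp

lemma vn_sum: "(\<And>i. i \<in> I \<Longrightarrow> f i \<in> A) \<Longrightarrow> (\<Sum>i\<in>I. f i) \<in> A"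
  by (induction I rule: infinite_finite_induct) (auto intro: vn_zero vn_add)

lemma vn_op_pow: "a \<in> A \<Longrightarrow> op_pow a n \<in> A"
  by (induction n) (auto simp: op_pow_Suc intro: vn_id vn_compose)

text \<open>Stated for arbitrary filters, to serve both ordinary sequences and weak cluster
  points.\<close>

lemma vn_weak_limit:
  assumes "F \<noteq> bot" "\<And>j. b j \<in> A" "c \<in> bounded_ops"
    and lim: "\<And>x y. ((\<lambda>j. cinner (blinfun_apply (b j) x) y) \<longlongrightarrow> cinner (blinfun_apply c x) y) F"
  shows "c \<in> A"
proof -
  have "limitin weak_operator_top b c F"
    unfolding weak_operator_top_def
    by (rule limitin_pullback_topology) (use assms vn_bounded_ops in \<open>auto simp: tendsto_fun_iff\<close>)
  then have "c \<in> A \<or> (\<forall>\<^sub>F j in F. b j \<in> topspace weak_operator_top - A)"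
    using vn_closed unfolding limitin_def closedin_def by blast
  then show ?thesis using assms(1,2) by auto
qed

text \<open>The partial sums of the Neumann series lie in \<open>A\<close>, and norm convergence
  implies weak operator convergence, so weak closedness puts the sum in \<open>A\<close>. This
  membership is what allows an automorphism of \<open>A\<close> to be applied to the
  inverse.\<close>

lemma vn_neumann_inverse:
  assumes h: "h \<in> A" and norm: "norm h < 1"
  shows "\<exists>g\<in>A. g o\<^sub>L (id_blinfun - h) = id_blinfun"
proof -
  have pow_le: "norm (op_pow h n) \<le> norm h ^ n" for n
  proof (induction n)
    case 0
    show ?case by (simp add: norm_blinfun_id_le)
  next
    case (Suc n)
    have "norm (op_pow h (Suc n)) \<le> norm h * norm (op_pow h n)"
      unfolding op_pow_Suc by (rule norm_blinfun_compose)
    also have "\<dots> \<le> norm h * norm h ^ n" using Suc by (intro mult_left_mono) auto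
    finally show ?case by simp
  qed
  have summ: "summable (\<lambda>n. op_pow h n)"
    by (rule summable_comparison_test'[of "\<lambda>n. norm h ^ n" 0]) (use norm pow_le in \<open>auto simp: summable_geometric\<close>)
  define g where "g = (\<Sum>n. op_pow h n)"
  have g: "(\<lambda>N. \<Sum>n<N. op_pow h n) \<longlonglongrightarrow> g"
    using summable_LIMSEQ[OF summ] by (simp add: g_def)
  have SA: "(\<Sum>n<N. op_pow h n) \<in> A" for N by (intro vn_sum vn_op_pow h)
  have app: "(\<lambda>N. blinfun_apply (\<Sum>n<N. op_pow h n) x) \<longlonglongrightarrow> blinfun_apply g x" for x
    by (intro blinfun.tendsto g tendsto_const)
  have "g \<in> bounded_ops"
    unfolding bounded_ops_def
  proof (intro CollectI allI)
    fix c x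
    have "(\<lambda>N. c *\<^sub>C blinfun_apply (\<Sum>n<N. op_pow h n) x) \<longlonglongrightarrow> c *\<^sub>C blinfun_apply g x"
      by (intro scaleC.tendsto app tendsto_const)
    then have "(\<lambda>N. blinfun_apply (\<Sum>n<N. op_pow h n) (c *\<^sub>C x)) \<longlonglongrightarrow> c *\<^sub>C blinfun_apply g x"
      by (simp only: bounded_opsD[OF vn_bounded_ops[OF SA]])
    then show "blinfun_apply g (c *\<^sub>C x) = c *\<^sub>C blinfun_apply g x" using app LIMSEQ_unique by blast
  qed
  then have gA: "g \<in> A"
    by (rule vn_weak_limit[where b="\<lambda>N. \<Sum>n<N. op_pow h n", OF sequentially_bot SA])
      (intro cinner.tendsto app tendsto_const)
  have "(\<Sum>n<N. op_pow h n) o\<^sub>L (id_blinfun - h) = id_blinfun - op_pow h N" for N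
  proof (induction N)
    case (Suc N)
    have "op_pow h N o\<^sub>L h = op_pow h (Suc N)"
      by (rule blinfun_eqI) (simp add: op_pow_apply funpow_swap1)
    moreover have "(\<Sum>n<Suc N. op_pow h n) o\<^sub>L (id_blinfun - h)
      = ((\<Sum>n<N. op_pow h n) o\<^sub>L (id_blinfun - h)) + (op_pow h N - (op_pow h N o\<^sub>L h))"
      by (rule blinfun_eqI) (simp add: blinfun.add_left blinfun.diff_left blinfun.diff_right)
    ultimately show ?case using Suc by simp
  qed (rule blinfun_eqI, simp add: blinfun.diff_left)
  then have "(\<lambda>N. id_blinfun - op_pow h N) \<longlonglongrightarrow> (g o\<^sub>L (id_blinfun - h))"
    using bounded_bilinear.tendsto[OF bounded_bilinear_blinfun_compose g tendsto_const[of "id_blinfun - h"]]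
    by simp
  moreover have "(\<lambda>N. id_blinfun - op_pow h N) \<longlonglongrightarrow> id_blinfun - 0"
    by (intro tendsto_intros summable_LIMSEQ_zero[OF summ])
  ultimately have "g o\<^sub>L (id_blinfun - h) = id_blinfun" using LIMSEQ_unique by fastforce
  with gA show ?thesis by blast
qed

text \<open>If \<open>\<beta>\<close> increased the norm of \<open>b\<close>, then \<open>\<beta> (b\<^sup>* b)\<close> would have an approximate eigenvalue
  above the spectrum of \<open>b\<^sup>* b\<close>.\<close>

lemma star_automorphism_contractive:
  assumes \<beta>: "star_automorphism A \<beta>" and b: "b \<in> A"
  shows "norm (\<beta> b) \<le> norm b"
proof (rule ccontr)
  assume "\<not> norm (\<beta> b) \<le> norm b"
  then have less: "norm b < norm (\<beta> b)" by simp
  have bij: "bij_betw \<beta> A A"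
    and badd: "\<And>x y. x \<in> A \<Longrightarrow> y \<in> A \<Longrightarrow> \<beta> (x + y) = \<beta> x + \<beta> y"
    and bscale: "\<And>c x. x \<in> A \<Longrightarrow> \<beta> (scaleC_op c x) = scaleC_op c (\<beta> x)"
    and bcomp: "\<And>x y. x \<in> A \<Longrightarrow> y \<in> A \<Longrightarrow> \<beta> (x o\<^sub>L y) = \<beta> x o\<^sub>L \<beta> y"
    and badj: "\<And>x. x \<in> A \<Longrightarrow> \<beta> (adj x) = adj (\<beta> x)"
    using \<beta> by (auto simp: star_automorphism_def)
  have bA: "\<beta> x \<in> A" if "x \<in> A" for x using bij that by (auto simp: bij_betw_def)
  have bid: "\<beta> id_blinfun = id_blinfun"
  proof -
    obtain e where e: "e \<in> A" "\<beta> e = id_blinfun"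
      using bij vn_id by (metis bij_betw_def imageE)
    have "\<beta> e = \<beta> id_blinfun o\<^sub>L \<beta> e"
      unfolding bcomp[OF vn_id e(1), symmetric] by (rule arg_cong[of _ _ \<beta>], rule blinfun_eqI) simp
    then have "id_blinfun = \<beta> id_blinfun o\<^sub>L id_blinfun" using e(2) by simp
    also have "\<dots> = \<beta> id_blinfun" by (rule blinfun_eqI) simp
    finally show ?thesis by simp
  qed
  let ?B = "\<beta> b"
  \<comment> \<open>At this scale \<open>h\<close> has norm below 1, so
    \<open>id_blinfun - h\<close> is invertible, whereas \<open>\<beta> h\<close> has 1 as an
    approximate eigenvalue.\<close>
  define s where "s = (norm ?B)\<^sup>2"
  have s0: "s > 0" using less by (auto simp: s_def intro: le_less_trans)
  define h where "h = (1 / s) *\<^sub>R (adj b o\<^sub>L b)"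
  have hA: "h \<in> A" unfolding h_def by (intro vn_scaleR vn_compose vn_adj b)
  have "norm (adj b o\<^sub>L b) \<le> norm b * norm b"
    by (rule order_trans[OF norm_blinfun_compose])
      (intro mult_right_mono norm_adjoint_le vn_adj(2) b norm_ge_zero)
  also have "\<dots> < s"
    unfolding s_def power2_eq_square using less by (intro mult_strict_mono') auto
  finally have "norm h < 1" using s0 by (simp add: h_def)
  from vn_neumann_inverse[OF hA this]
  obtain g where g: "g \<in> A" "g o\<^sub>L (id_blinfun - h) = id_blinfun" by blast
  have bR: "\<beta> (t *\<^sub>R x) = t *\<^sub>R \<beta> x" if "x \<in> A" for t x
    using bscale[OF that, of "complex_of_real t"] by (simp add: scaleC_op_of_real)
  have bh: "\<beta> h = (1 / s) *\<^sub>R (adj ?B o\<^sub>L ?B)"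
    unfolding h_def using b by (simp add: bR vn_compose vn_adj bcomp badj)
  have "\<beta> (id_blinfun + (-1) *\<^sub>R h) = id_blinfun + (-1) *\<^sub>R \<beta> h"
    by (simp only: badd[OF vn_id vn_scaleR[OF hA]] bid bR[OF hA])
  then have bdiff: "\<beta> (id_blinfun - h) = id_blinfun - \<beta> h" by simp
  have inv: "\<beta> g o\<^sub>L (id_blinfun - \<beta> h) = id_blinfun"
    unfolding bdiff[symmetric] bcomp[OF g(1) vn_diff[OF vn_id hA], symmetric] g(2) by (rule bid)
  define K where "K = norm (\<beta> g)"
  have lower: "norm x \<le> K * norm (x - blinfun_apply (\<beta> h) x)" for x
  proof -
    have "x = blinfun_apply (\<beta> g) (x - blinfun_apply (\<beta> h) x)"
      using arg_cong[OF inv, of "\<lambda>T. blinfun_apply T x"] by (simp add: blinfun.diff_left)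
    then show ?thesis unfolding K_def by (metis norm_blinfun)
  qed
  \<comment> \<open>Small enough for the error \<open>2 * \<delta> * (norm x)^2\<close> below to
    contradict \<open>lower\<close>; the added 1 covers \<open>K = 0\<close>.\<close>
  define \<delta> where "\<delta> = 1 / (2 * K\<^sup>2 + 1)"
  have \<delta>: "0 < \<delta>" "\<delta> \<le> 1" "2 * \<delta> * K\<^sup>2 < 1"
    by (auto simp: \<delta>_def field_simps add_pos_nonneg add_nonneg_pos)
  have "\<exists>x. sqrt (1 - \<delta>) * norm ?B * norm x < norm (blinfun_apply ?B x)"
  proof (rule ccontr)
    assume "\<not> ?thesis"
    then have "norm ?B \<le> sqrt (1 - \<delta>) * norm ?B"
      using \<delta> by (intro norm_blinfun_bound) (auto simp: not_less)
    moreover have "sqrt (1 - \<delta>) < 1" using \<delta> by simp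
    moreover have "norm ?B > 0" using less by (rule le_less_trans[OF norm_ge_zero])
    ultimately show False by (simp add: mult_le_cancel_right1)
  qed
  then obtain x where x: "sqrt (1 - \<delta>) * norm ?B * norm x < norm (blinfun_apply ?B x)" by blast
  have "(sqrt (1 - \<delta>) * norm ?B * norm x)\<^sup>2 < (norm (blinfun_apply ?B x))\<^sup>2"
    using x \<delta> by (intro power_strict_mono) auto
  then have x2: "(1 - \<delta>) * s * (norm x)\<^sup>2 < (norm (blinfun_apply ?B x))\<^sup>2"
    using \<delta> by (simp add: power_mult_distrib s_def)
  have x0: "norm x > 0" using x by (cases "x = 0") auto
  define z where "z = blinfun_apply (adj ?B o\<^sub>L ?B) x"
  have adjB: "is_adjoint (adj ?B) ?B" by (rule vn_adj[OF bA[OF b]])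
  have zx: "Re (cinner x z) = (norm (blinfun_apply ?B x))\<^sup>2"
    by (simp add: z_def is_adjointD[OF adjB, symmetric] cinner_self flip: of_real_power)
  have zn: "norm z \<le> s * norm x"
  proof -
    have "norm z \<le> norm (adj ?B) * norm (blinfun_apply ?B x)"
      by (simp add: z_def norm_blinfun)
    also have "\<dots> \<le> norm ?B * (norm ?B * norm x)"
      by (intro mult_mono norm_adjoint_le[OF adjB] norm_blinfun) auto
    finally show ?thesis by (simp add: s_def power2_eq_square mult_ac)
  qed
  have hx: "blinfun_apply (\<beta> h) x = (1 / s) *\<^sub>R z"
    by (simp add: bh z_def blinfun.scaleR_left)
  \<comment> \<open>Expanding the square shows that \<open>x\<close>, at which
    \<open>\<beta> b\<close> nearly attains its norm, is almost fixed by
    \<open>\<beta> h\<close>.\<close>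
  have "(norm (x - (1 / s) *\<^sub>R z))\<^sup>2 = (norm x)\<^sup>2 - 2 / s * (norm (blinfun_apply ?B x))\<^sup>2 + (norm z / s)\<^sup>2"
    using norm_add_sq[of x "- ((1 / s) *\<^sub>R z)"] zx s0
    by (simp add: cinner.minus_right cinner_scaleR_right)
  also have "\<dots> \<le> (norm x)\<^sup>2 - 2 / s * ((1 - \<delta>) * s * (norm x)\<^sup>2) + (norm x)\<^sup>2"
  proof -
    have "norm z / s \<le> norm x" using zn s0 by (simp add: divide_le_eq mult.commute)
    then have "(norm z / s)\<^sup>2 \<le> (norm x)\<^sup>2" using s0 by (intro power_mono) auto
    moreover have "2 / s * ((1 - \<delta>) * s * (norm x)\<^sup>2) \<le> 2 / s * (norm (blinfun_apply ?B x))\<^sup>2"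
      using x2 s0 by (intro mult_left_mono) auto
    ultimately show ?thesis by simp
  qed
  also have "\<dots> = 2 * \<delta> * (norm x)\<^sup>2" using s0 by (simp add: field_simps)
  finally have small: "(norm (x - blinfun_apply (\<beta> h) x))\<^sup>2 \<le> 2 * \<delta> * (norm x)\<^sup>2" by (simp only: hx)
  have "(norm x)\<^sup>2 \<le> (K * norm (x - blinfun_apply (\<beta> h) x))\<^sup>2"
    using lower[of x] by (intro power_mono) auto
  also have "\<dots> \<le> K\<^sup>2 * (2 * \<delta> * (norm x)\<^sup>2)"
    unfolding power_mult_distrib using small by (intro mult_left_mono) auto
  also have "\<dots> = (2 * \<delta> * K\<^sup>2) * (norm x)\<^sup>2" by simp
  also have "\<dots> < 1 * (norm x)\<^sup>2" using \<delta>(3) x0 by (intro mult_strict_right_mono) auto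
  finally show False by simp
qed

lemma star_automorphism_funpow:
  assumes \<beta>: "star_automorphism A \<beta>" and b: "b \<in> A"
  shows "(\<beta> ^^ n) b \<in> A" "norm ((\<beta> ^^ n) b) \<le> norm b"
proof -
  have "(\<beta> ^^ n) b \<in> A \<and> norm ((\<beta> ^^ n) b) \<le> norm b"
  proof (induction n)
    case (Suc n)
    then have "\<beta> ((\<beta> ^^ n) b) \<in> A" using \<beta> by (auto simp: star_automorphism_def bij_betw_def)
    moreover have "norm (\<beta> ((\<beta> ^^ n) b)) \<le> norm b"
      using Suc star_automorphism_contractive[OF \<beta>] order_trans by blast
    ultimately show ?case by simp
  qed (simp add: b)
  then show "(\<beta> ^^ n) b \<in> A" "norm ((\<beta> ^^ n) b) \<le> norm b" by auto
qed

text \<open>On norm-bounded sets weak operator convergence implies ultraweak convergence: the terms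
  of each defining series converge and share a summable majorant, so Tannery's theorem exchanges
  limit and sum.\<close>

lemma normal_weak_limit:
  fixes T :: "nat \<Rightarrow> 'k \<Rightarrow>\<^sub>L 'k"
  assumes normal: "continuous_map (subtopology ultraweak_top A) euclidean \<phi>"
    and F: "F \<noteq> bot" and T: "\<And>N. T N \<in> A" "\<And>N. norm (T N) \<le> M" and c: "c \<in> A"
    and lim: "\<And>x y. ((\<lambda>N. cinner (blinfun_apply (T N) x) y) \<longlongrightarrow> cinner (blinfun_apply c x) y) F"
  shows "((\<lambda>N. \<phi> (T N)) \<longlongrightarrow> \<phi> c) F"
proof -
  have M: "0 \<le> M" using T(2) norm_ge_zero order_trans by blast
  have comp: "((\<lambda>N. \<Sum>n. cinner (blinfun_apply (T N) (\<xi> n)) (\<eta> n))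
      \<longlongrightarrow> (\<Sum>n. cinner (blinfun_apply c (\<xi> n)) (\<eta> n))) F"
    if summ: "summable (\<lambda>n. (norm (\<xi> n))\<^sup>2)" "summable (\<lambda>n. (norm (\<eta> n))\<^sup>2)" for \<xi> \<eta> :: "nat \<Rightarrow> 'k"
  proof -
    have bound: "cmod (cinner (blinfun_apply (T N) (\<xi> n)) (\<eta> n)) \<le> M * ((norm (\<xi> n))\<^sup>2 + (norm (\<eta> n))\<^sup>2)" for N n
    proof -
      have "cmod (cinner (blinfun_apply (T N) (\<xi> n)) (\<eta> n)) \<le> norm (blinfun_apply (T N) (\<xi> n)) * norm (\<eta> n)"
        by (rule cinner_cauchy_schwarz)
      also have "\<dots> \<le> (M * norm (\<xi> n)) * norm (\<eta> n)"
        by (intro mult_right_mono order_trans[OF norm_blinfun]) (auto intro: mult_right_mono T(2))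
      also have "\<dots> \<le> M * ((norm (\<xi> n))\<^sup>2 + (norm (\<eta> n))\<^sup>2)"
        unfolding mult.assoc
      proof (rule mult_left_mono[OF _ M])
        have "0 \<le> norm (\<xi> n) * norm (\<eta> n)" by simp
        then show "norm (\<xi> n) * norm (\<eta> n) \<le> (norm (\<xi> n))\<^sup>2 + (norm (\<eta> n))\<^sup>2"
          using sum_squares_bound[of "norm (\<xi> n)" "norm (\<eta> n)"] by linarith
      qed
      finally show ?thesis .
    qed
    show ?thesis
      by (rule tannerys_theorem[where M="\<lambda>n. M * ((norm (\<xi> n))\<^sup>2 + (norm (\<eta> n))\<^sup>2)", THEN conjunct2, THEN conjunct2])
        (use lim bound F summ in \<open>auto intro!: summable_mult summable_add always_eventually\<close>)
  qed
  have "limitin ultraweak_top T c F"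
    unfolding ultraweak_top_def
    by (rule limitin_pullback_topology)
      (use c T(1) vn_bounded_ops comp in \<open>auto simp: limitin_componentwise square_summable_pairs_def\<close>)
  then have "limitin (subtopology ultraweak_top A) T c F"
    using c T(1) by (simp add: limitin_subtopology)
  from continuous_map_limit[OF normal this] show ?thesis by (simp add: o_def)
qed

text \<open>The image of \<open>A\<close> is in general not closed in its completion; the uniform
  operator bound keeps this limit inside. Pairing with \<open>\<Lambda> d\<close> identifies it,
  because such pairings are values of \<phi> on products with the fixed element
  \<open>adj d\<close>.\<close>

lemma gns_bounded_limit:
  fixes \<Lambda> :: "('k \<Rightarrow>\<^sub>L 'k) \<Rightarrow> 'h::chilbert"
  assumes normal: "continuous_map (subtopology ultraweak_top A) euclidean \<phi>"
    and gns: "\<And>a b. a \<in> A \<Longrightarrow> b \<in> A \<Longrightarrow> cinner (\<Lambda> a) (\<Lambda> b) = \<phi> (adj b o\<^sub>L a)"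
    and dense: "closure (\<Lambda> ` A) = UNIV"
    and b: "\<And>N. b N \<in> A" "\<And>N. norm (b N) \<le> M" and lim: "(\<lambda>N. \<Lambda> (b N)) \<longlonglongrightarrow> h"
  shows "\<exists>c\<in>A. \<Lambda> c = h"
proof -
  have M: "0 \<le> M" using b(2) norm_ge_zero order_trans by blast
  define f where "f N p = cinner (blinfun_apply (b N) (fst p)) (snd p)" for N p
  have fb: "cmod (f N p) \<le> M * norm (fst p) * norm (snd p)" for N p
  proof -
    have "cmod (f N p) \<le> norm (blinfun_apply (b N) (fst p)) * norm (snd p)"
      unfolding f_def by (rule cinner_cauchy_schwarz)
    also have "\<dots> \<le> (M * norm (fst p)) * norm (snd p)"
      by (intro mult_right_mono order_trans[OF norm_blinfun]) (auto intro: mult_right_mono b(2))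
    finally show ?thesis .
  qed
  \<comment> \<open>Each matrix coefficient stays in a fixed disc whose radius is \<open>M\<close>
    times the norms of the two vectors; these discs are the compact factors.\<close>
  obtain F l where F: "F \<noteq> bot" "F \<le> sequentially" and l: "\<And>p. ((\<lambda>N. f N p) \<longlongrightarrow> l p) F"
    by (rule convergent_subfilter_of_bounded_sequence[of f "\<lambda>p. cball 0 (M * norm (fst p) * norm (snd p))"])
      (use fb in auto)
  note uniq = tendsto_unique[OF F(1)]
  have l': "((\<lambda>N. cinner (blinfun_apply (b N) x) y) \<longlongrightarrow> l (x, y)) F" for x y
    using l[of "(x, y)"] by (simp add: f_def)
  obtain c where c: "c \<in> bounded_ops" "\<And>x y. l (x, y) = cinner (blinfun_apply c x) y"
  proof (rule operator_of_form[of "\<lambda>x y. l (x, y)" M])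
    show "l (x + x', y) = l (x, y) + l (x', y)" for x x' y
      by (rule uniq[OF l']) (use tendsto_add[OF l'[of x y] l'[of x' y]] in
        \<open>simp add: blinfun.add_right cinner_add_left\<close>)
    show "l (c *\<^sub>C x, y) = c * l (x, y)" for c x y
      by (rule uniq[OF l']) (use tendsto_mult_left[OF l'[of x y], of c] in
        \<open>simp add: bounded_opsD[OF vn_bounded_ops[OF b(1)]] cinner_scaleC_left\<close>)
    show "l (x, y + y') = l (x, y) + l (x, y')" for x y y'
      by (rule uniq[OF l']) (use tendsto_add[OF l'[of x y] l'[of x y']] in
        \<open>simp add: cinner_add_right\<close>)
    show "l (x, c *\<^sub>C y) = cnj c * l (x, y)" for c x y
      by (rule uniq[OF l']) (use tendsto_mult_left[OF l'[of x y], of "cnj c"] in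
        \<open>simp add: cinner_scaleC_right\<close>)
    show "cmod (l (x, y)) \<le> M * norm x * norm y" for x y
      using tendsto_upperbound[OF tendsto_norm[OF l[of "(x, y)"]] _ F(1)] fb[of _ "(x, y)"]
      by (simp add: always_eventually)
  qed (use M in auto)
  have clim: "((\<lambda>N. cinner (blinfun_apply (b N) x) y) \<longlongrightarrow> cinner (blinfun_apply c x) y) F" for x y
    using l'[of x y] by (simp add: c(2))
  have cA: "c \<in> A" by (rule vn_weak_limit[OF F(1) b(1) c(1) clim])
  have "cinner (\<Lambda> d) (h - \<Lambda> c) = 0" if d: "d \<in> A" for d
  proof -
    have "((\<lambda>N. \<phi> (adj d o\<^sub>L b N)) \<longlongrightarrow> \<phi> (adj d o\<^sub>L c)) F"
    proof (rule normal_weak_limit[OF normal F(1), where M="norm (adj d) * M"])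
      show "adj d o\<^sub>L b N \<in> A" for N by (intro vn_compose vn_adj d b)
      show "norm (adj d o\<^sub>L b N) \<le> norm (adj d) * M" for N
        by (rule order_trans[OF norm_blinfun_compose]) (intro mult_left_mono b norm_ge_zero)
      show "adj d o\<^sub>L c \<in> A" by (intro vn_compose vn_adj d cA)
      have "is_adjoint d (adj d)" by (rule is_adjoint_sym[OF vn_adj(2)[OF d]])
      then show "((\<lambda>N. cinner (blinfun_apply (adj d o\<^sub>L b N) x) y)
          \<longlongrightarrow> cinner (blinfun_apply (adj d o\<^sub>L c) x) y) F" for x y
        using clim by (simp add: is_adjointD)
    qed
    then have "((\<lambda>N. cinner (\<Lambda> (b N)) (\<Lambda> d)) \<longlongrightarrow> cinner (\<Lambda> c) (\<Lambda> d)) F"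
      using gns d b(1) cA by simp
    moreover have "((\<lambda>N. cinner (\<Lambda> (b N)) (\<Lambda> d)) \<longlongrightarrow> cinner h (\<Lambda> d)) F"
      using tendsto_mono[OF F(2) lim] by (intro cinner.tendsto tendsto_const)
    ultimately have "cinner h (\<Lambda> d) = cinner (\<Lambda> c) (\<Lambda> d)" using uniq by blast
    then have "cinner (\<Lambda> d) h = cinner (\<Lambda> d) (\<Lambda> c)" by (metis cinner_commute)
    then show ?thesis by (simp add: cinner.diff_right)
  qed
  then have "\<Lambda> ` A \<subseteq> {x. cinner x (h - \<Lambda> c) = 0}" by auto
  moreover have "closed {x. cinner x (h - \<Lambda> c) = 0}"
    by (intro closed_Collect_eq cinner.continuous_on continuous_intros)
  ultimately have "{x. cinner x (h - \<Lambda> c) = 0} = UNIV"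
    using dense closure_minimal by (metis top.extremum_uniqueI)
  then have "cinner (h - \<Lambda> c) (h - \<Lambda> c) = 0" by blast
  then have "\<Lambda> c = h" by (simp add: cinner_self)
  then show ?thesis using cA by blast
qed

end

section \<open>Polynomial averages\<close>

lemma norm_op_prod_list_le:
  assumes "\<And>l. l \<in> set ls \<Longrightarrow> norm (f l) \<le> c l"
  shows "norm (op_prod_list (map f ls)) \<le> (\<Prod>l\<leftarrow>ls. c l)"
  using assms
proof (induction ls)
  case (Cons l ls)
  have "norm (op_prod_list (map f (l # ls))) \<le> norm (f l) * norm (op_prod_list (map f ls))"
    by (simp add: op_prod_list_def norm_blinfun_compose)
  also have "\<dots> \<le> c l * (\<Prod>l\<leftarrow>ls. c l)"
  proof (intro mult_mono)
    show "norm (f l) \<le> c l" using Cons.prems by simp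
    then show "0 \<le> c l" using norm_ge_zero order_trans by blast
  qed (use Cons in auto)
  finally show ?case by simp
qed (simp add: op_prod_list_def norm_blinfun_id_le)

lemma (in vn_algebra) vn_op_prod_list:
  "(\<And>l. l \<in> set ls \<Longrightarrow> f l \<in> A) \<Longrightarrow> op_prod_list (map f ls) \<in> A"
  by (induction ls) (simp_all add: op_prod_list_def vn_id vn_compose)

text \<open>Between neighbouring factors, the inverse power with exponent \<open>s j\<close> cancels
  all but \<open>q (Suc j)\<close> of the next exponent \<open>s (Suc j)\<close>. The start
  \<open>j\<close> is kept general and the induction descends from \<open>k\<close>, since a tail of
  the product begins with the uncancelled power of exponent \<open>s j\<close>.\<close>

lemma conjugated_product_telescopes:
  fixes u :: "'h::chilbert \<Rightarrow>\<^sub>L 'h" and a :: "nat \<Rightarrow> 'h \<Rightarrow>\<^sub>L 'h"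
  assumes u: "unitary_op u"
    and f: "\<And>l x. l \<in> {1..k} \<Longrightarrow> f l x = blinfun_apply (op_pow u (s l))
      (blinfun_apply (a l) (blinfun_apply (op_pow (op_inv u) (s l)) x))"
    and s: "\<And>l. s (Suc l) = s l + q (Suc l)" and j: "1 \<le> j" "j \<le> k"
  shows "foldr f [j..<Suc k] v = blinfun_apply (op_pow u (s j))
    (foldr (\<lambda>l x. blinfun_apply (a l) (blinfun_apply (op_pow u (q (Suc l))) x)) [j..<k]
      (blinfun_apply (a k) (blinfun_apply (op_pow (op_inv u) (s k)) v)))"
  using j(2,1)
proof (induction rule: inc_induct)
  case base
  then show ?case by (simp add: f)
next
  case (step j)
  have cancel: "blinfun_apply (op_pow (op_inv u) m) (blinfun_apply (op_pow u m) x) = x" for m x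
  proof (induction m arbitrary: x)
    case (Suc m)
    have "blinfun_apply (op_pow (op_inv u) (m + 1)) (blinfun_apply (op_pow u (Suc m)) x)
        = blinfun_apply (op_pow (op_inv u) m) (blinfun_apply (op_pow u m) x)"
      unfolding op_pow_add by (simp add: op_pow_Suc unitary_op_inv_apply[OF u])
    then show ?case using Suc by simp
  qed simp
  let ?X = "foldr (\<lambda>l x. blinfun_apply (a l) (blinfun_apply (op_pow u (q (Suc l))) x)) [Suc j..<k]
      (blinfun_apply (a k) (blinfun_apply (op_pow (op_inv u) (s k)) v))"
  have "foldr f [j..<Suc k] v = f j (foldr f [Suc j..<Suc k] v)"
    using step.hyps by (simp add: upt_conv_Cons del: upt_Suc)
  also have "foldr f [Suc j..<Suc k] v = blinfun_apply (op_pow u (s j + q (Suc j))) ?X"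
    using step by (simp add: s del: upt_Suc)
  also have "f j \<dots> = blinfun_apply (op_pow u (s j)) (blinfun_apply (a j) (blinfun_apply (op_pow u (q (Suc j))) ?X))"
    using step by (simp add: f op_pow_add cancel)
  finally show ?case using step.hyps by (simp add: upt_conv_Cons del: upt_Suc)
qed

theorem corollary3p4:
  fixes A :: "('k::chilbert \<Rightarrow>\<^sub>L 'k) set"
    and \<phi> :: "('k \<Rightarrow>\<^sub>L 'k) \<Rightarrow> complex"
    and \<beta> :: "('k \<Rightarrow>\<^sub>L 'k) \<Rightarrow> 'k \<Rightarrow>\<^sub>L 'k"
    and \<Lambda> :: "('k \<Rightarrow>\<^sub>L 'k) \<Rightarrow> 'h::chilbert"
    and \<pi> :: "('k \<Rightarrow>\<^sub>L 'k) \<Rightarrow> 'h \<Rightarrow>\<^sub>L 'h"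
    and u :: "'h \<Rightarrow>\<^sub>L 'h"
    and r k :: nat
    and \<alpha> :: "nat \<Rightarrow> nat"
    and p :: "nat \<Rightarrow> int poly"
    and a :: "nat \<Rightarrow> 'k \<Rightarrow>\<^sub>L 'k"
  assumes "von_neumann_dynamical_system A \<phi> \<beta>"
    and "gns_space A \<phi> \<Lambda> \<pi>"
    and "unitary_op u"
    and "\<And>b. b \<in> A \<Longrightarrow> \<pi> (\<beta> b) = u o\<^sub>L \<pi> b o\<^sub>L op_inv u"
    and "1 \<le> r" and "r \<le> k"
    and "\<alpha> ` {1..k} = {1..r}"
    and "\<And>i. i \<in> {1..r} \<Longrightarrow> p i \<in> nonneg_int_polys"
    and "\<And>j. j \<in> {1..k} \<Longrightarrow> a j \<in> A"
    and "strongly_relatively_compact {\<pi> (a k) o\<^sub>L op_pow (op_inv u) n |n. n \<ge> 1}"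
    and "\<And>j. 1 \<le> j \<Longrightarrow> j \<le> k - 1 \<Longrightarrow>
           strongly_relatively_compact {\<pi> (a j) o\<^sub>L op_pow u n |n. n \<ge> 1}"
  shows "strongly_convergent A \<phi> (polynomial_average \<beta> r k \<alpha> p a)"
proof -
  interpret vn_algebra A
    using assms(1) by unfold_locales (simp add: von_neumann_dynamical_system_def)
  interpret P: phase_averages "\<lambda>N. {1..r} \<rightarrow>\<^sub>E {1..N}" "poly_phases r p" by (rule phase_averages_box)
  have \<beta>: "star_automorphism A \<beta>" and normal: "continuous_map (subtopology ultraweak_top A) euclidean \<phi>"
    using assms(1) by (auto simp: von_neumann_dynamical_system_def faithful_normal_trace_def)
  have Ladd: "\<And>x y. x \<in> A \<Longrightarrow> y \<in> A \<Longrightarrow> \<Lambda> (x + y) = \<Lambda> x + \<Lambda> y"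
    and Lscale: "\<And>c x. x \<in> A \<Longrightarrow> \<Lambda> (scaleC_op c x) = c *\<^sub>C \<Lambda> x"
    and gns: "\<And>x y. x \<in> A \<Longrightarrow> y \<in> A \<Longrightarrow> cinner (\<Lambda> x) (\<Lambda> y) = \<phi> (adj y o\<^sub>L x)"
    and dense: "closure (\<Lambda> ` A) = UNIV"
    and \<pi>_ops: "\<And>x. x \<in> A \<Longrightarrow> \<pi> x \<in> bounded_ops"
    and \<pi>: "\<And>x y. x \<in> A \<Longrightarrow> y \<in> A \<Longrightarrow> blinfun_apply (\<pi> x) (\<Lambda> y) = \<Lambda> (x o\<^sub>L y)"
    using assms(2) by (auto simp: gns_space_def)
  have LscaleR: "\<Lambda> (t *\<^sub>R x) = t *\<^sub>R \<Lambda> x" if "x \<in> A" for t x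
    using Lscale[OF that, of "complex_of_real t"] by (simp add: scaleC_op_of_real scaleC_of_real)
  have Ldiff: "\<Lambda> (x - y) = \<Lambda> x - \<Lambda> y" if "x \<in> A" "y \<in> A" for x y
    using Ladd[of x "(-1) *\<^sub>R y"] that by (simp add: vn_scaleR[of y "-1", simplified] LscaleR[of y "-1", simplified])
  have L0: "\<Lambda> 0 = 0" using LscaleR[OF vn_zero, of 0] by simp
  have Lsum: "\<Lambda> (\<Sum>i\<in>I. f i) = (\<Sum>i\<in>I. \<Lambda> (f i))" if "\<And>i. i \<in> I \<Longrightarrow> f i \<in> A" for I :: "(nat \<Rightarrow> nat) set" and f
    using that by (induction I rule: infinite_finite_induct) (simp_all add: L0 Ladd vn_sum)
  have tn: "trace_norm \<phi> x = norm (\<Lambda> x)" if "x \<in> A" for x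
    unfolding trace_norm_def gns[OF that that, symmetric] cinner_self by simp
  have Lprod: "\<Lambda> (op_prod_list (map f ls)) = foldr (\<lambda>l. blinfun_apply (\<pi> (f l))) ls (\<Lambda> id_blinfun)"
    if "\<And>l. l \<in> set ls \<Longrightarrow> f l \<in> A" for ls :: "nat list" and f
    using that
  proof (induction ls)
    case (Cons l ls)
    have "f l \<in> A" "op_prod_list (map f ls) \<in> A" using Cons.prems by (auto intro: vn_op_prod_list)
    from \<pi>[OF this] Cons show ?case by (simp add: op_prod_list_def)
  qed (simp add: op_prod_list_def)
  note \<beta>pow = star_automorphism_funpow[OF \<beta>]
  have \<pi>\<beta>: "blinfun_apply (\<pi> ((\<beta> ^^ m) x)) z
      = blinfun_apply (op_pow u m) (blinfun_apply (\<pi> x) (blinfun_apply (op_pow (op_inv u) m) z))"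
    if "x \<in> A" for m x z
  proof (induction m arbitrary: z)
    case (Suc m)
    have "blinfun_apply (\<pi> ((\<beta> ^^ Suc m) x)) z
        = blinfun_apply u (blinfun_apply (\<pi> ((\<beta> ^^ m) x)) (blinfun_apply (op_inv u) z))"
      using assms(4)[OF \<beta>pow(1)[OF that, of m]] by simp
    then show ?case by (simp add: Suc op_pow_apply funpow_swap1)
  qed simp

  define q where "q l n = nat (poly (p (\<alpha> l)) (int (n (\<alpha> l))))" for l and n :: "nat \<Rightarrow> nat"
  define s where "s l n = (\<Sum>d\<in>{1..l}. q d n)" for l and n :: "nat \<Rightarrow> nat"
  have \<alpha>: "\<alpha> l \<in> {1..r}" if "l \<in> {1..k}" for l using assms(7) that by blast
  have q_phase: "(\<lambda>n. real (q l n)) \<in> poly_phases r p" if "l \<in> {1..k}" for l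
    unfolding q_def by (rule poly_phases_single) (use \<alpha>[OF that] assms(8) in auto)
  have s_phase: "(\<lambda>n. real (s k n)) \<in> poly_phases r p"
    unfolding s_def of_nat_sum by (intro poly_phases_sum q_phase) auto
  \<comment> \<open>\<open>partial_exponent\<close> applies \<open>nat\<close> to the whole sum,
    \<open>s\<close> to each summand; they agree because every summand is nonnegative on a
    box.\<close>
  have exponent: "partial_exponent \<alpha> p n l = s l n"
    if "n \<in> {1..r} \<rightarrow>\<^sub>E {1..N}" "l \<in> {1..k}" for n N l
  proof -
    have "poly (p (\<alpha> d)) (int (n (\<alpha> d))) = int (q d n)" if d: "d \<in> {1..l}" for d
    proof -
      have ad: "\<alpha> d \<in> {1..r}" using \<alpha> d \<open>l \<in> {1..k}\<close> by auto
      have "n (\<alpha> d) \<ge> 1" using PiE_mem[OF \<open>n \<in> _\<close> ad] by simp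
      then show ?thesis using assms(8)[OF ad] by (simp add: q_def nonneg_int_polys_def)
    qed
    then have "(\<Sum>d=1..l. poly (p (\<alpha> d)) (int (n (\<alpha> d)))) = int (s l n)"
      unfolding s_def of_nat_sum by (intro sum.cong) auto
    then show ?thesis by (simp add: partial_exponent_def)
  qed
  define X where "X n = op_prod_list (map (\<lambda>l. (\<beta> ^^ partial_exponent \<alpha> p n l) (a l)) [1..<Suc k])" for n
  define b where "b = polynomial_average \<beta> r k \<alpha> p a"
  have XA: "X n \<in> A" for n
    unfolding X_def by (intro vn_op_prod_list \<beta>pow assms(9)) auto
  have b_avg: "b N = P.avg N X" for N
    unfolding b_def polynomial_average_def P.avg_def X_def by (simp add: card_PiE del: upt_Suc)
  have bA: "b N \<in> A" for N
    unfolding b_avg P.avg_def by (intro vn_scaleR vn_sum XA)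
  \<comment> \<open>Contractivity of \<beta> gives one bound for all \<open>n\<close>, however large
    the exponents.\<close>
  have "norm (X n) \<le> (\<Prod>l\<leftarrow>[1..<Suc k]. norm (a l))" for n
    unfolding X_def by (intro norm_op_prod_list_le \<beta>pow assms(9)) auto
  moreover have "0 \<le> (\<Prod>l\<leftarrow>[1..<Suc k]. norm (a l))" by (intro prod_list_nonneg) auto
  ultimately have b_bound: "norm (b N) \<le> (\<Prod>l\<leftarrow>[1..<Suc k]. norm (a l))" for N
    unfolding b_avg by (rule P.norm_avg_le)

  \<comment> \<open>The telescoped product applied to the vector of the unit; it agrees with
    \<open>\<Lambda> (X n)\<close> at the indices from the boxes.\<close>
  define G where "G n = blinfun_apply (op_pow u (q 1 n))
    (foldr (\<lambda>l x. blinfun_apply (\<pi> (a l)) (blinfun_apply (op_pow u (q (Suc l) n)) x)) [1..<k]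
      (blinfun_apply (\<pi> (a k)) (blinfun_apply (op_pow (op_inv u) (s k n)) (\<Lambda> id_blinfun))))" for n
  have k: "1 \<le> k" using assms(5,6) by simp
  have "P.good G"
    unfolding G_def
    by (rule P.good_entangled[where a="\<lambda>l. \<pi> (a l)" and q=q and s="s k", OF assms(3) k \<pi>_ops[OF assms(9)] q_phase s_phase assms(10,11)])
  then obtain h where h: "(\<lambda>N. P.avg N G) \<longlonglongrightarrow> h"
    using P.good_convergent_avg convergent_def by blast
  have LX: "\<Lambda> (X n) = G n" if n: "n \<in> P.idx" for n
  proof -
    obtain N where N: "n \<in> {1..r} \<rightarrow>\<^sub>E {1..N}" using n unfolding P.idx_def by blast
    have "\<Lambda> (X n) = foldr (\<lambda>l. blinfun_apply (\<pi> ((\<beta> ^^ partial_exponent \<alpha> p n l) (a l)))) [1..<Suc k] (\<Lambda> id_blinfun)"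
      unfolding X_def by (intro Lprod \<beta>pow assms(9)) auto
    also have "\<dots> = blinfun_apply (op_pow u (s 1 n))
      (foldr (\<lambda>l x. blinfun_apply (\<pi> (a l)) (blinfun_apply (op_pow u (q (Suc l) n)) x)) [1..<k]
      (blinfun_apply (\<pi> (a k)) (blinfun_apply (op_pow (op_inv u) (s k n)) (\<Lambda> id_blinfun))))"
      by (rule conjugated_product_telescopes[OF assms(3), where s="\<lambda>l. s l n"])
        (use k in \<open>simp_all add: exponent[OF N] \<pi>\<beta> assms(9) s_def\<close>)
    finally show ?thesis by (simp add: G_def s_def)
  qed
  have "\<Lambda> (b N) = P.avg N (\<lambda>n. \<Lambda> (X n))" for N
    unfolding b_avg P.avg_def by (simp add: LscaleR Lsum vn_sum XA)
  also have "P.avg N (\<lambda>n. \<Lambda> (X n)) = P.avg N G" for N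
    by (rule P.avg_cong) (rule LX)
  finally have lim: "(\<lambda>N. \<Lambda> (b N)) \<longlonglongrightarrow> h" using h by simp
  obtain c where c: "c \<in> A" "\<Lambda> c = h"
    using gns_bounded_limit[OF normal gns dense bA b_bound lim] by blast
  have "(\<lambda>N. norm (\<Lambda> (b N) - h)) \<longlonglongrightarrow> 0" using lim by (simp add: LIM_zero tendsto_norm_zero)
  moreover have "trace_norm \<phi> (b N - c) = norm (\<Lambda> (b N) - h)" for N
    using bA c by (simp add: tn vn_diff Ldiff)
  ultimately have "(\<lambda>N. trace_norm \<phi> (b N - c)) \<longlonglongrightarrow> 0" by simp
  with c(1) show ?thesis
    unfolding strongly_convergent_def b_def by blast
qed

end
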